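(* There is a polynomial-time algorithm for Robust Interval Scheduling.
   Context: Robust Interval Scheduling: the input is a finite set $I=\{i_1,\dots,i_n\}$ of jobs, job $i_j$ being a half-open interval $[a_j,b_j)$ with $a_j,b_j\in\mathbb{N}$, $a_j\le b_j$, together with weights $w:I\to\mathbb{R}_{\ge0}$. Let $\mathcal{F}$ be the family of subsets of $I$ consisting of pairwise disjoint intervals. The task is to solve $$\max_{S\in\mathcal{F}}\ \min_{f\in I\cup\{\emptyset\}}\ \max_{\substack{e\in (I\setminus(S\cup\{f\}))\cup\{\emptyset\}\\ (S\setminus\{f\})\cup\{e\}\in\mathcal{F}}} w\big((S\setminus\{f\})\cup\{e\}\big),$$ where $w$ of a set is the sum of weights, $f=\emptyset$ means no job is deleted and $e=\emptyset$ means no job is added (i.e., output an optimal first-stage solution $S$). *)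

theory Defs
  imports Complex_Main
begin

text \<open>An instance with n jobs: job j (j < n) is the half-open interval [a j, b j)
  of naturals with weight w j.  Jobs are identified by their index, so
  I = {0..<n}.\<close>

definition ival :: "(nat \<Rightarrow> nat) \<Rightarrow> (nat \<Rightarrow> nat) \<Rightarrow> nat \<Rightarrow> nat set" where
  "ival a b j = {a j..<b j}"

definition feasible :: "nat \<Rightarrow> (nat \<Rightarrow> nat) \<Rightarrow> (nat \<Rightarrow> nat) \<Rightarrow> nat set \<Rightarrow> bool" where
  "feasible n a b S \<longleftrightarrow> S \<subseteq> {..<n} \<and>
     (\<forall>i\<in>S. \<forall>j\<in>S. i \<noteq> j \<longrightarrow> ival a b i \<inter> ival a b j = {})"

definition wt :: "(nat \<Rightarrow> real) \<Rightarrow> nat set \<Rightarrow> real" where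
  "wt w S = (\<Sum>j\<in>S. w j)"

fun del :: "nat set \<Rightarrow> nat option \<Rightarrow> nat set" where
  "del S None = S"
| "del S (Some f) = S - {f}"

fun addj :: "nat set \<Rightarrow> nat option \<Rightarrow> nat set" where
  "addj S None = S"
| "addj S (Some e) = insert e S"

definition choices :: "nat set \<Rightarrow> nat option set" where
  "choices A = insert None (Some ` A)"

definition repair_val ::
  "nat \<Rightarrow> (nat \<Rightarrow> nat) \<Rightarrow> (nat \<Rightarrow> nat) \<Rightarrow> (nat \<Rightarrow> real) \<Rightarrow> nat set \<Rightarrow> nat option \<Rightarrow> real" where
  "repair_val n a b w S f =
     Max ((\<lambda>e. wt w (addj (del S f) e)) `
          {e \<in> choices ({..<n} - (S \<union> set_option f)). feasible n a b (addj (del S f) e)})"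

definition robust_val ::
  "nat \<Rightarrow> (nat \<Rightarrow> nat) \<Rightarrow> (nat \<Rightarrow> nat) \<Rightarrow> (nat \<Rightarrow> real) \<Rightarrow> nat set \<Rightarrow> real" where
  "robust_val n a b w S = Min (repair_val n a b w S ` choices {..<n})"

definition robust_optimal ::
  "nat \<Rightarrow> (nat \<Rightarrow> nat) \<Rightarrow> (nat \<Rightarrow> nat) \<Rightarrow> (nat \<Rightarrow> real) \<Rightarrow> nat set \<Rightarrow> bool" where
  "robust_optimal n a b w S \<longleftrightarrow> feasible n a b S \<and>
     (\<forall>T. feasible n a b T \<longrightarrow> robust_val n a b w T \<le> robust_val n a b w S)"

text \<open>A random access machine with an integer register file I (constants,
  addition, subtraction, comparison, indirect addressing) and a real register
  file R (integer constants, addition, subtraction, comparison, indirect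
  addressing via integer registers), every instruction costing one step.
  There is no conversion from reals to integers and no multiplication, so the
  model is polynomially equivalent to Turing machines on the integer part and
  is the standard arithmetic model on the real weights.  The machine halts when
  the program counter leaves the program.\<close>

datatype instr =
    IConst nat int
  | IAdd nat nat nat
  | ISub nat nat nat
  | ILoad nat nat
  | IStore nat nat
  | RConst nat int
  | RAdd nat nat nat
  | RSub nat nat nat
  | RLoad nat nat
  | RStore nat nat
  | IJle nat nat nat
  | RJle nat nat nat

record mstate =
  pc :: nat
  ireg :: "nat \<Rightarrow> int"
  rreg :: "nat \<Rightarrow> real"

fun exec :: "instr \<Rightarrow> mstate \<Rightarrow> mstate" where
  "exec (IConst r c) s = s\<lparr>pc := Suc (pc s), ireg := (ireg s)(r := c)\<rparr>"
| "exec (IAdd r x y) s = s\<lparr>pc := Suc (pc s), ireg := (ireg s)(r := ireg s x + ireg s y)\<rparr>"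
| "exec (ISub r x y) s = s\<lparr>pc := Suc (pc s), ireg := (ireg s)(r := ireg s x - ireg s y)\<rparr>"
| "exec (ILoad r x) s = s\<lparr>pc := Suc (pc s), ireg := (ireg s)(r := ireg s (nat (ireg s x)))\<rparr>"
| "exec (IStore x r) s = s\<lparr>pc := Suc (pc s), ireg := (ireg s)(nat (ireg s x) := ireg s r)\<rparr>"
| "exec (RConst r c) s = s\<lparr>pc := Suc (pc s), rreg := (rreg s)(r := of_int c)\<rparr>"
| "exec (RAdd r x y) s = s\<lparr>pc := Suc (pc s), rreg := (rreg s)(r := rreg s x + rreg s y)\<rparr>"
| "exec (RSub r x y) s = s\<lparr>pc := Suc (pc s), rreg := (rreg s)(r := rreg s x - rreg s y)\<rparr>"
| "exec (RLoad r x) s = s\<lparr>pc := Suc (pc s), rreg := (rreg s)(r := rreg s (nat (ireg s x)))\<rparr>"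
| "exec (RStore x r) s = s\<lparr>pc := Suc (pc s), rreg := (rreg s)(nat (ireg s x) := rreg s r)\<rparr>"
| "exec (IJle x y t) s = s\<lparr>pc := (if ireg s x \<le> ireg s y then t else Suc (pc s))\<rparr>"
| "exec (RJle x y t) s = s\<lparr>pc := (if rreg s x \<le> rreg s y then t else Suc (pc s))\<rparr>"

definition halted :: "instr list \<Rightarrow> mstate \<Rightarrow> bool" where
  "halted prog s \<longleftrightarrow> length prog \<le> pc s"

definition step :: "instr list \<Rightarrow> mstate \<Rightarrow> mstate" where
  "step prog s = (if halted prog s then s else exec (prog ! pc s) s)"

definition run :: "instr list \<Rightarrow> nat \<Rightarrow> mstate \<Rightarrow> mstate" where
  "run prog t s = (step prog ^^ t) s"

text \<open>Input encoding: I[0] = n, I[1+2j] = a_j, I[2+2j] = b_j, R[j] = w_j (j < n),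
  all other registers 0.  Output: job j < n is in S iff I[j] \<noteq> 0 on halting.\<close>

definition init :: "nat \<Rightarrow> (nat \<Rightarrow> nat) \<Rightarrow> (nat \<Rightarrow> nat) \<Rightarrow> (nat \<Rightarrow> real) \<Rightarrow> mstate" where
  "init n a b w =
     \<lparr>pc = 0,
      ireg = (\<lambda>k. if k = 0 then int n
                 else if k \<le> 2 * n then
                   (if odd k then int (a ((k - 1) div 2)) else int (b ((k - 2) div 2)))
                 else 0),
      rreg = (\<lambda>k. if k < n then w k else 0)\<rparr>"

definition ram_output :: "nat \<Rightarrow> mstate \<Rightarrow> nat set" where
  "ram_output n s = {j. j < n \<and> ireg s j \<noteq> 0}"

text \<open>Input size: number of jobs plus binary lengths of the endpoints
  (weights are real numbers, each of unit size).\<close>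

fun bitlen :: "nat \<Rightarrow> nat" where
  "bitlen k = (if k \<le> 1 then 1 else Suc (bitlen (k div 2)))"

definition input_size :: "nat \<Rightarrow> (nat \<Rightarrow> nat) \<Rightarrow> (nat \<Rightarrow> nat) \<Rightarrow> nat" where
  "input_size n a b = n + (\<Sum>j<n. bitlen (a j) + bitlen (b j))"

end

theory Submission
  imports Defs
begin

text \<open>After moving empty intervals out of the way, disjointness of intervals is comparability in a
  strict order, so feasible sets are chains.  If \<open>f\<close> is deleted from a chain \<open>S\<close>, a job that can
  replace it either fits into \<open>S\<close> itself or lies between the two neighbours of \<open>f\<close>.  Guess the two
  best jobs \<open>p\<close> and \<open>q\<close> that can be added to \<open>S\<close>, and the difference \<open>\<mu>\<close> between the robust value and
  \<open>w(S)\<close>, which is always a difference of two weights.  For a fixed guess the robustness condition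
  is local, it only concerns triples of consecutive elements of the chain.  Hence a heaviest
  admissible chain is a heaviest path in the graph whose vertices are the pairs of consecutive
  elements, and this is computed by relaxing all edges \<open>n + 2\<close> times.

  The algorithm is written in a language all of whose loops have length \<open>n + 2\<close>, which makes
  termination and polynomial running time automatic, and is compiled to the machine.\<close>

section \<open>Structured programs for the machine\<close>

text \<open>Two candidates suffice because the adversary takes away only one job: if
  \<open>f\<close> is not in \<open>S\<close>, at most one of the two best additions is lost. A
  replacement that conflicts with the deleted \<open>f\<close> but with nothing else in
  \<open>S\<close> inherits every order relation of \<open>f\<close>; this is why it sits between
  the neighbours, and why triples see everything. The gap \<mu> is a difference of two weights
  because an optimal play loses at most one job and gains at most one. Guesses need not be right.
  Every admissible chain for a guess certifies the lower bound \<open>w(S) + \<mu>\<close> on its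
  robust value, and each feasible set has a guess for which this bound is exact. Hence maximising
  over all guesses, wrong ones included, yields the optimum. The machine shapes the rest. Without
  multiplication, multiples and powers are tabulated by repeated addition, and a chain is kept as
  one integer beside its value. Input and output occupy the low registers that a program needs for
  its own work, so the compiled algorithm is wrapped in hand-written code that moves data in and
  out.\<close>

type_synonym mem = "(nat \<Rightarrow> int) \<times> (nat \<Rightarrow> real)"

definition mem_of :: "mstate \<Rightarrow> mem" where
  "mem_of s = (ireg s, rreg s)"

fun is_jump :: "instr \<Rightarrow> bool" where
  "is_jump (IJle _ _ _) = True"
| "is_jump (RJle _ _ _) = True"
| "is_jump _ = False"

definition mexec :: "instr \<Rightarrow> mem \<Rightarrow> mem" where
  "mexec i m = mem_of (exec i \<lparr>pc = 0, ireg = fst m, rreg = snd m\<rparr>)"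

lemma mexec_simps [simp]:
  "mexec (IConst r c) m = ((fst m)(r := c), snd m)"
  "mexec (IAdd r x y) m = ((fst m)(r := fst m x + fst m y), snd m)"
  "mexec (ISub r x y) m = ((fst m)(r := fst m x - fst m y), snd m)"
  "mexec (ILoad r x) m = ((fst m)(r := fst m (nat (fst m x))), snd m)"
  "mexec (IStore x r) m = ((fst m)(nat (fst m x) := fst m r), snd m)"
  "mexec (RConst r c) m = (fst m, (snd m)(r := of_int c))"
  "mexec (RAdd r x y) m = (fst m, (snd m)(r := snd m x + snd m y))"
  "mexec (RSub r x y) m = (fst m, (snd m)(r := snd m x - snd m y))"
  "mexec (RLoad r x) m = (fst m, (snd m)(r := snd m (nat (fst m x))))"
  "mexec (RStore x r) m = (fst m, (snd m)(nat (fst m x) := snd m r))"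
  by (simp_all add: mexec_def mem_of_def)

lemma exec_nonjump:
  "\<not> is_jump i \<Longrightarrow> pc (exec i s) = Suc (pc s) \<and> mem_of (exec i s) = mexec i (mem_of s)"
  by (cases i) (simp_all add: mem_of_def)

section \<open>Structured control flow with step counts\<close>

datatype test = TI nat nat | TR nat nat

fun holds :: "test \<Rightarrow> mem \<Rightarrow> bool" where
  "holds (TI x y) m \<longleftrightarrow> fst m x \<le> fst m y"
| "holds (TR x y) m \<longleftrightarrow> snd m x \<le> snd m y"

fun jump_if :: "test \<Rightarrow> nat \<Rightarrow> instr" where
  "jump_if (TI x y) t = IJle x y t"
| "jump_if (TR x y) t = RJle x y t"

lemma exec_jump_if [simp]:
  "pc (exec (jump_if b t) s) = (if holds b (mem_of s) then t else Suc (pc s))"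
  "mem_of (exec (jump_if b t) s) = mem_of s"
  by (cases b; simp add: mem_of_def)+

text \<open>The loop leaves when its test holds, because the machine jumps on \<open>\<le>\<close>
  only and the compiled test is the forward exit jump.\<close>

datatype scom =
    Blk "instr list"
  | Sq scom scom
  | Ite test scom scom
  | Until test scom

text \<open>The count is an upper bound on machine steps. Both branches of \<open>Ite\<close> are
  charged 2, for the test and for the jump over the other branch, although the branch placed last
  runs into the exit without a jump. A loop iteration pays 2 for the test and the jump back.\<close>

inductive big_step :: "scom \<Rightarrow> mem \<Rightarrow> nat \<Rightarrow> mem \<Rightarrow> bool" where
  Blk: "\<forall>i\<in>set is. \<not> is_jump i \<Longrightarrow> big_step (Blk is) m (length is) (fold mexec is m)"
| Sq: "big_step c m t m' \<Longrightarrow> big_step d m' u m'' \<Longrightarrow> big_step (Sq c d) m (t + u) m''"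
| IteT: "holds b m \<Longrightarrow> big_step c m t m' \<Longrightarrow> big_step (Ite b c d) m (t + 2) m'"
| IteF: "\<not> holds b m \<Longrightarrow> big_step d m t m' \<Longrightarrow> big_step (Ite b c d) m (t + 2) m'"
| UntilT: "holds b m \<Longrightarrow> big_step (Until b c) m 1 m"
| UntilF: "\<not> holds b m \<Longrightarrow> big_step c m t m' \<Longrightarrow> big_step (Until b c) m' u m'' \<Longrightarrow>
    big_step (Until b c) m (t + u + 2) m''"

fun size_of :: "scom \<Rightarrow> nat" where
  "size_of (Blk is) = length is"
| "size_of (Sq c d) = size_of c + size_of d"
| "size_of (Ite b c d) = size_of c + size_of d + 2"
| "size_of (Until b c) = size_of c + 2"

text \<open>Jumps are absolute, so the load address \<open>k\<close> is threaded through.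
  \<open>IJle 0 0\<close> is the unconditional jump, and the else-branch comes first because a
  successful test is the one that jumps.\<close>

fun assemble :: "nat \<Rightarrow> scom \<Rightarrow> instr list" where
  "assemble k (Blk is) = is"
| "assemble k (Sq c d) = assemble k c @ assemble (k + size_of c) d"
| "assemble k (Ite b c d) = jump_if b (k + size_of d + 2) # assemble (Suc k) d @
     IJle 0 0 (k + size_of d + size_of c + 2) # assemble (k + size_of d + 2) c"
| "assemble k (Until b c) = jump_if b (k + size_of c + 2) # assemble (Suc k) c @ [IJle 0 0 k]"

lemma length_assemble [simp]: "length (assemble k c) = size_of c"
  by (induction c arbitrary: k) auto

section \<open>Code placement and timed reachability\<close>

definition code_at :: "instr list \<Rightarrow> nat \<Rightarrow> instr list \<Rightarrow> bool" where
  "code_at prog k is \<longleftrightarrow> (\<exists>xs ys. prog = xs @ is @ ys \<and> length xs = k)"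

lemma code_at_append:
  "code_at prog k (is @ js) \<longleftrightarrow> code_at prog k is \<and> code_at prog (k + length is) js"
proof
  assume "code_at prog k (is @ js)"
  then obtain xs ys where e: "prog = xs @ is @ js @ ys" "length xs = k"
    by (auto simp: code_at_def)
  have "code_at prog k is" unfolding code_at_def using e by blast
  moreover have "code_at prog (k + length is) js" unfolding code_at_def
    using e by (intro exI[of _ "xs @ is"] exI[of _ ys]) simp
  ultimately show "code_at prog k is \<and> code_at prog (k + length is) js" ..
next
  assume "code_at prog k is \<and> code_at prog (k + length is) js"
  then obtain xs ys xs' ys' where e: "prog = xs @ is @ ys" "length xs = k"
    "prog = xs' @ js @ ys'" "length xs' = k + length is"
    unfolding code_at_def by blast
  then have "xs @ is = xs'"
    by (metis append.assoc append_eq_append_conv length_append)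
  with e(2,3) have "prog = xs @ (is @ js) @ ys'" by simp
  with e(2) show "code_at prog k (is @ js)" unfolding code_at_def by blast
qed

lemma code_at_Cons:
  "code_at prog k (i # js) \<longleftrightarrow> code_at prog k [i] \<and> code_at prog (Suc k) js"
  using code_at_append[of prog k "[i]" js] by simp

lemma step_code_at:
  "code_at prog (pc s) [i] \<Longrightarrow> step prog s = exec i s"
  by (auto simp: code_at_def step_def halted_def nth_append)

lemma run_0: "run prog 0 s = s"
  by (simp add: run_def)

lemma run_Suc: "run prog (Suc t) s = run prog t (step prog s)"
  by (simp add: run_def funpow_Suc_right del: funpow.simps)

lemma run_add: "run prog (t + u) s = run prog u (run prog t s)"
  by (induction t arbitrary: s) (simp_all add: run_0 run_Suc)

definition reaches :: "instr list \<Rightarrow> mstate \<Rightarrow> nat \<Rightarrow> nat \<Rightarrow> mem \<Rightarrow> bool" where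
  "reaches prog s t k m \<longleftrightarrow> (\<exists>u\<le>t. pc (run prog u s) = k \<and> mem_of (run prog u s) = m)"

lemma reaches_refl: "pc s = k \<Longrightarrow> mem_of s = m \<Longrightarrow> reaches prog s 0 k m"
  by (simp add: reaches_def run_0)

lemma reaches_step:
  "reaches prog (step prog s) t k m \<Longrightarrow> reaches prog s (Suc t) k m"
  unfolding reaches_def by (metis Suc_le_mono run_Suc)

lemma reaches_trans:
  assumes "reaches prog s t k m"
    and "\<And>s'. pc s' = k \<Longrightarrow> mem_of s' = m \<Longrightarrow> reaches prog s' u k' m'"
  shows "reaches prog s (t + u) k' m'"
proof -
  obtain v where v: "v \<le> t" "pc (run prog v s) = k" "mem_of (run prog v s) = m"
    using assms(1) by (auto simp: reaches_def)
  from assms(2)[OF v(2,3)] obtain x where "x \<le> u" "pc (run prog x (run prog v s)) = k'"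
    "mem_of (run prog x (run prog v s)) = m'" by (auto simp: reaches_def)
  with v(1) show ?thesis
    unfolding reaches_def by (intro exI[of _ "v + x"]) (simp add: run_add)
qed

lemma reaches_mono: "reaches prog s t k m \<Longrightarrow> t \<le> u \<Longrightarrow> reaches prog s u k m"
  unfolding reaches_def using le_trans by blast

lemma reaches_block:
  assumes "code_at prog (pc s) is" "\<forall>i\<in>set is. \<not> is_jump i"
  shows "reaches prog s (length is) (pc s + length is) (fold mexec is (mem_of s))"
  using assms
proof (induction "is" arbitrary: s)
  case Nil
  then show ?case by (simp add: reaches_refl)
next
  case (Cons i "is")
  then have c: "code_at prog (pc s) [i]" "code_at prog (Suc (pc s)) is"
    using code_at_Cons by blast+
  have e: "step prog s = exec i s" by (rule step_code_at[OF c(1)])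
  have x: "pc (exec i s) = Suc (pc s)" "mem_of (exec i s) = mexec i (mem_of s)"
    using exec_nonjump Cons.prems(2) by simp_all
  have "reaches prog (exec i s) (length is) (Suc (pc s) + length is) (fold mexec is (mexec i (mem_of
    s)))"
    using Cons.IH[of "exec i s"] c(2) Cons.prems(2) by (simp add: x)
  then have "reaches prog (step prog s) (length is) (pc s + length (i # is))
    (fold mexec (i # is) (mem_of s))"
    by (simp add: e)
  from reaches_step[OF this] show ?case by simp
qed

text \<open>Every construct is entered at its first instruction and left at the address just behind
  its last one, so sequential composition is concatenation of code, and a whole program placed at 0
  ends at its own length, where the machine halts.\<close>

theorem big_step_reaches:
  assumes "big_step c m t m'" "code_at prog (pc s) (assemble (pc s) c)" "mem_of s = m"
  shows "reaches prog s t (pc s + size_of c) m'"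
  using assms
proof (induction c m t m' arbitrary: s rule: big_step.induct)
  case (Blk "is" m)
  then show ?case using reaches_block by auto
next
  case (Sq c m t m' d u m'')
  have c: "code_at prog (pc s) (assemble (pc s) c)"
    "code_at prog (pc s + size_of c) (assemble (pc s + size_of c) d)"
    using Sq.prems(1) by (simp_all add: code_at_append)
  have "reaches prog s (t + u) (pc s + size_of c + size_of d) m''"
  proof (rule reaches_trans[OF Sq.IH(1)[OF c(1) Sq.prems(2)]])
    fix s' assume "pc s' = pc s + size_of c" "mem_of s' = m'"
    then show "reaches prog s' u (pc s + size_of c + size_of d) m''"
      using Sq.IH(2)[of s'] c(2) by simp
  qed
  then show ?case by (simp add: add.assoc)
next
  case (IteT b m c t m' d)
  have c: "code_at prog (pc s) [jump_if b (pc s + size_of d + 2)]"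
    "code_at prog (pc s + size_of d + 2) (assemble (pc s + size_of d + 2) c)"
    using IteT.prems(1) by (simp_all add: code_at_append code_at_Cons[of _ _ _ "_ @ _"]
      code_at_Cons[of _ _ _ "assemble _ _"])
  let ?s = "exec (jump_if b (pc s + size_of d + 2)) s"
  have x: "pc ?s = pc s + size_of d + 2" "mem_of ?s = m"
    using IteT.hyps(1) IteT.prems(2) by auto
  have "reaches prog ?s t (pc s + size_of d + 2 + size_of c) m'"
    using IteT.IH[of ?s] c(2) x by simp
  then have "reaches prog s (Suc t) (pc s + size_of d + 2 + size_of c) m'"
    using reaches_step step_code_at[OF c(1)] by simp
  moreover have "pc s + size_of d + 2 + size_of c = pc s + size_of (Ite b c d)" by simp
  ultimately show ?case using reaches_mono[of prog s "Suc t" _ m' "t + 2"] by (simp add: ac_simps)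
next
  case (IteF b m d t m' c)
  let ?k = "pc s + size_of d + size_of c + 2"
  have c: "code_at prog (pc s) [jump_if b (pc s + size_of d + 2)]"
    "code_at prog (Suc (pc s)) (assemble (Suc (pc s)) d)"
    "code_at prog (Suc (pc s + size_of d)) [IJle 0 0 ?k]"
    using IteF.prems(1) by (simp_all add: code_at_append code_at_Cons[of _ _ _ "_ @ _"]
      code_at_Cons[of _ _ _ "assemble _ _"])
  let ?s = "exec (jump_if b (pc s + size_of d + 2)) s"
  have x: "pc ?s = Suc (pc s)" "mem_of ?s = m"
    using IteF.hyps(1) IteF.prems(2) by auto
  have "reaches prog ?s t (Suc (pc s) + size_of d) m'"
    using IteF.IH[of ?s] c(2) x by simp
  moreover have "reaches prog s' 1 ?k m'" if "pc s' = Suc (pc s) + size_of d" "mem_of s' = m'" for s'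
  proof -
    have "step prog s' = exec (IJle 0 0 ?k) s'" using step_code_at c(3) that(1) by simp
    then have "reaches prog (step prog s') 0 ?k m'"
      using that(2) by (intro reaches_refl) (simp_all add: mem_of_def)
    from reaches_step[OF this] show ?thesis by simp
  qed
  ultimately have "reaches prog ?s (t + 1) ?k m'" by (rule reaches_trans)
  then have "reaches prog s (Suc (t + 1)) ?k m'"
    using reaches_step step_code_at[OF c(1)] by metis
  then show ?case by (simp add: algebra_simps)
next
  case (UntilT b m c)
  have c: "code_at prog (pc s) [jump_if b (pc s + size_of c + 2)]"
    using UntilT.prems(1) by (simp add: code_at_Cons[of _ _ _ "_ @ _"])
  have "reaches prog (step prog s) 0 (pc s + size_of c + 2) m"
    using UntilT.hyps UntilT.prems(2) step_code_at[OF c] by (intro reaches_refl) auto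
  from reaches_step[OF this] show ?case by simp
next
  case (UntilF b m c t m' u m'')
  have c: "code_at prog (pc s) [jump_if b (pc s + size_of c + 2)]"
    "code_at prog (Suc (pc s)) (assemble (Suc (pc s)) c)"
    "code_at prog (Suc (pc s + size_of c)) [IJle 0 0 (pc s)]"
    using UntilF.prems(1) by (simp_all add: code_at_append code_at_Cons[of _ _ _ "_ @ _"])
  let ?s = "exec (jump_if b (pc s + size_of c + 2)) s"
  let ?k = "pc s + size_of (Until b c)"
  have x: "pc ?s = Suc (pc s)" "mem_of ?s = m"
    using UntilF.hyps(1) UntilF.prems(2) by auto
  have "reaches prog ?s t (Suc (pc s) + size_of c) m'"
    using UntilF.IH(1)[of ?s] c(2) x by simp
  moreover have "reaches prog s' (Suc u) ?k m''"
    if "pc s' = Suc (pc s) + size_of c" "mem_of s' = m'" for s'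
  proof -
    have "step prog s' = exec (IJle 0 0 (pc s)) s'" using step_code_at c(3) that(1) by simp
    then have "pc (step prog s') = pc s" "mem_of (step prog s') = m'"
      using that(2) by (simp_all add: mem_of_def)
    then have "reaches prog (step prog s') u ?k m''"
      using UntilF.IH(2)[of "step prog s'"] UntilF.prems(1) by simp
    then show ?thesis by (rule reaches_step)
  qed
  ultimately have "reaches prog ?s (t + Suc u) ?k m''" by (rule reaches_trans)
  then have "reaches prog s (Suc (t + Suc u)) ?k m''"
    using reaches_step step_code_at[OF c(1)] by metis
  then show ?case by simp
qed

lemma run_halted: "halted prog s \<Longrightarrow> run prog t s = s"
  by (induction t) (simp_all add: run_0 run_Suc step_def)

text \<open>A halted machine stays put, so the run may be observed at any later time
  \<open>u\<close>. The final theorem observes it after a fixed polynomial number of steps.\<close>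

corollary big_step_run:
  assumes "big_step c (mem_of s) t m" "pc s = 0" "t \<le> u"
  shows "halted (assemble 0 c) (run (assemble 0 c) u s)"
    and "mem_of (run (assemble 0 c) u s) = m"
proof -
  let ?p = "assemble 0 c"
  have "code_at ?p 0 ?p" unfolding code_at_def by (intro exI[of _ "[]"]) simp
  then have "reaches ?p s t (size_of c) m"
    using big_step_reaches[OF assms(1), of ?p s] assms(2) by simp
  then obtain v where v: "v \<le> t" "pc (run ?p v s) = size_of c" "mem_of (run ?p v s) = m"
    by (auto simp: reaches_def)
  then have h: "halted ?p (run ?p v s)" by (simp add: halted_def)
  have "run ?p u s = run ?p (u - v) (run ?p v s)"
    using run_add[of ?p v "u - v" s] v(1) assms(3) by simp
  then have "run ?p u s = run ?p v s" using run_halted[OF h] by simp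
  with h v(3) show "halted ?p (run ?p u s)" "mem_of (run ?p u s) = m" by simp_all
qed

section \<open>A loop language with arrays\<close>

datatype ivar = Jobs | Cand1 | Cand2 | Gain | Loss | Rnd | Fst | Snd | Thd | Alt | Ok | Acc | BestSet
datatype rvar = Slack | BestVal
datatype iarr = Beg | End | Row | Pow | Sel
datatype rarr = Wt | Val | Out

record env =
  iv :: "ivar \<Rightarrow> nat"
  rv :: "rvar \<Rightarrow> real"
  ia :: "iarr \<Rightarrow> nat \<Rightarrow> nat"
  ra :: "rarr \<Rightarrow> nat \<Rightarrow> real"

datatype iexp = IC nat | IV ivar | Bound | IPlus iexp iexp | IA iarr iexp
datatype rexp = RC int | RV rvar | RPlus rexp rexp | RMinus rexp rexp | RA rarr iexp
datatype bexp = ILe iexp iexp | RLe rexp rexp | Neg bexp | Conj bexp bexp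

datatype com =
    Skip
  | ISet ivar iexp
  | IPut iarr iexp iexp
  | RSet rvar rexp
  | RPut rarr iexp rexp
  | Seq com com (infixr ";;" 60)
  | Cond bexp com com
  | For ivar com

text \<open>Every loop runs over the range \<open>0..<N\<close> of one global bound, so the running time of a
  program is a polynomial in \<open>N\<close> whatever it computes.\<close>

fun ieval :: "nat \<Rightarrow> iexp \<Rightarrow> env \<Rightarrow> nat" where
  "ieval N (IC k) s = k"
| "ieval N (IV x) s = iv s x"
| "ieval N Bound s = N"
| "ieval N (IPlus e f) s = ieval N e s + ieval N f s"
| "ieval N (IA q e) s = ia s q (ieval N e s)"

fun reval :: "nat \<Rightarrow> rexp \<Rightarrow> env \<Rightarrow> real" where
  "reval N (RC k) s = of_int k"
| "reval N (RV x) s = rv s x"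
| "reval N (RPlus e f) s = reval N e s + reval N f s"
| "reval N (RMinus e f) s = reval N e s - reval N f s"
| "reval N (RA q e) s = ra s q (ieval N e s)"

fun beval :: "nat \<Rightarrow> bexp \<Rightarrow> env \<Rightarrow> bool" where
  "beval N (ILe e f) s \<longleftrightarrow> ieval N e s \<le> ieval N f s"
| "beval N (RLe e f) s \<longleftrightarrow> reval N e s \<le> reval N f s"
| "beval N (Neg b) s \<longleftrightarrow> \<not> beval N b s"
| "beval N (Conj b c) s \<longleftrightarrow> beval N b s \<and> beval N c s"

definition set_iv :: "ivar \<Rightarrow> nat \<Rightarrow> env \<Rightarrow> env" where
  "set_iv x v s = s\<lparr>iv := (iv s)(x := v)\<rparr>"

definition loop :: "nat \<Rightarrow> ivar \<Rightarrow> (env \<Rightarrow> env) \<Rightarrow> env \<Rightarrow> env" where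
  "loop k x f s = fold (\<lambda>i s. f (set_iv x i s)) [0..<k] s"

lemma loop_0: "loop 0 x f s = s"
  by (simp add: loop_def)

lemma loop_Suc: "loop (Suc k) x f s = f (set_iv x k (loop k x f s))"
  by (simp add: loop_def)

fun sem :: "nat \<Rightarrow> com \<Rightarrow> env \<Rightarrow> env" where
  "sem N Skip s = s"
| "sem N (ISet x e) s = set_iv x (ieval N e s) s"
| "sem N (IPut q e f) s = s\<lparr>ia := (ia s)(q := (ia s q)(ieval N e s := ieval N f s))\<rparr>"
| "sem N (RSet x e) s = s\<lparr>rv := (rv s)(x := reval N e s)\<rparr>"
| "sem N (RPut q e f) s = s\<lparr>ra := (ra s)(q := (ra s q)(ieval N e s := reval N f s))\<rparr>"
| "sem N (c ;; d) s = sem N d (sem N c s)"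
| "sem N (Cond b c d) s = (if beval N b s then sem N c s else sem N d s)"
| "sem N (For x c) s = loop N x (sem N c) s"

section \<open>Compilation\<close>

text \<open>Register 0 holds the loop bound, the registers congruent to 0 modulo 8 the variables,
  those congruent to 1 the temporaries, and every array occupies one of the other residue
  classes modulo 8.\<close>

fun iaddr :: "ivar \<Rightarrow> nat" where
  "iaddr Jobs = 8" | "iaddr Cand1 = 16" | "iaddr Cand2 = 24" | "iaddr Gain = 32"
| "iaddr Loss = 40" | "iaddr Rnd = 48" | "iaddr Fst = 56" | "iaddr Snd = 64"
| "iaddr Thd = 72" | "iaddr Alt = 80" | "iaddr Ok = 88" | "iaddr Acc = 96"
| "iaddr BestSet = 104"

fun raddr :: "rvar \<Rightarrow> nat" where
  "raddr Slack = 0" | "raddr BestVal = 8"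

fun ibase :: "iarr \<Rightarrow> nat" where
  "ibase Beg = 2" | "ibase End = 3" | "ibase Row = 4" | "ibase Pow = 5" | "ibase Sel = 6"

fun rbase :: "rarr \<Rightarrow> nat" where
  "rbase Wt = 2" | "rbase Val = 3" | "rbase Out = 4"

definition tmp :: "nat \<Rightarrow> nat" where
  "tmp d = 8 * d + 1"

definition represents :: "nat \<Rightarrow> env \<Rightarrow> mem \<Rightarrow> bool" where
  "represents N s m \<longleftrightarrow> fst m 0 = int N \<and>
     (\<forall>x. fst m (iaddr x) = int (iv s x)) \<and> (\<forall>x. snd m (raddr x) = rv s x) \<and>
     (\<forall>q i. fst m (8 * i + ibase q) = int (ia s q i)) \<and>
     (\<forall>q i. snd m (8 * i + rbase q) = ra s q i)"

text \<open>For want of multiplication, three doublings supply the factor 8 between array index and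
  address.\<close>

definition index_code :: "nat \<Rightarrow> nat \<Rightarrow> instr list" where
  "index_code d k = [IAdd (tmp d) (tmp d) (tmp d), IAdd (tmp d) (tmp d) (tmp d),
     IAdd (tmp d) (tmp d) (tmp d), IConst (tmp (Suc d)) (int k),
     IAdd (tmp d) (tmp d) (tmp (Suc d))]"

text \<open>Temporaries form a stack: code at depth \<open>d\<close> leaves its value in
  \<open>tmp d\<close> and may spoil deeper ones only. Adding a register to 0 replaces the missing
  move instruction.\<close>

fun icode :: "nat \<Rightarrow> iexp \<Rightarrow> instr list" where
  "icode d (IC k) = [IConst (tmp d) (int k)]"
| "icode d (IV x) = [IConst (tmp d) 0, IAdd (tmp d) (tmp d) (iaddr x)]"
| "icode d Bound = [IConst (tmp d) 0, IAdd (tmp d) (tmp d) 0]"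
| "icode d (IPlus e f) = icode d e @ icode (Suc d) f @ [IAdd (tmp d) (tmp d) (tmp (Suc d))]"
| "icode d (IA q e) = icode d e @ index_code d (ibase q) @ [ILoad (tmp d) (tmp d)]"

fun rcode :: "nat \<Rightarrow> rexp \<Rightarrow> instr list" where
  "rcode d (RC k) = [RConst (tmp d) k]"
| "rcode d (RV x) = [RConst (tmp d) 0, RAdd (tmp d) (tmp d) (raddr x)]"
| "rcode d (RPlus e f) = rcode d e @ rcode (Suc d) f @ [RAdd (tmp d) (tmp d) (tmp (Suc d))]"
| "rcode d (RMinus e f) = rcode d e @ rcode (Suc d) f @ [RSub (tmp d) (tmp d) (tmp (Suc d))]"
| "rcode d (RA q e) = icode d e @ index_code d (rbase q) @ [RLoad (tmp d) (tmp d)]"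

text \<open>Tests are compiled with both continuations at hand, which gives short-circuit evaluation
  and makes negation free. A conjunction duplicates \<open>c'\<close>; this costs program length,
  not time.\<close>

fun branch :: "nat \<Rightarrow> bexp \<Rightarrow> scom \<Rightarrow> scom \<Rightarrow> scom" where
  "branch d (ILe e f) c c' =
     Sq (Blk (icode d e @ icode (Suc d) f)) (Ite (TI (tmp d) (tmp (Suc d))) c c')"
| "branch d (RLe e f) c c' =
     Sq (Blk (rcode d e @ rcode (Suc d) f)) (Ite (TR (tmp d) (tmp (Suc d))) c c')"
| "branch d (Neg b) c c' = branch d b c' c"
| "branch d (Conj b b') c c' = branch d b (branch d b' c c') c'"

text \<open>Loop counters live in temporaries, hence a loop body may overwrite the loop variable.\<close>

fun compile :: "nat \<Rightarrow> com \<Rightarrow> scom" where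
  "compile d Skip = Blk []"
| "compile d (ISet x e) =
     Blk (icode d e @ [IConst (tmp (Suc d)) 0, IAdd (iaddr x) (tmp d) (tmp (Suc d))])"
| "compile d (IPut q e f) =
     Blk (icode d e @ index_code d (ibase q) @ icode (Suc d) f @ [IStore (tmp d) (tmp (Suc d))])"
| "compile d (RSet x e) =
     Blk (rcode d e @ [RConst (tmp (Suc d)) 0, RAdd (raddr x) (tmp d) (tmp (Suc d))])"
| "compile d (RPut q e f) =
     Blk (icode d e @ index_code d (rbase q) @ rcode (Suc d) f @ [RStore (tmp d) (tmp (Suc d))])"
| "compile d (c ;; c') = Sq (compile d c) (compile d c')"
| "compile d (Cond b c c') = branch d b (compile d c) (compile d c')"
| "compile d (For x c) = Sq (Blk [IConst (tmp d) 0]) (Until (TI 0 (tmp d))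
     (Sq (Blk [IConst (iaddr x) 0, IAdd (iaddr x) (iaddr x) (tmp d)])
       (Sq (compile (Suc d) c)
         (Blk [IConst (tmp (Suc d)) 1, IAdd (tmp d) (tmp d) (tmp (Suc d))]))))"

section \<open>Running time of compiled programs\<close>

fun btime :: "bexp \<Rightarrow> nat" where
  "btime (ILe e f) = length (icode 0 e) + length (icode 0 f) + 2"
| "btime (RLe e f) = length (rcode 0 e) + length (rcode 0 f) + 2"
| "btime (Neg b) = btime b"
| "btime (Conj b c) = btime b + btime c"

text \<open>Per iteration, 6 pays for copying the counter to the variable (2), for incrementing it
  (2) and for the test and the jump back (2); the last 2 are the initialisation and the exit test.
  \<open>Cond\<close> adds both branches as a cheap bound on their maximum. The remaining commands
  are straight-line code, for which size is time.\<close>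

fun time :: "nat \<Rightarrow> com \<Rightarrow> nat" where
  "time N (c ;; d) = time N c + time N d"
| "time N (Cond b c d) = btime b + time N c + time N d"
| "time N (For x c) = N * (time N c + 6) + 2"
| "time N c = size_of (compile 0 c)"

lemma length_index_code [simp]: "length (index_code d k) = 5"
  by (simp add: index_code_def)

lemma length_icode: "length (icode d e) = length (icode 0 e)"
proof (induction e arbitrary: d)
  case (IPlus e f)
  show ?case using IPlus.IH(1)[of d] IPlus.IH(2)[of "Suc d"] IPlus.IH(2)[of 1] by simp
next
  case (IA q e)
  then show ?case by simp
qed auto

lemma length_rcode: "length (rcode d e) = length (rcode 0 e)"
proof (induction e arbitrary: d)
  case (RPlus e f)
  show ?case using RPlus.IH(1)[of d] RPlus.IH(2)[of "Suc d"] RPlus.IH(2)[of 1] by simp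
next
  case (RMinus e f)
  show ?case using RMinus.IH(1)[of d] RMinus.IH(2)[of "Suc d"] RMinus.IH(2)[of 1] by simp
next
  case (RA q e)
  then show ?case using length_icode[of d] by simp
qed auto

text \<open>Bounds of this shape are closed under sums and under multiplication by \<open>N\<close>.
  The base \<open>N + 1\<close> is at least 1 even for \<open>N = 0\<close>, so raising an exponent
  never lowers a bound and different exponents can be merged.\<close>

lemma time_polynomial: "\<exists>C k. \<forall>N. time N c \<le> C * (N + 1) ^ k"
proof -
  have mono: "C * (N + 1) ^ k \<le> (C + C') * (N + 1) ^ (k + l)"
    "C * (N + 1) ^ k \<le> (C' + C) * (N + 1) ^ (l + k)" for C C' k l N :: nat
    by (intro mult_mono power_increasing; simp)+
  have add: "\<exists>E j. \<forall>N. f N + g N \<le> E * (N + 1) ^ j"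
    if f: "\<And>N. f N \<le> C * (N + 1) ^ k" and g: "\<And>N. g N \<le> D * (N + 1) ^ l" for f g :: "nat \<Rightarrow> nat" and
      C D k l
  proof (intro exI allI)
    fix N :: nat
    have "f N + g N \<le> (C + D) * (N + 1) ^ (k + l) + (C + D) * (N + 1) ^ (k + l)"
      using f[of N] g[of N] mono(1)[of C N k D l] mono(2)[of D N l C k] by linarith
    then show "f N + g N \<le> (2 * (C + D)) * (N + 1) ^ (k + l)" by (simp add: algebra_simps)
  qed
  have const: "K \<le> K * (N + 1) ^ 0" for K N :: nat by simp
  show ?thesis
  proof (induction c)
    case (Seq c d)
    then obtain C k D l where "\<And>N. time N c \<le> C * (N + 1) ^ k" "\<And>N. time N d \<le> D * (N + 1) ^ l"
      by blast
    from add[OF this] show ?case by simp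
  next
    case (Cond b c d)
    then obtain C k D l where h: "\<And>N. time N c \<le> C * (N + 1) ^ k" "\<And>N. time N d \<le> D * (N + 1) ^ l"
      by blast
    from add[OF const h(1)] obtain E j where "\<And>N. btime b + time N c \<le> E * (N + 1) ^ j" by blast
    from add[OF this h(2)] show ?case by simp
  next
    case (For x c)
    then obtain C k where h: "\<And>N. time N c \<le> C * (N + 1) ^ k" by blast
    have "N * (time N c + 6) + 2 \<le> (C + 8) * (N + 1) ^ Suc k" for N
    proof -
      have p: "1 \<le> (N + 1) ^ k" by simp
      have "N * (time N c + 6) + 2 \<le> (N + 1) * (time N c + 8)" by (simp add: algebra_simps)
      also have "\<dots> \<le> (N + 1) * (C * (N + 1) ^ k + 8 * (N + 1) ^ k)"
        using h[of N] p by (intro mult_left_mono add_mono) simp_all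
      also have "\<dots> = (C + 8) * (N + 1) ^ Suc k" by (simp add: algebra_simps)
      finally show ?thesis .
    qed
    then have "\<forall>N. time N (For x c) \<le> (C + 8) * (N + 1) ^ Suc k" by simp
    then show ?case by blast
  qed (metis const time.simps)+
qed

section \<open>Disjointness of register classes and correctness of the compiler\<close>

lemma addr_mod:
  "iaddr x mod 8 = 0" "raddr y mod 8 = 0" "2 \<le> ibase q" "ibase q < 8" "2 \<le> rbase p" "rbase p < 8"
  by (cases x, simp_all) (cases y, simp_all, (cases q, simp_all)+, (cases p, simp_all)+)

lemma tmp_inject [simp]: "tmp d = tmp d' \<longleftrightarrow> d = d'"
  by (simp add: tmp_def)

lemma tmp_neq [simp]:
  "iaddr x \<noteq> tmp d" "raddr y \<noteq> tmp d" "8 * i + ibase q \<noteq> tmp d" "8 * i + rbase p \<noteq> tmp d"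
  "tmp d \<noteq> iaddr x" "tmp d \<noteq> raddr y" "tmp d \<noteq> 8 * i + ibase q" "tmp d \<noteq> 8 * i + rbase p"
  "tmp d \<noteq> 0" "0 \<noteq> tmp d"
  using addr_mod(1)[of x] addr_mod(2)[of y] addr_mod(3,4)[of q] addr_mod(5,6)[of p]
  unfolding tmp_def by presburger+

definition frame :: "nat \<Rightarrow> mem \<Rightarrow> mem \<Rightarrow> bool" where
  "frame d m m' \<longleftrightarrow>
     (\<forall>k. (\<forall>d'\<ge>d. k \<noteq> tmp d') \<longrightarrow> fst m' k = fst m k \<and> snd m' k = snd m k)"

lemma frame_trans: "frame d m m' \<Longrightarrow> frame d' m' m'' \<Longrightarrow> d \<le> d' \<Longrightarrow> frame d m m''"
  unfolding frame_def by (metis le_trans)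

lemma frame_tmp: "frame d m m' \<Longrightarrow> d' < d \<Longrightarrow> fst m' (tmp d') = fst m (tmp d') \<and> snd m' (tmp d') =
  snd m (tmp d')"
  unfolding frame_def by simp

lemma frame_upd [simp]:
  "d \<le> d' \<Longrightarrow> frame d m ((fst m)(tmp d' := v), snd m)"
  "d \<le> d' \<Longrightarrow> frame d m (fst m, (snd m)(tmp d' := r))"
  by (auto simp: frame_def)

lemma iaddr_inject [simp]: "iaddr x = iaddr y \<longleftrightarrow> x = y"
  by (cases x; cases y; simp)

lemma raddr_inject [simp]: "raddr x = raddr y \<longleftrightarrow> x = y"
  by (cases x; cases y; simp)

lemma ibase_inject [simp]: "ibase x = ibase y \<longleftrightarrow> x = y"
  by (cases x; cases y; simp)

lemma rbase_inject [simp]: "rbase x = rbase y \<longleftrightarrow> x = y"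
  by (cases x; cases y; simp)

lemma array_addr_inject [simp]:
  "8 * i + ibase q = 8 * i' + ibase q' \<longleftrightarrow> i = i' \<and> q = q'"
  "8 * i + rbase p = 8 * i' + rbase p' \<longleftrightarrow> i = i' \<and> p = p'"
proof -
  have "8 * i + ibase q = 8 * i' + ibase q' \<longleftrightarrow> i = i' \<and> ibase q = ibase q'"
    using addr_mod(4)[of q] addr_mod(4)[of q'] by presburger
  then show "8 * i + ibase q = 8 * i' + ibase q' \<longleftrightarrow> i = i' \<and> q = q'" by simp
  have "8 * i + rbase p = 8 * i' + rbase p' \<longleftrightarrow> i = i' \<and> rbase p = rbase p'"
    using addr_mod(6)[of p] addr_mod(6)[of p'] by presburger
  then show "8 * i + rbase p = 8 * i' + rbase p' \<longleftrightarrow> i = i' \<and> p = p'" by simp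
qed

lemma var_array_addr [simp]:
  "iaddr x \<noteq> 8 * i + ibase q" "8 * i + ibase q \<noteq> iaddr x"
  "raddr y \<noteq> 8 * i + rbase p" "8 * i + rbase p \<noteq> raddr y" "8 * i + ibase q \<noteq> 0"
  using addr_mod(1)[of x] addr_mod(2)[of y] addr_mod(3,4)[of q] addr_mod(5,6)[of p]
  by presburger+

lemma iaddr_neq_0 [simp]: "iaddr x \<noteq> 0"
  by (cases x) simp_all

lemma represents_frame: "represents N s m \<Longrightarrow> frame d m m' \<Longrightarrow> represents N s m'"
  unfolding represents_def frame_def by simp

lemma index_code_correct:
  assumes "fst m (tmp d) = int v"
  shows "frame d m (fold mexec (index_code d k) m)"
    and "fst (fold mexec (index_code d k) m) (tmp d) = int (8 * v + k)"
  using assms by (auto simp: index_code_def frame_def)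

lemma icode_correct:
  assumes "represents N s m"
  shows "frame d m (fold mexec (icode d e) m) \<and>
    fst (fold mexec (icode d e) m) (tmp d) = int (ieval N e s)"
  using assms
proof (induction e arbitrary: d m)
  case (IC k)
  show ?case by simp
next
  case (IV x)
  then show ?case by (simp add: represents_def frame_def)
next
  case Bound
  then show ?case by (simp add: represents_def frame_def)
next
  case (IPlus e f)
  let ?m1 = "fold mexec (icode d e) m"
  let ?m2 = "fold mexec (icode (Suc d) f) ?m1"
  have 1: "frame d m ?m1" "fst ?m1 (tmp d) = int (ieval N e s)" using IPlus.IH(1) IPlus.prems by blast+
  have 2: "frame (Suc d) ?m1 ?m2" "fst ?m2 (tmp (Suc d)) = int (ieval N f s)"
    using IPlus.IH(2) represents_frame[OF IPlus.prems 1(1)] by blast+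
  have "fst ?m2 (tmp d) = int (ieval N e s)" using frame_tmp[OF 2(1), of d] 1(2) by simp
  moreover have "frame d m ?m2" using frame_trans[OF 1(1) 2(1)] by simp
  ultimately show ?case
    using 2(2) frame_trans[OF \<open>frame d m ?m2\<close> frame_upd(1), of d d] by simp
next
  case (IA q e)
  let ?m1 = "fold mexec (icode d e) m"
  let ?m2 = "fold mexec (index_code d (ibase q)) ?m1"
  have 1: "frame d m ?m1" "fst ?m1 (tmp d) = int (ieval N e s)" using IA by blast+
  have 2: "frame d ?m1 ?m2" "fst ?m2 (tmp d) = int (8 * ieval N e s + ibase q)"
    using index_code_correct[OF 1(2)] by blast+
  have 3: "frame d m ?m2" using frame_trans[OF 1(1) 2(1)] by simp
  have "represents N s ?m2" using represents_frame[OF IA.prems 3] .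
  then have "fst ?m2 (8 * ieval N e s + ibase q) = int (ia s q (ieval N e s))"
    by (simp add: represents_def)
  moreover have "nat (fst ?m2 (tmp d)) = 8 * ieval N e s + ibase q"
    using 2(2) by simp
  ultimately show ?case
    using frame_trans[OF 3 frame_upd(1), of d d] by simp
qed

lemma rcode_correct:
  assumes "represents N s m"
  shows "frame d m (fold mexec (rcode d e) m) \<and>
    snd (fold mexec (rcode d e) m) (tmp d) = reval N e s"
  using assms
proof (induction e arbitrary: d m)
  case (RC k)
  show ?case by simp
next
  case (RV x)
  then show ?case by (simp add: represents_def frame_def)
next
  case (RPlus e f)
  let ?m1 = "fold mexec (rcode d e) m"
  let ?m2 = "fold mexec (rcode (Suc d) f) ?m1"
  have 1: "frame d m ?m1" "snd ?m1 (tmp d) = reval N e s" using RPlus.IH(1) RPlus.prems by blast+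
  have 2: "frame (Suc d) ?m1 ?m2" "snd ?m2 (tmp (Suc d)) = reval N f s"
    using RPlus.IH(2) represents_frame[OF RPlus.prems 1(1)] by blast+
  have "snd ?m2 (tmp d) = reval N e s" using frame_tmp[OF 2(1), of d] 1(2) by simp
  moreover have "frame d m ?m2" using frame_trans[OF 1(1) 2(1)] by simp
  ultimately show ?case
    using 2(2) frame_trans[OF \<open>frame d m ?m2\<close> frame_upd(2), of d d] by simp
next
  case (RMinus e f)
  let ?m1 = "fold mexec (rcode d e) m"
  let ?m2 = "fold mexec (rcode (Suc d) f) ?m1"
  have 1: "frame d m ?m1" "snd ?m1 (tmp d) = reval N e s" using RMinus.IH(1) RMinus.prems by blast+
  have 2: "frame (Suc d) ?m1 ?m2" "snd ?m2 (tmp (Suc d)) = reval N f s"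
    using RMinus.IH(2) represents_frame[OF RMinus.prems 1(1)] by blast+
  have "snd ?m2 (tmp d) = reval N e s" using frame_tmp[OF 2(1), of d] 1(2) by simp
  moreover have "frame d m ?m2" using frame_trans[OF 1(1) 2(1)] by simp
  ultimately show ?case
    using 2(2) frame_trans[OF \<open>frame d m ?m2\<close> frame_upd(2), of d d] by simp
next
  case (RA q e)
  let ?m1 = "fold mexec (icode d e) m"
  let ?m2 = "fold mexec (index_code d (rbase q)) ?m1"
  have 1: "frame d m ?m1" "fst ?m1 (tmp d) = int (ieval N e s)"
    using icode_correct[OF RA.prems] by blast+
  have 2: "frame d ?m1 ?m2" "fst ?m2 (tmp d) = int (8 * ieval N e s + rbase q)"
    using index_code_correct[OF 1(2)] by blast+
  have 3: "frame d m ?m2" using frame_trans[OF 1(1) 2(1)] by simp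
  have "represents N s ?m2" using represents_frame[OF RA.prems 3] .
  then have "snd ?m2 (8 * ieval N e s + rbase q) = ra s q (ieval N e s)"
    by (simp add: represents_def)
  moreover have "nat (fst ?m2 (tmp d)) = 8 * ieval N e s + rbase q"
    using 2(2) by simp
  ultimately show ?case
    using frame_trans[OF 3 frame_upd(2), of d d] by simp
qed

lemma nonjump_code:
  "\<forall>i\<in>set (index_code d k). \<not> is_jump i"
  "\<forall>i\<in>set (icode d e). \<not> is_jump i"
  "\<forall>i\<in>set (rcode d f). \<not> is_jump i"
proof -
  show 1: "\<forall>i\<in>set (index_code d k). \<not> is_jump i" for d k by (simp add: index_code_def)
  show 2: "\<forall>i\<in>set (icode d e). \<not> is_jump i" for d e
    by (induction e arbitrary: d) (use 1 in auto)
  show "\<forall>i\<in>set (rcode d f). \<not> is_jump i"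
    by (induction f arbitrary: d) (use 1 2 in auto)
qed

text \<open>Commands write variables and arrays, so \<open>frame\<close> fails for them. What an
  enclosing loop relies on is that its integer counter, a temporary of smaller depth, survives the
  body.\<close>

definition keeps :: "nat \<Rightarrow> mem \<Rightarrow> mem \<Rightarrow> bool" where
  "keeps d m m' \<longleftrightarrow> (\<forall>d'<d. fst m' (tmp d') = fst m (tmp d'))"

lemma keeps_trans: "keeps d m m' \<Longrightarrow> keeps d' m' m'' \<Longrightarrow> d \<le> d' \<Longrightarrow> keeps d m m''"
  by (simp add: keeps_def)

lemma frame_keeps: "frame d m m' \<Longrightarrow> keeps d m m'"
  by (simp add: keeps_def frame_tmp)

text \<open>Evaluating a test spoils temporaries before a branch is entered, so the branches have to
  work from every memory in the frame of \<open>m\<close>. Keeping them arbitrary lets the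
  conjunction case pass a nested \<open>branch\<close> to the induction hypothesis.\<close>

lemma branch_correct:
  assumes "represents N s m"
    and "\<And>m1. frame d m m1 \<Longrightarrow> beval N b s \<Longrightarrow> \<exists>t\<le>tc. \<exists>m'. big_step c m1 t m' \<and> P m'"
    and "\<And>m1. frame d m m1 \<Longrightarrow> \<not> beval N b s \<Longrightarrow> \<exists>t\<le>tc. \<exists>m'. big_step c' m1 t m' \<and> P m'"
  shows "\<exists>t\<le>btime b + tc. \<exists>m'. big_step (branch d b c c') m t m' \<and> P m'"
  using assms
proof (induction b arbitrary: m c c' tc)
  case (ILe e f)
  let ?m1 = "fold mexec (icode d e) m"
  let ?m2 = "fold mexec (icode (Suc d) f) ?m1"
  have 1: "frame d m ?m1" "fst ?m1 (tmp d) = int (ieval N e s)"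
    using icode_correct[OF ILe.prems(1)] by blast+
  have 2: "frame (Suc d) ?m1 ?m2" "fst ?m2 (tmp (Suc d)) = int (ieval N f s)"
    using icode_correct[OF represents_frame[OF ILe.prems(1) 1(1)]] by blast+
  have 3: "fst ?m2 (tmp d) = int (ieval N e s)" using frame_tmp[OF 2(1), of d] 1(2) by simp
  have 4: "frame d m ?m2" using frame_trans[OF 1(1) 2(1)] by simp
  have b: "big_step (Blk (icode d e @ icode (Suc d) f)) m (length (icode d e @ icode (Suc d) f)) ?m2"
    using big_step.Blk[of "icode d e @ icode (Suc d) f" m] nonjump_code(2) by auto
  have h: "holds (TI (tmp d) (tmp (Suc d))) ?m2 \<longleftrightarrow> beval N (ILe e f) s"
    using 2(2) 3 by simp
  obtain t m' where t: "t \<le> tc" "big_step (Ite (TI (tmp d) (tmp (Suc d))) c c') ?m2 (t + 2) m'" "P m'"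
  proof (cases "beval N (ILe e f) s")
    case True
    then show ?thesis using ILe.prems(2)[OF 4] that IteT h by blast
  next
    case False
    then show ?thesis using ILe.prems(3)[OF 4] that IteF h by blast
  qed
  show ?case
    using big_step.Sq[OF b t(2)] t(1,3) length_icode[of d e] length_icode[of "Suc d" f]
    by (intro exI[of _ "length (icode d e @ icode (Suc d) f) + (t + 2)"] conjI exI[of _ m']) auto
next
  case (RLe e f)
  let ?m1 = "fold mexec (rcode d e) m"
  let ?m2 = "fold mexec (rcode (Suc d) f) ?m1"
  have 1: "frame d m ?m1" "snd ?m1 (tmp d) = reval N e s"
    using rcode_correct[OF RLe.prems(1)] by blast+
  have 2: "frame (Suc d) ?m1 ?m2" "snd ?m2 (tmp (Suc d)) = reval N f s"
    using rcode_correct[OF represents_frame[OF RLe.prems(1) 1(1)]] by blast+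
  have 3: "snd ?m2 (tmp d) = reval N e s" using frame_tmp[OF 2(1), of d] 1(2) by simp
  have 4: "frame d m ?m2" using frame_trans[OF 1(1) 2(1)] by simp
  have b: "big_step (Blk (rcode d e @ rcode (Suc d) f)) m (length (rcode d e @ rcode (Suc d) f)) ?m2"
    using big_step.Blk[of "rcode d e @ rcode (Suc d) f" m] nonjump_code(3) by auto
  have h: "holds (TR (tmp d) (tmp (Suc d))) ?m2 \<longleftrightarrow> beval N (RLe e f) s"
    using 2(2) 3 by simp
  obtain t m' where t: "t \<le> tc" "big_step (Ite (TR (tmp d) (tmp (Suc d))) c c') ?m2 (t + 2) m'" "P m'"
  proof (cases "beval N (RLe e f) s")
    case True
    then show ?thesis using RLe.prems(2)[OF 4] that IteT h by blast
  next
    case False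
    then show ?thesis using RLe.prems(3)[OF 4] that IteF h by blast
  qed
  show ?case
    using big_step.Sq[OF b t(2)] t(1,3) length_rcode[of d e] length_rcode[of "Suc d" f]
    by (intro exI[of _ "length (rcode d e @ rcode (Suc d) f) + (t + 2)"] conjI exI[of _ m']) auto
next
  case (Neg b)
  show ?case using Neg.IH[OF Neg.prems(1), of tc c' c] Neg.prems(2,3) by simp
next
  case (Conj b b')
  have "\<exists>t\<le>btime b + (btime b' + tc). \<exists>m'. big_step (branch d b (branch d b' c c') c') m t m' \<and> P m'"
  proof (rule Conj.IH(1)[OF Conj.prems(1)])
    fix m1 assume 1: "frame d m m1" "beval N b s"
    show "\<exists>t\<le>btime b' + tc. \<exists>m'. big_step (branch d b' c c') m1 t m' \<and> P m'"
    proof (rule Conj.IH(2)[OF represents_frame[OF Conj.prems(1) 1(1)]])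
      fix m2 assume 2: "frame d m1 m2"
      have 3: "frame d m m2" using frame_trans[OF 1(1) 2] by simp
      { assume "beval N b' s"
        then show "\<exists>t\<le>tc. \<exists>m'. big_step c m2 t m' \<and> P m'" using Conj.prems(2)[OF 3] 1(2) by simp }
      { assume "\<not> beval N b' s"
        then show "\<exists>t\<le>tc. \<exists>m'. big_step c' m2 t m' \<and> P m'" using Conj.prems(3)[OF 3] by simp }
    qed
  next
    fix m1 assume "frame d m m1" "\<not> beval N b s"
    then obtain t m' where "t \<le> tc" "big_step c' m1 t m'" "P m'" using Conj.prems(3) by fastforce
    then show "\<exists>t\<le>btime b' + tc. \<exists>m'. big_step c' m1 t m' \<and> P m'"
      using trans_le_add2 by blast
  qed
  then show ?case by (simp add: add.assoc)
qed

lemma represents_upd: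
  assumes "represents N s m"
  shows "represents N (set_iv x v s) ((fst m)(iaddr x := int v), snd m)"
    and "represents N (s\<lparr>rv := (rv s)(y := r)\<rparr>) (fst m, (snd m)(raddr y := r))"
    and "represents N (s\<lparr>ia := (ia s)(q := (ia s q)(i := v))\<rparr>) ((fst m)(8 * i + ibase q := int v),
      snd m)"
    and "represents N (s\<lparr>ra := (ra s)(p := (ra s p)(i := r))\<rparr>) (fst m, (snd m)(8 * i + rbase p := r))"
  using assms addr_mod(3)[of q] by (auto simp: represents_def set_iv_def)

lemma big_step_code:
  "\<forall>i\<in>set is. \<not> is_jump i \<Longrightarrow> Q (fold mexec is m) \<Longrightarrow> length is \<le> t \<Longrightarrow>
    \<exists>u\<le>t. \<exists>m'. big_step (Blk is) m u m' \<and> Q m'"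
  using big_step.Blk by blast

theorem compile_correct:
  assumes "represents N s m"
  shows "\<exists>t\<le>time N c. \<exists>m'. big_step (compile d c) m t m' \<and> represents N (sem N c s) m' \<and> keeps d m m'"
  using assms
proof (induction c arbitrary: d s m)
  case Skip
  moreover have "big_step (Blk []) m 0 m" using big_step.Blk[of "[]" m] by simp
  moreover have "keeps d m m" by (simp add: keeps_def)
  ultimately show ?case by (intro exI[of _ 0] conjI exI[of _ m]) simp_all
next
  case (ISet x e)
  let ?m1 = "fold mexec (icode d e) m"
  have 1: "frame d m ?m1" "fst ?m1 (tmp d) = int (ieval N e s)"
    using icode_correct[OF ISet] by blast+
  have 2: "frame d m ((fst ?m1)(tmp (Suc d) := 0), snd ?m1)"
    using frame_trans[OF 1(1) frame_upd(1), of d "Suc d"] by simp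
  have "\<exists>t\<le>time N (ISet x e). \<exists>m'. big_step (Blk (icode d e @ [IConst (tmp (Suc d)) 0,
      IAdd (iaddr x) (tmp d) (tmp (Suc d))])) m t m' \<and>
    (represents N (sem N (ISet x e) s) m' \<and> keeps d m m')"
    using represents_upd(1)[OF represents_frame[OF ISet 2]] frame_keeps[OF 2] 1(2)
    by (intro big_step_code) (auto simp: nonjump_code length_icode[of d] keeps_def)
  then show ?case by simp
next
  case (IPut q e f)
  let ?m1 = "fold mexec (icode d e) m"
  let ?m2 = "fold mexec (index_code d (ibase q)) ?m1"
  let ?m3 = "fold mexec (icode (Suc d) f) ?m2"
  have 1: "frame d m ?m1" "fst ?m1 (tmp d) = int (ieval N e s)"
    using icode_correct[OF IPut] by blast+
  have 2: "frame d ?m1 ?m2" "fst ?m2 (tmp d) = int (8 * ieval N e s + ibase q)"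
    using index_code_correct[OF 1(2)] by blast+
  have f2: "frame d m ?m2" using frame_trans[OF 1(1) 2(1)] by simp
  have 3: "frame (Suc d) ?m2 ?m3" "fst ?m3 (tmp (Suc d)) = int (ieval N f s)"
    using icode_correct[OF represents_frame[OF IPut f2]] by blast+
  have f3: "frame d m ?m3" using frame_trans[OF f2 3(1)] by simp
  have a: "nat (fst ?m3 (tmp d)) = 8 * ieval N e s + ibase q"
    using frame_tmp[OF 3(1), of d] 2(2) by simp
  have "\<exists>t\<le>time N (IPut q e f). \<exists>m'. big_step (Blk (icode d e @ index_code d (ibase q) @
      icode (Suc d) f @ [IStore (tmp d) (tmp (Suc d))])) m t m' \<and>
    (represents N (sem N (IPut q e f) s) m' \<and> keeps d m m')"
    using represents_upd(3)[OF represents_frame[OF IPut f3]] frame_keeps[OF f3] 3(2) a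
    by (intro big_step_code)
      (auto simp: nonjump_code length_icode[of d] length_icode[of "Suc _"] keeps_def)
  then show ?case by simp
next
  case (RSet x e)
  let ?m1 = "fold mexec (rcode d e) m"
  have 1: "frame d m ?m1" "snd ?m1 (tmp d) = reval N e s"
    using rcode_correct[OF RSet] by blast+
  have 2: "frame d m (fst ?m1, (snd ?m1)(tmp (Suc d) := 0))"
    using frame_trans[OF 1(1) frame_upd(2), of d "Suc d"] by simp
  have "\<exists>t\<le>time N (RSet x e). \<exists>m'. big_step (Blk (rcode d e @ [RConst (tmp (Suc d)) 0,
      RAdd (raddr x) (tmp d) (tmp (Suc d))])) m t m' \<and>
    (represents N (sem N (RSet x e) s) m' \<and> keeps d m m')"
    using represents_upd(2)[OF represents_frame[OF RSet 2]] frame_keeps[OF 2] 1(2)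
    by (intro big_step_code) (auto simp: nonjump_code length_rcode[of d] keeps_def)
  then show ?case by simp
next
  case (RPut q e f)
  let ?m1 = "fold mexec (icode d e) m"
  let ?m2 = "fold mexec (index_code d (rbase q)) ?m1"
  let ?m3 = "fold mexec (rcode (Suc d) f) ?m2"
  have 1: "frame d m ?m1" "fst ?m1 (tmp d) = int (ieval N e s)"
    using icode_correct[OF RPut] by blast+
  have 2: "frame d ?m1 ?m2" "fst ?m2 (tmp d) = int (8 * ieval N e s + rbase q)"
    using index_code_correct[OF 1(2)] by blast+
  have f2: "frame d m ?m2" using frame_trans[OF 1(1) 2(1)] by simp
  have 3: "frame (Suc d) ?m2 ?m3" "snd ?m3 (tmp (Suc d)) = reval N f s"
    using rcode_correct[OF represents_frame[OF RPut f2]] by blast+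
  have f3: "frame d m ?m3" using frame_trans[OF f2 3(1)] by simp
  have a: "nat (fst ?m3 (tmp d)) = 8 * ieval N e s + rbase q"
    using frame_tmp[OF 3(1), of d] 2(2) by simp
  have "\<exists>t\<le>time N (RPut q e f). \<exists>m'. big_step (Blk (icode d e @ index_code d (rbase q) @
      rcode (Suc d) f @ [RStore (tmp d) (tmp (Suc d))])) m t m' \<and>
    (represents N (sem N (RPut q e f) s) m' \<and> keeps d m m')"
    using represents_upd(4)[OF represents_frame[OF RPut f3]] frame_keeps[OF f3] 3(2) a
    by (intro big_step_code)
      (auto simp: nonjump_code length_icode[of d] length_rcode[of "Suc _"] keeps_def)
  then show ?case by simp
next
  case (Seq c c')
  from Seq.IH(1)[OF Seq.prems] obtain t m' where 1: "t \<le> time N c" "big_step (compile d c) m t m'"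
    "represents N (sem N c s) m'" "keeps d m m'" by blast
  from Seq.IH(2)[OF 1(3)] obtain u m'' where 2: "u \<le> time N c'" "big_step (compile d c') m' u m''"
    "represents N (sem N c' (sem N c s)) m''" "keeps d m' m''" by blast
  show ?case
    using big_step.Sq[OF 1(2) 2(2)] 1(1) 2(1,3) keeps_trans[OF 1(4) 2(4)]
    by (intro exI[of _ "t + u"] conjI exI[of _ m'']) auto
next
  case (Cond b c c')
  let ?P = "\<lambda>m'. represents N (sem N (Cond b c c') s) m' \<and> keeps d m m'"
  have "\<exists>t\<le>btime b + (time N c + time N c'). \<exists>m'. big_step (branch d b (compile d c) (compile d c'))
    m t m' \<and> ?P m'"
  proof (rule branch_correct[OF Cond.prems])
    fix m1 assume 1: "frame d m m1" "beval N b s"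
    from Cond.IH(1)[OF represents_frame[OF Cond.prems 1(1)], of d] obtain t m' where
      "t \<le> time N c" "big_step (compile d c) m1 t m'" "represents N (sem N c s) m'" "keeps d m1 m'"
      by blast
    then show "\<exists>t\<le>time N c + time N c'. \<exists>m'. big_step (compile d c) m1 t m' \<and> ?P m'"
      using 1(2) keeps_trans[OF frame_keeps[OF 1(1)], of d m']
      by (intro exI[of _ t] conjI exI[of _ m']) simp_all
  next
    fix m1 assume 1: "frame d m m1" "\<not> beval N b s"
    from Cond.IH(2)[OF represents_frame[OF Cond.prems 1(1)], of d] obtain t m' where
      "t \<le> time N c'" "big_step (compile d c') m1 t m'" "represents N (sem N c' s) m'" "keeps d m1 m'"
      by blast
    then show "\<exists>t\<le>time N c + time N c'. \<exists>m'. big_step (compile d c') m1 t m' \<and> ?P m'"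
      using 1(2) keeps_trans[OF frame_keeps[OF 1(1)], of d m']
      by (intro exI[of _ t] conjI exI[of _ m']) simp_all
  qed
  then show ?case by (simp add: add.assoc)
next
  case (For x c)
  define body where "body = Sq (Blk [IConst (iaddr x) 0, IAdd (iaddr x) (iaddr x) (tmp d)])
       (Sq (compile (Suc d) c) (Blk [IConst (tmp (Suc d)) 1, IAdd (tmp d) (tmp d) (tmp (Suc d))]))"
  \<comment> \<open>\<open>i\<close> iterations are done and \<open>k\<close> remain; the extra 1 is
    the exit test. The counter in \<open>tmp d\<close> survives the body because that is compiled at
    depth \<open>Suc d\<close>.\<close>
  have iter: "\<exists>t\<le>k * (time N c + 6) + 1. \<exists>m'. big_step (Until (TI 0 (tmp d)) body) m1 t m' \<and>
      represents N (loop N x (sem N c) s) m' \<and> keeps d m1 m'"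
    if "represents N (loop i x (sem N c) s) m1" "fst m1 (tmp d) = int i" "i + k = N" for i k m1
    using that
  proof (induction k arbitrary: i m1)
    case 0
    then have "big_step (Until (TI 0 (tmp d)) body) m1 1 m1"
      by (intro UntilT) (simp add: represents_def)
    moreover have "keeps d m1 m1" by (simp add: keeps_def)
    ultimately show ?case using 0 by (intro exI[of _ 1] conjI exI[of _ m1]) simp_all
  next
    case (Suc k)
    have i: "i < N" using Suc.prems(3) by simp
    have nh: "\<not> holds (TI 0 (tmp d)) m1" using Suc.prems i by (simp add: represents_def)
    let ?b1 = "[IConst (iaddr x) 0, IAdd (iaddr x) (iaddr x) (tmp d)]"
    let ?b2 = "[IConst (tmp (Suc d)) 1, IAdd (tmp d) (tmp d) (tmp (Suc d))]"
    let ?m2 = "((fst m1)(iaddr x := int i), snd m1)"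
    have b1: "big_step (Blk ?b1) m1 2 ?m2"
      using big_step.Blk[of ?b1 m1] Suc.prems(2) by (simp add: numeral_2_eq_2)
    have "represents N (set_iv x i (loop i x (sem N c) s)) ?m2"
      by (rule represents_upd(1)[OF Suc.prems(1)])
    from For.IH[OF this, of "Suc d"] obtain t m3 where 3: "t \<le> time N c"
      "big_step (compile (Suc d) c) ?m2 t m3"
      "represents N (loop (Suc i) x (sem N c) s) m3" "keeps (Suc d) ?m2 m3"
      unfolding loop_Suc by blast
    have td: "fst m3 (tmp d) = int i" using 3(4) Suc.prems(2) by (simp add: keeps_def)
    let ?m4 = "((fst m3)(tmp (Suc d) := 1, tmp d := int i + 1), snd m3)"
    have b2: "big_step (Blk ?b2) m3 2 ?m4"
      using big_step.Blk[of ?b2 m3] td by (simp add: numeral_2_eq_2)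
    have f: "frame d m3 ?m4" by (auto simp: frame_def)
    have b: "big_step body m1 (2 + (t + 2)) ?m4"
      unfolding body_def by (rule big_step.Sq[OF b1 big_step.Sq[OF 3(2) b2]])
    have "fst ?m4 (tmp d) = int (Suc i)" by simp
    from Suc.IH[OF represents_frame[OF 3(3) f] this] Suc.prems(3) obtain u m5 where 5:
      "u \<le> k * (time N c + 6) + 1" "big_step (Until (TI 0 (tmp d)) body) ?m4 u m5"
      "represents N (loop N x (sem N c) s) m5" "keeps d ?m4 m5" by auto
    have "keeps d m1 m5" using 3(4) 5(4) by (simp add: keeps_def)
    then show ?case using UntilF[OF nh b 5(2)] 5(1,3) 3(1)
      by (intro exI[of _ "2 + (t + 2) + u + 2"] conjI exI[of _ m5]) auto
  qed
  let ?m0 = "((fst m)(tmp d := 0), snd m)"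
  have f0: "frame d m ?m0" by simp
  from iter[of 0 ?m0 N] represents_frame[OF For.prems f0]
  obtain t m' where t: "t \<le> N * (time N c + 6) + 1" "big_step (Until (TI 0 (tmp d)) body) ?m0 t m'"
    "represents N (loop N x (sem N c) s) m'" "keeps d ?m0 m'" by (auto simp: loop_0)
  have b0: "big_step (Blk [IConst (tmp d) 0]) m 1 ?m0"
    using big_step.Blk[of "[IConst (tmp d) 0]" m] by simp
  have "keeps d m m'" using keeps_trans[OF frame_keeps[OF f0] t(4)] by simp
  then show ?case using big_step.Sq[OF b0 t(2)] t(1,3)
    by (intro exI[of _ "1 + t"] conjI exI[of _ m']) (auto simp: body_def)
qed

section \<open>Robust chains\<close>

lemma finite_feasible: "feasible n a b S \<Longrightarrow> finite S"
  unfolding feasible_def using finite_subset by blast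

lemma feasible_subset: "feasible n a b S \<Longrightarrow> T \<subseteq> S \<Longrightarrow> feasible n a b T"
  unfolding feasible_def by blast

lemma feasible_del: "feasible n a b S \<Longrightarrow> feasible n a b (del S f)"
  by (cases f) (auto intro: feasible_subset)

section \<open>Repairs and the robust value\<close>

definition repairs :: "nat \<Rightarrow> (nat \<Rightarrow> nat) \<Rightarrow> (nat \<Rightarrow> nat) \<Rightarrow> nat set \<Rightarrow> nat option \<Rightarrow> nat option set" where
  "repairs n a b S f =
     {e \<in> choices ({..<n} - (S \<union> set_option f)). feasible n a b (addj (del S f) e)}"

lemma finite_choices: "finite A \<Longrightarrow> finite (choices A)"
  by (simp add: choices_def)

lemma finite_repairs: "finite (repairs n a b S f)"
  unfolding repairs_def by (simp add: finite_choices)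

lemma None_repairs: "feasible n a b S \<Longrightarrow> None \<in> repairs n a b S f"
  by (simp add: repairs_def choices_def feasible_del)

lemma Some_repairs:
  "Some e \<in> repairs n a b S f \<longleftrightarrow> e < n \<and> e \<notin> S \<and> f \<noteq> Some e \<and> feasible n a b (insert e (del S f))"
  by (cases f) (auto simp: repairs_def choices_def)

lemma repair_val_ge:
  "e \<in> repairs n a b S f \<Longrightarrow> wt w (addj (del S f) e) \<le> repair_val n a b w S f"
  unfolding repair_val_def repairs_def[symmetric] by (simp add: finite_repairs)

lemma repair_val_attained:
  assumes "feasible n a b S"
  obtains e where "e \<in> repairs n a b S f" "repair_val n a b w S f = wt w (addj (del S f) e)"
proof -
  have "repair_val n a b w S f \<in> (\<lambda>e. wt w (addj (del S f) e)) ` repairs n a b S f"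
    unfolding repair_val_def repairs_def[symmetric]
    using finite_repairs[of n a b S f] None_repairs[OF assms, of f] by (intro Max_in) blast+
  then show thesis using that by blast
qed

lemma robust_val_le: "f \<in> choices {..<n} \<Longrightarrow> robust_val n a b w S \<le> repair_val n a b w S f"
  unfolding robust_val_def by (simp add: finite_choices)

lemma robust_val_attained:
  obtains f where "f \<in> choices {..<n}" "robust_val n a b w S = repair_val n a b w S f"
proof -
  have "robust_val n a b w S \<in> repair_val n a b w S ` choices {..<n}"
    unfolding robust_val_def by (intro Min_in) (auto simp: finite_choices choices_def)
  then show thesis using that by blast
qed

text \<open>Intervals enter the objective only through the family of feasible sets. This licenses
  the normalisation, which moves intervals but preserves that family.\<close>

lemma robust_optimal_cong:
  assumes F: "feasible n a b = feasible n a' b'" and w: "\<And>j. j < n \<Longrightarrow> w j = w' j"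
  shows "robust_optimal n a b w S \<longleftrightarrow> robust_optimal n a' b' w' S"
proof -
  have "repair_val n a b w T f = repair_val n a' b' w' T f" for T f
    unfolding repair_val_def F
    by (rule arg_cong[where f = Max], rule image_cong)
      (auto simp: feasible_def wt_def intro!: sum.cong w)
  then have "robust_val n a b w T = robust_val n a' b' w' T" for T
    unfolding robust_val_def by simp
  then show ?thesis unfolding robust_optimal_def F by simp
qed

text \<open>Jobs are the indices below \<open>n\<close>; the indices \<open>n\<close> and \<open>n + 1\<close> are sentinels lying before and
  after all jobs.  Their weight is 0, so they also stand for the choice \<open>\<emptyset>\<close>.\<close>

locale guarded_jobs =
  fixes n :: nat and A B :: "nat \<Rightarrow> nat" and W :: "nat \<Rightarrow> real"
  assumes A_less_B: "j < n + 2 \<Longrightarrow> A j < B j"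
    and bot_before: "j < n + 2 \<Longrightarrow> j \<noteq> n \<Longrightarrow> B n \<le> A j"
    and before_top: "j < n + 2 \<Longrightarrow> j \<noteq> n + 1 \<Longrightarrow> B j \<le> A (n + 1)"
    and W_nonneg: "j < n \<Longrightarrow> 0 \<le> W j"
    and W_sentinel: "W n = 0" "W (n + 1) = 0"
begin

lemma W_nonneg': "j < n + 2 \<Longrightarrow> 0 \<le> W j"
  using W_nonneg[of j] W_sentinel by (cases "j < n"; cases "j = n"; cases "j = n + 1") auto

section \<open>The interval order\<close>

definition prec :: "nat \<Rightarrow> nat \<Rightarrow> bool" where
  "prec i j \<longleftrightarrow> B i \<le> A j"

lemma prec_trans: "prec i j \<Longrightarrow> prec j k \<Longrightarrow> j < n + 2 \<Longrightarrow> prec i k"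
  unfolding prec_def using A_less_B[of j] by linarith

lemma prec_irrefl: "j < n + 2 \<Longrightarrow> \<not> prec j j"
  unfolding prec_def using A_less_B[of j] by linarith

lemma not_prec_bot: "j < n + 2 \<Longrightarrow> \<not> prec j n"
  unfolding prec_def using bot_before[of j] A_less_B[of j] A_less_B[of n] by (cases "j = n") auto

lemma not_top_prec: "j < n + 2 \<Longrightarrow> \<not> prec (n + 1) j"
  unfolding prec_def using before_top[of j] A_less_B[of j] A_less_B[of "n + 1"]
  by (cases "j = n + 1") auto

text \<open>Nonempty intervals are not comparable to themselves. So a job comparable to every member
  of a chain is automatically outside the chain, which is how \<open>p\<close> and \<open>q\<close>
  are known to be addable.\<close>

definition comparable :: "nat \<Rightarrow> nat \<Rightarrow> bool" where
  "comparable i j \<longleftrightarrow> prec i j \<or> prec j i"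

lemma comparable_sentinel: "j < n \<Longrightarrow> comparable j n" "j < n \<Longrightarrow> comparable j (n + 1)"
  using bot_before[of j] before_top[of j] by (auto simp: comparable_def prec_def)

lemma disjoint_iff_comparable:
  "i < n \<Longrightarrow> j < n \<Longrightarrow> ival A B i \<inter> ival A B j = {} \<longleftrightarrow> comparable i j"
  using A_less_B[of i] A_less_B[of j]
  by (simp add: ival_def comparable_def prec_def Int_atLeastLessThan) linarith

lemma feasible_iff:
  "feasible n A B S \<longleftrightarrow> S \<subseteq> {..<n} \<and> (\<forall>i\<in>S. \<forall>j\<in>S. i \<noteq> j \<longrightarrow> comparable i j)"
  unfolding feasible_def using disjoint_iff_comparable by (metis lessThan_iff subsetD)

lemma feasible_insert:
  "feasible n A B S \<Longrightarrow> e < n \<Longrightarrow> (\<And>i. i \<in> S \<Longrightarrow> i \<noteq> e \<Longrightarrow> comparable i e) \<Longrightarrow> feasible n A B (insert e S)"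
  unfolding feasible_iff comparable_def by auto

text \<open>Each disjunct is \<open>w(S) - W f + W z \<ge> w(S) + \<mu>\<close> for \<open>z\<close>
  one of \<open>p\<close>, \<open>q\<close>, with \<open>w(S)\<close> cancelled; this cancellation
  is what frees the condition from the rest of the chain.\<close>

definition cover :: "nat \<Rightarrow> nat \<Rightarrow> real \<Rightarrow> nat \<Rightarrow> bool" where
  "cover p q \<mu> f \<longleftrightarrow> \<mu> + W f \<le> W p \<or> \<mu> + W f \<le> W q"

text \<open>The consecutive elements \<open>i\<close>, \<open>j\<close>, \<open>k\<close> of a chain are admissible if the loss of \<open>j\<close> can be
  compensated up to \<open>\<mu>\<close>, either globally by \<open>p\<close> or \<open>q\<close> or by a job between \<open>i\<close> and \<open>k\<close>.\<close>

definition admissible :: "nat \<Rightarrow> nat \<Rightarrow> real \<Rightarrow> nat \<Rightarrow> nat \<Rightarrow> nat \<Rightarrow> bool" where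
  "admissible p q \<mu> i j k \<longleftrightarrow> prec j k \<and> (j < n \<longrightarrow> comparable j p \<and> comparable j q \<and>
     (cover p q \<mu> j \<or> (\<exists>e<n. e \<noteq> j \<and> prec i e \<and> prec e k \<and> \<mu> + W j \<le> W e)))"

text \<open>A path is built backwards from the top sentinel: \<open>j\<close> is the current
  element, \<open>i\<close> its predecessor and \<open>X\<close> the chain strictly after
  \<open>j\<close>, without sentinels. The order of \<open>i\<close> and \<open>j\<close> is not
  recorded, since the step that leads into \<open>j\<close> checks it; this allows the start
  \<open>n\<close>, \<open>n\<close>, where the bottom sentinel is its own predecessor.
  \<open>r\<close> bounds the number of steps and will be the number of relaxation rounds.\<close>

inductive path :: "nat \<Rightarrow> nat \<Rightarrow> real \<Rightarrow> nat \<Rightarrow> nat \<Rightarrow> nat \<Rightarrow> nat set \<Rightarrow> bool" for p q \<mu> where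
  top: "path p q \<mu> r i (n + 1) {}"
| step: "path p q \<mu> r j k X \<Longrightarrow> admissible p q \<mu> i j k \<Longrightarrow> j < n + 2 \<Longrightarrow> k < n + 2 \<Longrightarrow>
    path p q \<mu> (Suc r) i j (if k < n then insert k X else X)"

section \<open>Paths describe exactly the robust chains\<close>

lemma path_mono: "path p q \<mu> r i j X \<Longrightarrow> r \<le> r' \<Longrightarrow> path p q \<mu> r' i j X"
proof (induction r i j X arbitrary: r' rule: path.induct)
  case (top r i)
  show ?case by (rule path.top)
next
  case (step r j k X i)
  then obtain r'' where "r' = Suc r''" "r \<le> r''" by (cases r') auto
  with step show ?case using path.step by simp
qed

text \<open>The two parts about replacements \<open>e\<close> differ because an element \<open>f\<close> of \<open>X\<close> has its predecessor
  in \<open>insert j X\<close>, while the predecessor of \<open>j\<close> is \<open>i\<close>.\<close>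

lemma path_sound:
  assumes "path p q \<mu> r i j X"
  shows "X \<subseteq> {..<n}" "\<And>x y. x \<in> X \<Longrightarrow> y \<in> X \<Longrightarrow> x \<noteq> y \<Longrightarrow> comparable x y"
    "\<And>x. x \<in> X \<Longrightarrow> prec j x"
    "\<And>f. f \<in> X \<Longrightarrow> comparable f p \<and> comparable f q"
    "\<And>f. f \<in> X \<Longrightarrow> cover p q \<mu> f \<or> (\<exists>e<n. e \<noteq> f \<and> \<mu> + W f \<le> W e \<and> prec j e \<and>
       (\<forall>x\<in>X - {f}. comparable x e))"
    "j < n \<Longrightarrow> comparable j p \<and> comparable j q \<and> (cover p q \<mu> j \<or>
       (\<exists>e<n. e \<noteq> j \<and> \<mu> + W j \<le> W e \<and> prec i e \<and> (\<forall>x\<in>X. prec e x)))"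
proof -
  have "X \<subseteq> {..<n} \<and> (\<forall>x\<in>X. \<forall>y\<in>X. x \<noteq> y \<longrightarrow> comparable x y) \<and> (\<forall>x\<in>X. prec j x) \<and>
    (\<forall>f\<in>X. comparable f p \<and> comparable f q) \<and>
    (\<forall>f\<in>X. cover p q \<mu> f \<or> (\<exists>e<n. e \<noteq> f \<and> \<mu> + W f \<le> W e \<and> prec j e \<and>
       (\<forall>x\<in>X - {f}. comparable x e))) \<and>
    (j < n \<longrightarrow> comparable j p \<and> comparable j q \<and> (cover p q \<mu> j \<or>
       (\<exists>e<n. e \<noteq> j \<and> \<mu> + W j \<le> W e \<and> prec i e \<and> (\<forall>x\<in>X. prec e x))))"
    using assms
  proof (induction r i j X rule: path.induct)
    case (top r i)
    show ?case by simp
  next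
    case (step r j k X i)
    have jk: "prec j k" using step.hyps(2) by (simp add: admissible_def)
    have k: "k < n \<or> k = n + 1"
      using step.hyps(3,4) jk not_prec_bot[of j] by (cases "k = n") auto
    have adm: "j < n \<longrightarrow> comparable j p \<and> comparable j q \<and>
       (cover p q \<mu> j \<or> (\<exists>e<n. e \<noteq> j \<and> prec i e \<and> prec e k \<and> \<mu> + W j \<le> W e))"
      using step.hyps(2) by (simp add: admissible_def)
    show ?case
    proof (cases "k < n")
      case True
      have kx: "prec k x" if "x \<in> X" for x using step.IH that by blast
      have below: "prec e x" if "prec e k" "x \<in> insert k X" for e x
        using that kx[of x] prec_trans[of e k x] step.hyps(4) by auto
      have 2: "\<forall>x\<in>insert k X. \<forall>y\<in>insert k X. x \<noteq> y \<longrightarrow> comparable x y"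
        using step.IH kx by (auto simp: comparable_def)
      have 5: "cover p q \<mu> f \<or> (\<exists>e<n. e \<noteq> f \<and> \<mu> + W f \<le> W e \<and> prec j e \<and>
         (\<forall>x\<in>insert k X - {f}. comparable x e))" if f: "f \<in> insert k X" for f
      proof (cases "cover p q \<mu> f")
        case False
        show ?thesis
        proof (cases "f = k")
          case True
          \<comment> \<open>The induction hypothesis concerns the pair \<open>j\<close>,
            \<open>k\<close>, so its clause about the second component supplies a replacement of
            \<open>k\<close> that lies after \<open>j\<close> and before all of
            \<open>X\<close>.\<close>
          with step.IH \<open>k < n\<close> False obtain e where e: "e < n" "e \<noteq> k" "\<mu> + W k \<le> W e" "prec j e"
            "\<forall>x\<in>X. prec e x" by blast
          then show ?thesis using True by (auto simp: comparable_def)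
        next
          case ne: False
          with f False step.IH obtain e where e: "e < n" "e \<noteq> f" "\<mu> + W f \<le> W e" "prec k e"
            "\<forall>x\<in>X - {f}. comparable x e" by blast
          then show ?thesis using prec_trans[OF jk e(4)] step.hyps(4) by (auto simp: comparable_def)
        qed
      qed simp
      have 6: "j < n \<longrightarrow> comparable j p \<and> comparable j q \<and> (cover p q \<mu> j \<or>
       (\<exists>e<n. e \<noteq> j \<and> \<mu> + W j \<le> W e \<and> prec i e \<and> (\<forall>x\<in>insert k X. prec e x)))"
        using adm below by blast
      show ?thesis using step.IH True 2 5 6 below[OF jk] by simp
    next
      case False
      then have "k = n + 1" using k by simp
      moreover have "\<not> prec (n + 1) x" if "x \<in> X" for x
        using not_top_prec[of x] step.IH that by fastforce
      ultimately have "X = {}" using step.IH by blast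
      then show ?thesis using False adm by auto
    qed
  qed
  then show "X \<subseteq> {..<n}" "\<And>x y. x \<in> X \<Longrightarrow> y \<in> X \<Longrightarrow> x \<noteq> y \<Longrightarrow> comparable x y"
    "\<And>x. x \<in> X \<Longrightarrow> prec j x"
    "\<And>f. f \<in> X \<Longrightarrow> comparable f p \<and> comparable f q"
    "\<And>f. f \<in> X \<Longrightarrow> cover p q \<mu> f \<or> (\<exists>e<n. e \<noteq> f \<and> \<mu> + W f \<le> W e \<and> prec j e \<and>
       (\<forall>x\<in>X - {f}. comparable x e))"
    "j < n \<Longrightarrow> comparable j p \<and> comparable j q \<and> (cover p q \<mu> j \<or>
       (\<exists>e<n. e \<noteq> j \<and> \<mu> + W j \<le> W e \<and> prec i e \<and> (\<forall>x\<in>X. prec e x)))"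
    by blast+
qed

text \<open>Soundness of an arbitrary guess: \<open>p\<close> and \<open>q\<close> need only be
  distinct and worth at least \<mu>, not the best candidates. The path conditions already provide an
  answer to every deletion, so wrong guesses never overestimate.\<close>

lemma path_robust:
  assumes path: "path p q \<mu> r n n X" and pq: "p \<noteq> q" "p < n + 2" "q < n + 2"
    and \<mu>: "\<mu> \<le> W p" "\<mu> \<le> W q"
  shows "feasible n A B X" "sum W X + \<mu> \<le> robust_val n A B W X"
proof -
  show feas: "feasible n A B X"
    using path_sound[OF path] by (simp add: feasible_iff)
  note fin = finite_feasible[OF feas]
  have out: "z \<notin> X" if "z = p \<or> z = q" for z
    using path_sound(1,4)[OF path] prec_irrefl that by (fastforce simp: comparable_def)
  have add: "sum W (del X f) + W z \<le> repair_val n A B W X f"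
    if z: "z = p \<or> z = q" and f: "f \<noteq> Some z" for z f
  proof (cases "z < n")
    case True
    have "feasible n A B (insert z (del X f))"
      using feasible_del[OF feas] True
    proof (rule feasible_insert)
      fix i assume "i \<in> del X f"
      then have "i \<in> X" by (cases f) auto
      then show "comparable i z" using path_sound(4)[OF path] z by blast
    qed
    then have "Some z \<in> repairs n A B X f" using Some_repairs True out[OF z] f by simp
    moreover have "z \<notin> del X f" using out[OF z] by (cases f) auto
    moreover have "finite (del X f)" using fin by (cases f) auto
    ultimately show ?thesis using repair_val_ge[of "Some z" n A B X f W] by (simp add: wt_def)
  next
    case False
    then have "W z = 0" using z pq W_sentinel by (metis One_nat_def add_2_eq_Suc' add_Suc_right
      add.right_neutral less_antisym not_less_eq)
    then show ?thesis using repair_val_ge[OF None_repairs[OF feas, of f], of W] by (simp add: wt_def)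
  qed
  have "sum W X + \<mu> \<le> repair_val n A B W X f" for f
  proof (cases "\<exists>g\<in>X. f = Some g")
    case True
    then obtain g where g: "g \<in> X" "f = Some g" by blast
    have s: "sum W X = sum W (X - {g}) + W g" using sum.remove[OF fin g(1), of W] by simp
    have "cover p q \<mu> g \<or> (\<exists>e<n. e \<noteq> g \<and> \<mu> + W g \<le> W e \<and> (\<forall>x\<in>X - {g}. comparable x e))"
      using path_sound(5)[OF path g(1)] by blast
    then show ?thesis
    proof
      assume "cover p q \<mu> g"
      then obtain z where z: "z = p \<or> z = q" "\<mu> + W g \<le> W z" unfolding cover_def by blast
      then have "f \<noteq> Some z" using g out by auto
      from add[OF z(1) this] show ?thesis using g(2) s z(2) by simp
    next
      assume "\<exists>e<n. e \<noteq> g \<and> \<mu> + W g \<le> W e \<and> (\<forall>x\<in>X - {g}. comparable x e)"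
      then obtain e where e: "e < n" "e \<noteq> g" "\<mu> + W g \<le> W e" "\<forall>x\<in>X - {g}. comparable x e" by blast
      \<comment> \<open>Otherwise \<open>e\<close>, being different from \<open>g\<close>, would
        have to be comparable to itself.\<close>
      have "e \<notin> X" using e(1,2,4) prec_irrefl[of e] by (auto simp: comparable_def)
      moreover have "feasible n A B (insert e (X - {g}))"
        using feasible_insert[OF feasible_subset[OF feas] e(1), of "X - {g}"] e(4) by blast
      ultimately have "Some e \<in> repairs n A B X f" using Some_repairs e(1,2) g(2) by simp
      from repair_val_ge[OF this, of W] show ?thesis
        using g(2) \<open>e \<notin> X\<close> fin s e(3) by (simp add: wt_def)
    qed
  next
    case False
    then have d: "del X f = X" by (cases f) auto
    \<comment> \<open>The adversary can forbid one of the two candidates but not both.\<close>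
    obtain z where "z = p \<or> z = q" "f \<noteq> Some z" using pq(1) by (cases "f = Some p") auto
    from add[OF this] show ?thesis using d \<open>z = p \<or> z = q\<close> \<mu> by auto
  qed
  then show "sum W X + \<mu> \<le> robust_val n A B W X"
    using robust_val_attained[of n A B W X] by metis
qed

text \<open>The assumption on replacements expresses "between the neighbours of \<open>f\<close>"
  without naming neighbours: \<open>e\<close> inherits all order relations of \<open>f\<close> to
  \<open>T\<close>. The path needs one step per element and one more to the top sentinel.\<close>

lemma path_of_chain:
  assumes T: "feasible n A B T"
    and comp: "\<And>f. f \<in> T \<Longrightarrow> comparable f p \<and> comparable f q"
    and cov: "\<And>f. f \<in> T \<Longrightarrow> cover p q \<mu> f \<or> (\<exists>e<n. e \<noteq> f \<and> \<mu> + W f \<le> W e \<and>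
      (\<forall>g\<in>T. (prec g f \<longrightarrow> prec g e) \<and> (prec f g \<longrightarrow> prec e g)))"
  shows "path p q \<mu> (card T + 1) n n T"
proof -
  \<comment> \<open>Generalised to the part \<open>X\<close> of the chain still ahead of
    \<open>j\<close>, with \<open>i\<close> before \<open>j\<close>; at the start the bottom
    sentinel takes both places.\<close>
  have "path p q \<mu> (card X + 1) i j X"
    if "X \<subseteq> T" "\<forall>x\<in>X. prec j x" "j \<in> T \<or> j = n" "j \<in> T \<Longrightarrow> i \<in> T \<and> prec i j \<or> i = n" for X i j
    using that
  proof (induction "card X" arbitrary: X i j)
    case 0
    have j: "j < n + 2" "j \<noteq> n + 1" using 0 T by (auto simp: feasible_iff)
    have top: "prec j (n + 1)" using before_top[OF j] by (simp add: prec_def)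
    have "finite X" using 0 finite_feasible[OF T] finite_subset by blast
    then have "X = {}" using 0 by simp
    moreover have "admissible p q \<mu> i j (n + 1)"
    proof (cases "j < n")
      case True
      then have jT: "j \<in> T" using 0 by auto
      have "prec i e" if "e < n" "\<forall>g\<in>T. prec g j \<longrightarrow> prec g e" for e
        using 0(5)[OF jT] that bot_before[of e] by (auto simp: prec_def)
      moreover have "prec e (n + 1)" if "e < n" for e
        using that before_top[of e] by (simp add: prec_def)
      ultimately show ?thesis using top comp[OF jT] cov[OF jT] unfolding admissible_def by blast
    qed (use top in \<open>simp add: admissible_def\<close>)
    ultimately show ?case
      using path.step[OF path.top[of p q \<mu> 0 j], of i] j by simp
  next
    case (Suc c)
    have j: "j < n + 2" "j \<noteq> n + 1" using Suc.prems T by (auto simp: feasible_iff)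
    have fin: "finite X" using Suc.prems finite_feasible[OF T] finite_subset by blast
    have "X \<noteq> {}" using Suc.hyps(2) by auto
    \<comment> \<open>Among disjoint nonempty intervals, the one that starts first precedes all
      others.\<close>
    then obtain k where k: "k \<in> X" "\<And>x. x \<in> X \<Longrightarrow> A k \<le> A x"
      using fin arg_min_if_finite[OF fin, of A] by (metis not_le_imp_less)
    have kT: "k \<in> T" "k < n" using k Suc.prems T by (auto simp: feasible_iff)
    have kx: "prec k x" if x: "x \<in> X - {k}" for x
    proof -
      have "comparable k x" using T x kT Suc.prems(1) by (auto simp: feasible_iff)
      moreover have "\<not> prec x k"
      proof -
        have "x < n" using x Suc.prems(1) T by (auto simp: feasible_iff)
        then show ?thesis using k(2)[of x] x A_less_B[of x] by (auto simp: prec_def)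
      qed
      ultimately show ?thesis by (simp add: comparable_def)
    qed
    have jk: "prec j k" using Suc.prems(2) k(1) by blast
    have "path p q \<mu> (card (X - {k}) + 1) j k (X - {k})"
      using Suc.prems kx kT jk k(1) by (intro Suc.hyps(1)) (use Suc.hyps(2) k(1) in auto)
    moreover have "admissible p q \<mu> i j k"
    proof (cases "j < n")
      case True
      then have jT: "j \<in> T" using Suc.prems by auto
      have "prec i e" if "e < n" "\<forall>g\<in>T. prec g j \<longrightarrow> prec g e" for e
        using Suc.prems(4)[OF jT] that bot_before[of e] by (auto simp: prec_def)
      then show ?thesis using jk kT comp[OF jT] cov[OF jT] unfolding admissible_def by blast
    qed (simp add: admissible_def jk)
    ultimately have "path p q \<mu> (Suc (card (X - {k}) + 1)) i j (insert k (X - {k}))"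
      using path.step[of p q \<mu> "card (X - {k}) + 1" j k "X - {k}" i] j kT(2) by simp
    moreover have "Suc (card (X - {k})) = card X" using card.remove[OF fin k(1)] by simp
    ultimately show ?case using k(1) by (simp add: insert_absorb)
  qed
  moreover have "\<forall>x\<in>T. prec n x" using T bot_before by (auto simp: feasible_iff prec_def)
  ultimately show ?thesis by blast
qed

lemma exists_best:
  assumes "finite E" "E \<subseteq> {..<n}" "z = n \<or> z = n + 1"
  obtains p where "p \<in> insert z E" "\<And>e. e \<in> E \<Longrightarrow> W e \<le> W p" "E = {} \<Longrightarrow> p = z" "E \<noteq> {} \<Longrightarrow> p \<in> E"
proof (cases "E = {}")
  case False
  then obtain p where "p \<in> E" "\<And>e. e \<in> E \<Longrightarrow> W e \<le> W p"
    using arg_min_if_finite[OF assms(1), of "\<lambda>e. - W e"] by (metis neg_less_iff_less not_le_imp_less)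
  then show thesis using that False by blast
qed (use that in blast)

text \<open>Completeness: for \<open>p\<close> the best and \<open>q\<close> the second best job
  that can be added to \<open>T\<close>, and \<mu> the exact gap, \<open>T\<close> is itself a path
  and the bound of \<open>path_robust\<close> is attained.\<close>

lemma robust_path:
  assumes T: "feasible n A B T"
  shows "\<exists>p<n + 2. \<exists>q<n + 2. \<exists>x<n + 2. \<exists>y<n + 2. p \<noteq> q \<and> W x - W y \<le> W p \<and> W x - W y \<le> W q \<and>
    path p q (W x - W y) (n + 2) n n T \<and> robust_val n A B W T = sum W T + (W x - W y)"
proof -
  note fin = finite_feasible[OF T]
  have Tn: "T \<subseteq> {..<n}" using T by (simp add: feasible_iff)
  define E where "E = {e. e < n \<and> e \<notin> T \<and> feasible n A B (insert e T)}"
  have finE: "finite E" and En: "E \<subseteq> {..<n}" by (auto simp: E_def)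
  obtain p where p: "p \<in> insert n E" "\<And>e. e \<in> E \<Longrightarrow> W e \<le> W p" "E = {} \<Longrightarrow> p = n" "E \<noteq> {} \<Longrightarrow> p \<in> E"
    using exists_best[OF finE En, of n] by blast
  have finE': "finite (E - {p})" and En': "E - {p} \<subseteq> {..<n}" using finE En by auto
  \<comment> \<open>The default here is the other sentinel, so \<open>p\<close> and \<open>q\<close>
    differ even when fewer than two jobs can be added.\<close>
  obtain q where q: "q \<in> insert (n + 1) (E - {p})" "\<And>e. e \<in> E - {p} \<Longrightarrow> W e \<le> W q"
    "E - {p} = {} \<Longrightarrow> q = n + 1" "E - {p} \<noteq> {} \<Longrightarrow> q \<in> E - {p}"
    using exists_best[OF finE' En', of "n + 1"] by blast
  have pn: "p < n + 2" "q < n + 2" using p(1) q(1) En by auto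
  have pq: "p \<noteq> q" using p(1) q(1) En by auto
  have Wpq: "W q \<le> W p" using p q(1) W_nonneg'[OF pn(1)] W_sentinel by auto
  define \<mu> where "\<mu> = robust_val n A B W T - sum W T"
  have repE: "e \<in> E" if "Some e \<in> repairs n A B T f" "del T f = T" for e f
    using that by (auto simp: E_def Some_repairs)
  have ex: "\<exists>x<n + 2. \<exists>y<n + 2. \<mu> = W x - W y"
  proof -
    obtain f where f: "robust_val n A B W T = repair_val n A B W T f"
      using robust_val_attained .
    obtain e where e: "e \<in> repairs n A B T f" "repair_val n A B W T f = wt W (addj (del T f) e)"
      using repair_val_attained[OF T] .
    \<comment> \<open>\<open>y\<close> is the job lost and \<open>x\<close> below the job gained in
      an optimal play; the sentinel \<open>n\<close>, of weight 0, stands in where nothing is lost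
      or gained.\<close>
    obtain y where y: "y < n + 2" "sum W (del T f) = sum W T - W y"
    proof (cases "del T f = T")
      case True
      then show ?thesis using that[of n] W_sentinel by simp
    next
      case False
      then obtain g where g: "f = Some g" "g \<in> T" by (cases f) auto
      then show ?thesis using that[of g] Tn sum.remove[OF fin g(2), of W] by auto
    qed
    obtain x where x: "x < n + 2" "wt W (addj (del T f) e) = sum W (del T f) + W x"
    proof (cases e)
      case None
      then show ?thesis using that[of n] W_sentinel by (simp add: wt_def)
    next
      case (Some x)
      then have "x < n" "x \<notin> T" using e(1) Some_repairs by auto
      moreover then have "x \<notin> del T f" by (cases f) auto
      moreover have "finite (del T f)" using fin by (cases f) auto
      ultimately show ?thesis using that[of x] Some by (simp add: wt_def)
    qed
    show ?thesis using x y f e(2) \<mu>_def by (intro exI[of _ x] exI[of _ y] conjI) auto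
  qed
  have q\<mu>: "\<mu> \<le> W q"
  proof -
    \<comment> \<open>Let the adversary forbid the best addition \<open>p\<close>. The best
      remaining one is \<open>q\<close>, so the robust value exceeds the weight of \<open>T\<close>
      by at most \<open>W q\<close>.\<close>
    define f where "f = (if E = {} then None else Some p)"
    have fT: "del T f = T" using p(4) by (auto simp: f_def E_def)
    have fc: "f \<in> choices {..<n}" using p(4) by (auto simp: f_def E_def choices_def)
    obtain e where e: "e \<in> repairs n A B T f" "repair_val n A B W T f = wt W (addj (del T f) e)"
      using repair_val_attained[OF T] .
    have "wt W (addj T e) \<le> sum W T + W q"
    proof (cases e)
      case None
      then show ?thesis using W_nonneg'[OF pn(2)] by (simp add: wt_def)
    next
      case (Some x)
      have "x \<in> E" using repE e(1) Some fT by blast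
      moreover from this have "x \<noteq> p" using e(1) Some by (auto simp: f_def Some_repairs split:
        if_splits)
      ultimately have "W x \<le> W q" using q(2) by blast
      moreover have "x \<notin> T" using \<open>x \<in> E\<close> by (simp add: E_def)
      ultimately show ?thesis using Some fin by (simp add: wt_def)
    qed
    then show ?thesis using robust_val_le[OF fc, of A B W T] e(2) fT by (simp add: \<mu>_def)
  qed
  have comp: "comparable f z" if "f \<in> T" "z \<in> insert n (insert (n + 1) E)" for f z
    using that comparable_sentinel[of f] Tn by (auto simp: E_def feasible_iff)
  have "path p q \<mu> (card T + 1) n n T"
  proof (rule path_of_chain[OF T])
    fix f assume f: "f \<in> T"
    show "comparable f p \<and> comparable f q" using comp[OF f] p(1) q(1) by blast
    obtain e where e: "e \<in> repairs n A B T (Some f)"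
      "repair_val n A B W T (Some f) = wt W (addj (T - {f}) e)"
      using repair_val_attained[OF T, of "Some f" W] by auto
    have "Some f \<in> choices {..<n}" using f Tn by (auto simp: choices_def)
    from robust_val_le[OF this, of A B W T]
    have ge: "sum W T + \<mu> \<le> wt W (addj (T - {f}) e)" using e(2) by (simp add: \<mu>_def)
    have s: "sum W T = sum W (T - {f}) + W f" using sum.remove[OF fin f, of W] by simp
    show "cover p q \<mu> f \<or> (\<exists>e<n. e \<noteq> f \<and> \<mu> + W f \<le> W e \<and>
      (\<forall>g\<in>T. (prec g f \<longrightarrow> prec g e) \<and> (prec f g \<longrightarrow> prec e g)))"
    proof (cases e)
      case None
      then have "\<mu> + W f \<le> W p" using ge s W_nonneg'[OF pn(1)] by (simp add: wt_def)
      then show ?thesis by (simp add: cover_def)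
    next
      case (Some x)
      then have x: "x < n" "x \<notin> T" "x \<noteq> f" "feasible n A B (insert x (T - {f}))"
        using e(1) Some_repairs[of x n A B T "Some f"] f by auto
      have Wx: "\<mu> + W f \<le> W x" using ge s Some x(2) fin by (simp add: wt_def)
      show ?thesis
      proof (cases "comparable f x")
        case True
        have "feasible n A B (insert x T)"
          using T x(1)
        proof (rule feasible_insert)
          fix i assume i: "i \<in> T" "i \<noteq> x"
          show "comparable i x" using True x(4) i by (cases "i = f") (auto simp: feasible_iff)
        qed
        then have "x \<in> E" using x by (simp add: E_def)
        then have "\<mu> + W f \<le> W p" using p(2) Wx by fastforce
        then show ?thesis by (simp add: cover_def)
      next
        case False
        \<comment> \<open>Now \<open>x\<close> conflicts with \<open>f\<close> but is comparable to
          every other \<open>g\<close> in \<open>T\<close>. If \<open>g\<close> precedes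
          \<open>f\<close>, then \<open>x\<close> before \<open>g\<close> would put \<open>x\<close>
          before \<open>f\<close>; hence \<open>g\<close> precedes \<open>x\<close>, and dually on
          the other side.\<close>
        have "(prec g f \<longrightarrow> prec g x) \<and> (prec f g \<longrightarrow> prec x g)" if g: "g \<in> T" for g
        proof (cases "g = f")
          case True
          then show ?thesis using f Tn prec_irrefl[of f] by auto
        next
          case gf: False
          have "comparable g x" using x(2,4) g gf by (auto simp: feasible_iff)
          moreover have "g < n + 2" using g Tn by auto
          ultimately show ?thesis using False prec_trans[of x g f] prec_trans[of f g x]
            by (auto simp: comparable_def)
        qed
        then show ?thesis using x(1,3) Wx by blast
      qed
    qed
  qed
  moreover have "card T \<le> n" using card_mono[OF finite_lessThan Tn] by simp
  \<comment> \<open>At most \<open>n + 1\<close> steps occur; the bound is raised to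
    \<open>n + 2\<close>, the common length of all loops.\<close>
  ultimately have "path p q \<mu> (n + 2) n n T" using path_mono by simp
  moreover obtain x y where xy: "x < n + 2" "y < n + 2" "\<mu> = W x - W y" using ex by blast
  ultimately show ?thesis using pn pq q\<mu> Wpq xy \<mu>_def
    by (intro exI[of _ p] exI[of _ q] exI[of _ x] exI[of _ y] conjI) simp_all
qed

end

section \<open>The algorithm\<close>

abbreviation ILt :: "iexp \<Rightarrow> iexp \<Rightarrow> bexp" where
  "ILt e f \<equiv> Neg (ILe f e)"

abbreviation Disj :: "bexp \<Rightarrow> bexp \<Rightarrow> bexp" where
  "Disj b c \<equiv> Neg (Conj (Neg b) (Neg c))"

abbreviation INeq :: "iexp \<Rightarrow> iexp \<Rightarrow> bexp" where
  "INeq e f \<equiv> Disj (ILt e f) (ILt f e)"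

text \<open>\<open>Row\<close> tabulates the multiples of the bound, since row-major addressing
  would otherwise need a multiplication.\<close>

abbreviation cell :: "ivar \<Rightarrow> ivar \<Rightarrow> iexp" where
  "cell x y \<equiv> IPlus (IA Row (IV x)) (IV y)"

abbreviation comparable_exp :: "ivar \<Rightarrow> ivar \<Rightarrow> bexp" where
  "comparable_exp x y \<equiv>
     Disj (ILe (IA End (IV x)) (IA Beg (IV y))) (ILe (IA End (IV y)) (IA Beg (IV x)))"

abbreviation covers_exp :: "ivar \<Rightarrow> bexp" where
  "covers_exp x \<equiv> RLe (RPlus (RV Slack) (RA Wt (IV Snd))) (RA Wt (IV x))"

definition try_alternative :: com where
  "try_alternative =
     Cond (Conj (ILt (IV Alt) (IV Jobs)) (Conj (INeq (IV Alt) (IV Snd))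
         (Conj (ILe (IA End (IV Fst)) (IA Beg (IV Alt)))
           (Conj (ILe (IA End (IV Alt)) (IA Beg (IV Thd))) (covers_exp Alt)))))
       (ISet Ok (IC 1)) Skip"

text \<open>The conjunct \<open>prec j k\<close> of \<open>admissible\<close> is left to
  \<open>relax\<close>, which tests it before coming here.\<close>

definition check_admissible :: com where
  "check_admissible =
     ISet Ok (IC 0) ;;
     Cond (ILe (IV Jobs) (IV Snd)) (ISet Ok (IC 1))
      (Cond (Conj (comparable_exp Snd Cand1) (comparable_exp Snd Cand2))
        (Cond (Disj (covers_exp Cand1) (covers_exp Cand2)) (ISet Ok (IC 1))
          (For Alt try_alternative))
        Skip)"

text \<open>\<open>Val\<close> and \<open>Sel\<close> are the tables of the dynamic program, indexed by pairs of consecutive chain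
  elements.  A negative value means that no chain is known; \<open>Sel\<close> stores the chain itself, as a
  sum of distinct powers of two.\<close>

definition relax :: com where
  "relax =
     Cond (Conj (ILe (IA End (IV Snd)) (IA Beg (IV Thd)))
         (Conj (RLe (RC 0) (RA Val (cell Snd Thd)))
           (Neg (RLe (RPlus (RA Val (cell Snd Thd)) (RA Wt (IV Thd))) (RA Val (cell Fst Snd))))))
       (check_admissible ;;
        Cond (ILe (IC 1) (IV Ok))
          (IPut Sel (cell Fst Snd) (IPlus (IA Sel (cell Snd Thd)) (IA Pow (IV Thd))) ;;
           RPut Val (cell Fst Snd) (RPlus (RA Val (cell Snd Thd)) (RA Wt (IV Thd))))
          Skip)
       Skip"

text \<open>Pairs ending in the top sentinel start with the base case of \<open>path\<close>, the
  empty rest of weight 0; all other cells are marked unknown.\<close>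

definition reset :: com where
  "reset = For Fst (For Snd
     (Cond (INeq (IV Snd) (IPlus (IV Jobs) (IC 1)))
        (RPut Val (cell Fst Snd) (RC (-1))) (RPut Val (cell Fst Snd) (RC 0)) ;;
      IPut Sel (cell Fst Snd) (IC 0)))"

definition relax_all :: com where
  "relax_all = For Fst (For Snd (For Thd relax))"

definition improve :: com where
  "improve =
     reset ;; For Rnd relax_all ;;
     Cond (RLe (RPlus (RA Val (cell Jobs Jobs)) (RV Slack)) (RV BestVal)) Skip
       (RSet BestVal (RPlus (RA Val (cell Jobs Jobs)) (RV Slack)) ;;
        ISet BestSet (IA Sel (cell Jobs Jobs)))"

definition try_guess :: com where
  "try_guess =
     RSet Slack (RMinus (RA Wt (IV Gain)) (RA Wt (IV Loss))) ;;
     Cond (Conj (INeq (IV Cand1) (IV Cand2)) (Conj (RLe (RV Slack) (RA Wt (IV Cand1)))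
         (RLe (RV Slack) (RA Wt (IV Cand2)))))
       improve Skip"

text \<open>The initial values describe the empty chain, whose robust value is at least 0 because
  doing nothing is a legal repair.\<close>

definition search :: com where
  "search = RSet BestVal (RC 0) ;; ISet BestSet (IC 0) ;;
     For Cand1 (For Cand2 (For Gain (For Loss try_guess)))"

text \<open>Greedy binary decoding. The powers fall as the index grows, so scanning upwards reads
  the most significant bit first, with additions and comparisons only.\<close>

definition decode :: com where
  "decode = ISet Acc (IC 0) ;;
     For Snd (Cond (Conj (ILt (IV Snd) (IV Jobs))
         (ILe (IPlus (IV Acc) (IA Pow (IV Snd))) (IV BestSet)))
       (ISet Acc (IPlus (IV Acc) (IA Pow (IV Snd))) ;; RPut Out (IV Snd) (RC 1))
       (RPut Out (IV Snd) (RC 0)))"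

section \<open>Rules for loops\<close>

lemma loop_invariant:
  assumes "P 0 s" "\<And>i s. i < k \<Longrightarrow> P i s \<Longrightarrow> P (Suc i) (f (set_iv x i s))"
  shows "P k (loop k x f s)"
proof -
  have "l \<le> k \<Longrightarrow> P l (loop l x f s)" for l
  proof (induction l)
    case 0
    show ?case using assms(1) by (simp add: loop_0)
  next
    case (Suc l)
    then show ?case using assms(2)[of l "loop l x f s"] by (simp add: loop_Suc)
  qed
  then show ?thesis by simp
qed

text \<open>The rule for exhaustive search: iteration \<open>i\<close> achieves \<open>Q i\<close>,
  and later iterations only move up in the preorder \<open>M\<close>, under which \<open>Q i\<close>
  is stable. It nests, the conclusion for an inner loop being the \<open>Q\<close> of the outer
  one.\<close>

lemma loop_all:
  assumes "I s"
    and step: "\<And>i s. i < k \<Longrightarrow> I s \<Longrightarrow> I (f (set_iv x i s)) \<and> M s (f (set_iv x i s)) \<and>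
      Q i (f (set_iv x i s))"
    and refl: "\<And>s. M s s" and trans: "\<And>s t u. M s t \<Longrightarrow> M t u \<Longrightarrow> M s u"
    and mono: "\<And>i s t. Q i s \<Longrightarrow> M s t \<Longrightarrow> Q i t"
  shows "I (loop k x f s) \<and> M s (loop k x f s) \<and> (\<forall>i<k. Q i (loop k x f s))"
proof (rule loop_invariant[where P = "\<lambda>l t. I t \<and> M s t \<and> (\<forall>i<l. Q i t)"])
  show "I s \<and> M s s \<and> (\<forall>i<0. Q i s)" using assms(1) refl by simp
next
  fix l t assume l: "l < k" and t: "I t \<and> M s t \<and> (\<forall>i<l. Q i t)"
  let ?t = "f (set_iv x l t)"
  have 1: "I ?t" "M t ?t" "Q l ?t" using step[OF l] t by blast+
  have "Q i ?t" if "i < Suc l" for i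
    using that 1(3) mono[OF _ 1(2), of i] t by (cases "i = l") auto
  moreover have "M s ?t" using t by (intro trans[OF _ 1(2)]) blast
  ultimately show "I ?t \<and> M s ?t \<and> (\<forall>i<Suc l. Q i ?t)" using 1(1) by blast
qed

lemma cell_inject:
  fixes i j i' j' N :: nat
  assumes "j < N" "j' < N"
  shows "i * N + j = i' * N + j' \<longleftrightarrow> i = i' \<and> j = j'"
proof
  assume e: "i * N + j = i' * N + j'"
  have "(i * N + j) mod N = j" "(i' * N + j') mod N = j'" using assms by simp_all
  then have "j = j'" using e by simp
  then show "i = i' \<and> j = j'" using e assms by simp
qed simp

text \<open>\<open>relax\<close> also adds the code of \<open>k\<close> when \<open>k\<close> is the
  top sentinel, which therefore has to be 0, as its weight is. Otherwise the codes stay abstract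
  until decoding.\<close>

locale tables = guarded_jobs +
  fixes Pw :: "nat \<Rightarrow> nat"
  assumes Pw_top: "Pw (n + 1) = 0"
begin

abbreviation N :: nat where
  "N \<equiv> n + 2"

declare add_2_eq_Suc [simp del] add_2_eq_Suc' [simp del]

section \<open>Correctness of the dynamic program\<close>

definition ctx :: "env \<Rightarrow> bool" where
  "ctx s \<longleftrightarrow> iv s Jobs = n \<and> ia s Beg = A \<and> ia s End = B \<and> ia s Pow = Pw \<and> ra s Wt = W \<and>
     (\<forall>i<N. ia s Row i = i * N)"

definition val :: "env \<Rightarrow> nat \<Rightarrow> nat \<Rightarrow> real" where
  "val s i j = ra s Val (i * N + j)"

definition sel :: "env \<Rightarrow> nat \<Rightarrow> nat \<Rightarrow> nat" where
  "sel s i j = ia s Sel (i * N + j)"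

text \<open>The frame condition of one run of the dynamic program: scratch variables and the two
  tables may change, while the guess and the best solution so far may not.\<close>

definition same :: "env \<Rightarrow> env \<Rightarrow> bool" where
  "same s t \<longleftrightarrow> (\<forall>x. x \<notin> {Rnd, Fst, Snd, Thd, Alt, Ok} \<longrightarrow> iv t x = iv s x) \<and> rv t = rv s \<and>
     (\<forall>q. q \<noteq> Sel \<longrightarrow> ia t q = ia s q) \<and> (\<forall>q. q \<noteq> Val \<longrightarrow> ra t q = ra s q)"

lemma same_refl: "same s s"
  by (simp add: same_def)

lemma same_trans: "same s t \<Longrightarrow> same t u \<Longrightarrow> same s u"
  by (simp add: same_def)

lemma same_ctx: "same s t \<Longrightarrow> ctx s \<Longrightarrow> ctx t"
  by (simp add: same_def ctx_def)

lemma same_loop_var: "x \<in> {Rnd, Fst, Snd, Thd, Alt, Ok} \<Longrightarrow> same s (set_iv x v s)"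
  by (auto simp: same_def set_iv_def)

lemma ctx_loop_var: "x \<noteq> Jobs \<Longrightarrow> ctx (set_iv x v s) = ctx s"
  by (simp add: ctx_def set_iv_def)

lemma val_loop_var: "val (set_iv x v s) = val s" "sel (set_iv x v s) = sel s"
  by (simp_all add: val_def sel_def set_iv_def fun_eq_iff)

lemma iv_set_iv: "iv (set_iv x v s) y = (if y = x then v else iv s y)"
  by (simp add: set_iv_def)

lemma check_admissible_correct:
  assumes c: "ctx s" and jk: "prec (iv s Snd) (iv s Thd)"
  shows "\<exists>v. sem N check_admissible s = s\<lparr>iv := (iv s)(Alt := v, Ok :=
    (if admissible (iv s Cand1) (iv s Cand2) (rv s Slack) (iv s Fst) (iv s Snd) (iv s Thd) then 1
      else 0))\<rparr>"
proof -
  let ?p = "iv s Cand1" and ?q = "iv s Cand2" and ?i = "iv s Fst" and ?j = "iv s Snd" and ?k =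
    "iv s Thd"
  let ?\<mu> = "rv s Slack"
  define fits where "fits e \<longleftrightarrow> e < n \<and> e \<noteq> ?j \<and> prec ?i e \<and> prec e ?k \<and> ?\<mu> + W ?j \<le> W e" for e
  have st: "iv s Jobs = n" "ia s Beg = A" "ia s End = B" "ra s Wt = W" using c by (auto simp: ctx_def)
  let ?P = "\<lambda>l t. \<exists>v. t = s\<lparr>iv := (iv s)(Alt := v, Ok := (if \<exists>e<l. fits e then 1 else 0))\<rparr>"
  have scan: "?P N (loop N Alt (sem N try_alternative) (set_iv Ok 0 s))"
  proof (rule loop_invariant[where P = ?P])
    show "?P 0 (set_iv Ok 0 s)"
      by (rule exI[of _ "iv s Alt"]) (simp add: set_iv_def fun_upd_idem fun_upd_twist)
  next
    fix l t assume "?P l t"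
    then obtain v where t: "t = s\<lparr>iv := (iv s)(Alt := v, Ok := (if \<exists>e<l. fits e then 1 else 0))\<rparr>" ..
    have "sem N try_alternative (set_iv Alt l t) = s\<lparr>iv := (iv s)(Alt := l, Ok :=
      (if \<exists>e<Suc l. fits e then 1 else 0))\<rparr>"
      by (auto simp: try_alternative_def t set_iv_def st fits_def prec_def less_Suc_eq fun_eq_iff)
    then show "?P (Suc l) (sem N try_alternative (set_iv Alt l t))" by blast
  qed
  have "(\<exists>e<N. fits e) \<longleftrightarrow> (\<exists>e<n. e \<noteq> ?j \<and> prec ?i e \<and> prec e ?k \<and> ?\<mu> + W ?j \<le> W e)"
    unfolding fits_def using trans_less_add1 by blast
  with scan obtain v where v: "loop N Alt (sem N try_alternative) (set_iv Ok 0 s) = s\<lparr>iv :=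
    (iv s)(Alt := v, Ok :=
    (if \<exists>e<n. e \<noteq> ?j \<and> prec ?i e \<and> prec e ?k \<and> ?\<mu> + W ?j \<le> W e then 1 else 0))\<rparr>" by auto
  let ?u = "set_iv Ok 0 s"
  have b: "beval N (ILe (IV Jobs) (IV Snd)) ?u \<longleftrightarrow> n \<le> ?j"
    "beval N (Conj (comparable_exp Snd Cand1) (comparable_exp Snd Cand2)) ?u \<longleftrightarrow>
       comparable ?j ?p \<and> comparable ?j ?q"
    "beval N (Disj (covers_exp Cand1) (covers_exp Cand2)) ?u \<longleftrightarrow> cover ?p ?q ?\<mu> ?j"
    by (auto simp: set_iv_def st comparable_def prec_def cover_def)
  have sem: "sem N check_admissible s =
    (if n \<le> ?j then set_iv Ok 1 ?u
     else if comparable ?j ?p \<and> comparable ?j ?q then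
       if cover ?p ?q ?\<mu> ?j then set_iv Ok 1 ?u else loop N Alt (sem N try_alternative) ?u
     else ?u)"
    unfolding check_admissible_def sem.simps ieval.simps(1) b ..
  have old: "\<exists>v. set_iv Ok b s = s\<lparr>iv := (iv s)(Alt := v, Ok := b)\<rparr>" for b
    by (rule exI[of _ "iv s Alt"]) (simp add: set_iv_def fun_upd_idem fun_upd_twist)
  have twice: "set_iv Ok 1 (set_iv Ok 0 s) = set_iv Ok 1 s" by (simp add: set_iv_def)
  show ?thesis
    unfolding sem twice using jk v old[of 0] old[of 1]
    by (auto simp: admissible_def)
qed

text \<open>As in the Bellman-Ford algorithm, in-place updates can run ahead of the round counter.
  So a known entry is only claimed to come from a path of some length, and \<open>complete\<close>
  only bounds entries from below by all paths of at most \<open>r\<close> steps.\<close>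

definition traced :: "nat \<Rightarrow> nat \<Rightarrow> real \<Rightarrow> env \<Rightarrow> bool" where
  "traced p q \<mu> s \<longleftrightarrow> (\<forall>i<N. \<forall>j<N. 0 \<le> val s i j \<longrightarrow>
     (\<exists>r X. path p q \<mu> r i j X \<and> val s i j = sum W X \<and> sel s i j = sum Pw X))"

definition complete :: "nat \<Rightarrow> nat \<Rightarrow> real \<Rightarrow> nat \<Rightarrow> env \<Rightarrow> bool" where
  "complete p q \<mu> r s \<longleftrightarrow> (\<forall>i<N. \<forall>j<N. \<forall>X. path p q \<mu> r i j X \<longrightarrow> sum W X \<le> val s i j)"

definition val_le :: "env \<Rightarrow> env \<Rightarrow> bool" where
  "val_le s t \<longleftrightarrow> (\<forall>i<N. \<forall>j<N. val s i j \<le> val t i j)"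

lemma path_finite: "path p q \<mu> r i j X \<Longrightarrow> finite X"
  by (rule finite_subset[OF path_sound(1) finite_lessThan])

text \<open>All of \<open>X\<close> lies after \<open>k\<close>, so \<open>k\<close> is new. Stated
  for general \<open>f\<close> because weights and binary codes accumulate in the same way.\<close>

lemma sum_path_step:
  assumes "path p q \<mu> r j k X" "k < N" "k \<noteq> n" and top: "f (n + 1) = 0"
  shows "sum f (if k < n then insert k X else X) = sum f X + (f k :: 'a :: comm_monoid_add)"
proof (cases "k < n")
  case True
  have "k \<notin> X" using path_sound(3)[OF assms(1), of k] prec_irrefl[of k] assms(2) by blast
  then show ?thesis using True path_finite[OF assms(1)] by (simp add: add.commute)
next
  case False
  then have "k = n + 1" using assms(2,3) by simp
  then show ?thesis using top by simp
qed

lemma relax_correct: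
  assumes c: "ctx s" and tr: "traced p q \<mu> s"
    and st: "iv s Cand1 = p" "iv s Cand2 = q" "rv s Slack = \<mu>" "iv s Fst = i" "iv s Snd =
      j" "iv s Thd = k"
    and ijk: "i < N" "j < N" "k < N"
  defines "t \<equiv> sem N relax s"
  shows "same s t" "iv t Rnd = iv s Rnd" "iv t Fst = i" "iv t Snd = j" "traced p q \<mu> t" "val_le s t"
    "admissible p q \<mu> i j k \<Longrightarrow> 0 \<le> val s j k \<Longrightarrow> val s j k + W k \<le> val t i j"
proof -
  have row: "ia s Row i = i * N" "ia s Row j = j * N" "ia s Beg = A" "ia s End = B" "ra s Wt =
    W" "ia s Pow = Pw"
    using c ijk by (auto simp: ctx_def)
  define go where "go \<longleftrightarrow> prec j k \<and> 0 \<le> val s j k \<and> val s i j < val s j k + W k"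
  define u where "u = sem N check_admissible s"
  have t: "t = (if go then if 1 \<le> iv u Ok then
      sem N (IPut Sel (cell Fst Snd) (IPlus (IA Sel (cell Snd Thd)) (IA Pow (IV Thd))) ;;
           RPut Val (cell Fst Snd) (RPlus (RA Val (cell Snd Thd)) (RA Wt (IV Thd)))) u else u else s)"
    unfolding t_def relax_def go_def u_def val_def by (simp add: st row prec_def not_le)
  have all: "same s t \<and> iv t Rnd = iv s Rnd \<and> iv t Fst = i \<and> iv t Snd = j \<and> traced p q \<mu> t \<and>
    val_le s t \<and>
    (admissible p q \<mu> i j k \<longrightarrow> 0 \<le> val s j k \<longrightarrow> val s j k + W k \<le> val t i j)"
  proof (cases go)
    case False
    then have "t = s" using t by simp
    then show ?thesis using False tr st same_refl
      by (auto simp: val_le_def go_def admissible_def not_less)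
  next
    case True
    then have jk: "prec j k" "0 \<le> val s j k" "val s i j < val s j k + W k" by (auto simp: go_def)
    from check_admissible_correct[OF c] jk(1) st obtain v where
      u: "u = s\<lparr>iv := (iv s)(Alt := v, Ok := (if admissible p q \<mu> i j k then 1 else 0))\<rparr>"
      unfolding u_def by auto
    show ?thesis
    proof (cases "admissible p q \<mu> i j k")
      case False
      then have "t = u" using True t u by simp
      then show ?thesis using False u tr st
        by (auto simp: val_le_def same_def traced_def val_def sel_def)
    next
      case adm: True
      have t': "t = u\<lparr>ia := (ia u)(Sel := (ia u Sel)(i * N + j := sel s j k + Pw k)),
          ra := (ra u)(Val := (ra u Val)(i * N + j := val s j k + W k))\<rparr>"
        using True adm t u row by (simp add: st val_def sel_def)
      have val_t: "val t i' j' = (if i' = i \<and> j' = j then val s j k + W k else val s i' j')"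
        "sel t i' j' = (if i' = i \<and> j' = j then sel s j k + Pw k else sel s i' j')" if "j' < N" for
          i' j'
        using cell_inject[OF that ijk(2), of i' i] by (auto simp: val_def sel_def t' u)
      have kn: "k \<noteq> n" using jk(1) not_prec_bot ijk(2) by blast
      obtain r X where X: "path p q \<mu> r j k X" "val s j k = sum W X" "sel s j k = sum Pw X"
        using tr jk(2) ijk unfolding traced_def by blast
      have new: "path p q \<mu> (Suc r) i j (if k < n then insert k X else X)"
        using path.step[OF X(1) adm ijk(2,3)] .
      have "traced p q \<mu> t"
        unfolding traced_def
      proof (intro allI impI)
        fix i' j' assume h: "i' < N" "j' < N" "0 \<le> val t i' j'"
        show "\<exists>r X. path p q \<mu> r i' j' X \<and> val t i' j' = sum W X \<and> sel t i' j' = sum Pw X"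
        proof (cases "i' = i \<and> j' = j")
          case True
          then show ?thesis
            using new val_t[OF h(2), of i'] X(2,3) sum_path_step[OF X(1) ijk(3) kn, of W]
              sum_path_step[OF X(1) ijk(3) kn, of Pw] W_sentinel Pw_top
            by (intro exI[of _ "Suc r"] exI[of _ "if k < n then insert k X else X"]) simp
        next
          case False
          then have "val t i' j' = val s i' j'" "sel t i' j' = sel s i' j'"
            using val_t[OF h(2), of i'] by auto
          then show ?thesis using tr h unfolding traced_def by simp
        qed
      qed
      moreover have "val_le s t" using val_t(1) jk(3) by (auto simp: val_le_def)
      moreover have "same s t" by (auto simp: same_def t' u)
      moreover have "val s j k + W k \<le> val t i j" using val_t(1)[OF ijk(2)] by simp
      moreover have "iv t Rnd = iv s Rnd" "iv t Fst = i" "iv t Snd = j" using st by (simp_all add: t' u)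
      ultimately show ?thesis by blast
    qed
  qed
  then show "same s t" "iv t Rnd = iv s Rnd" "iv t Fst = i" "iv t Snd = j" "traced p q \<mu> t" "val_le s t"
    "admissible p q \<mu> i j k \<Longrightarrow> 0 \<le> val s j k \<Longrightarrow> val s j k + W k \<le> val t i j"
    by blast+
qed

lemma val_le_refl: "val_le s s"
  by (simp add: val_le_def)

lemma val_leD: "val_le s t \<Longrightarrow> i < N \<Longrightarrow> j < N \<Longrightarrow> val s i j \<le> val t i j"
  by (simp add: val_le_def)

lemma val_le_trans: "val_le s t \<Longrightarrow> val_le t u \<Longrightarrow> val_le s u"
  unfolding val_le_def[of s u]
  by (intro allI impI, rule order_trans[OF val_leD[of s t] val_leD[of t u]]) simp_all

lemma complete_mono: "complete p q \<mu> r s \<Longrightarrow> val_le s t \<Longrightarrow> complete p q \<mu> r t"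
  unfolding complete_def by (intro allI impI, rule order_trans[OF _ val_leD[of s t]]) simp_all

definition dp_inv :: "env \<Rightarrow> nat \<Rightarrow> nat \<Rightarrow> real \<Rightarrow> nat \<Rightarrow> env \<Rightarrow> bool" where
  "dp_inv s0 p q \<mu> r s \<longleftrightarrow> same s0 s \<and> traced p q \<mu> s \<and> complete p q \<mu> r s"

lemma dp_inv_loop_var:
  "x \<in> {Rnd, Fst, Snd, Thd, Alt, Ok} \<Longrightarrow> dp_inv s0 p q \<mu> r s \<Longrightarrow> dp_inv s0 p q \<mu> r (set_iv x v s)"
  using same_trans same_loop_var by (auto simp: dp_inv_def traced_def complete_def val_loop_var)

lemma val_le_loop_var: "val_le (set_iv x v s) t = val_le s t" "val_le s (set_iv x v t) = val_le s t"
  by (simp_all add: val_le_def val_loop_var)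

definition relaxed :: "nat \<Rightarrow> nat \<Rightarrow> real \<Rightarrow> nat \<Rightarrow> nat \<Rightarrow> nat \<Rightarrow> nat \<Rightarrow> env \<Rightarrow> bool" where
  "relaxed p q \<mu> r i j k s \<longleftrightarrow>
     (\<forall>X. path p q \<mu> r j k X \<longrightarrow> admissible p q \<mu> i j k \<longrightarrow> sum W X + W k \<le> val s i j)"

lemma relaxed_mono: "relaxed p q \<mu> r i j k s \<Longrightarrow> val_le s t \<Longrightarrow> i < N \<Longrightarrow> j < N \<Longrightarrow> relaxed p q \<mu> r i j k t"
  unfolding relaxed_def by (intro allI impI, rule order_trans[OF _ val_leD[of s t]]) simp_all

lemma sum_path_nonneg: "path p q \<mu> r i j X \<Longrightarrow> 0 \<le> sum W X"
  using path_sound(1)[of p q \<mu> r i j X] W_nonneg by (intro sum_nonneg) auto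

text \<open>One Bellman-Ford round. A path of \<open>r + 1\<close> steps is an edge followed by a
  path of \<open>r\<close> steps; the latter is dominated by the table when its edge is relaxed, and
  later updates only raise entries.\<close>

lemma relax_all_correct:
  assumes c: "ctx s0" and g: "iv s0 Cand1 = p" "iv s0 Cand2 = q" "rv s0 Slack = \<mu>"
    and s: "dp_inv s0 p q \<mu> r s"
  shows "dp_inv s0 p q \<mu> (Suc r) (sem N relax_all s)"
proof -
  let ?I = "dp_inv s0 p q \<mu> r"
  have third: "(?I t' \<and> iv t' Fst = i \<and> iv t' Snd = j) \<and> val_le t t' \<and> (\<forall>k<N. relaxed p q \<mu> r i j k t')"
    if "?I t \<and> iv t Fst = i \<and> iv t Snd = j" "i < N" "j < N" "t' = sem N (For Thd relax) t" for i j t t'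
    unfolding that(4) sem.simps
  proof (rule loop_all[where I = "\<lambda>t. ?I t \<and> iv t Fst = i \<and> iv t Snd = j" and M = val_le
      and Q = "relaxed p q \<mu> r i j"])
    fix k u assume k: "k < N" and u: "?I u \<and> iv u Fst = i \<and> iv u Snd = j"
    let ?u = "set_iv Thd k u"
    have I: "?I ?u" using dp_inv_loop_var u by simp
    then have *: "ctx ?u" "traced p q \<mu> ?u" "same s0 ?u" "complete p q \<mu> r ?u"
      using same_ctx c by (auto simp: dp_inv_def)
    have st: "iv ?u Cand1 = p" "iv ?u Cand2 = q" "rv ?u Slack = \<mu>" "iv ?u Fst = i" "iv ?u Snd =
      j" "iv ?u Thd = k"
      using *(3) g u by (simp_all add: same_def iv_set_iv)
    note R = relax_correct[OF *(1,2) st that(2,3) k]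
    have "relaxed p q \<mu> r i j k (sem N relax ?u)"
      unfolding relaxed_def
    proof (intro allI impI)
      fix X assume X: "path p q \<mu> r j k X" "admissible p q \<mu> i j k"
      have "sum W X \<le> val ?u j k" using *(4) X(1) that(3) k by (simp add: complete_def)
      \<comment> \<open>Path weights are nonnegative, so a dominated entry cannot be the marker for
        an unknown chain and the edge is not skipped.\<close>
      moreover then have "0 \<le> val ?u j k" using sum_path_nonneg[OF X(1)] by simp
      ultimately show "sum W X + W k \<le> val (sem N relax ?u) i j" using R(7)[OF X(2)] by simp
    qed
    moreover have "?I (sem N relax ?u)"
      using same_trans[OF *(3) R(1)] R(5) complete_mono[OF *(4) R(6)] by (simp add: dp_inv_def)
    ultimately show "(?I (sem N relax ?u) \<and> iv (sem N relax ?u) Fst = i \<and> iv (sem N relax ?u) Snd = j) \<and>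
      val_le u (sem N relax ?u) \<and> relaxed p q \<mu> r i j k (sem N relax ?u)"
      using R(3,4,6) by (simp add: val_le_loop_var)
  qed (use that(1) in blast, rule val_le_refl, erule (1) val_le_trans,
      rule relaxed_mono[OF _ _ that(2,3)], assumption+)
  have second: "(?I t' \<and> iv t' Fst = i) \<and> val_le t t' \<and> (\<forall>j<N. \<forall>k<N. relaxed p q \<mu> r i j k t')"
    if "?I t \<and> iv t Fst = i" "i < N" "t' = sem N (For Snd (For Thd relax)) t" for i t t'
  proof -
    \<comment> \<open>\<open>j < N\<close> is made part of \<open>Q\<close> because stability under
      \<open>val_le\<close> holds for indices in range only; \<open>loop_all\<close> states it for
      all.\<close>
    have "(?I t' \<and> iv t' Fst = i) \<and> val_le t t' \<and> (\<forall>j<N. j < N \<and> (\<forall>k<N. relaxed p q \<mu> r i j k t'))"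
      unfolding that(3) sem.simps(8)[of _ Snd]
    proof (rule loop_all[where I = "\<lambda>t. ?I t \<and> iv t Fst = i" and M = val_le
      and Q = "\<lambda>j t. j < N \<and> (\<forall>k<N. relaxed p q \<mu> r i j k t)"])
      fix j u assume j: "j < N" and u: "?I u \<and> iv u Fst = i"
      then have "?I (set_iv Snd j u) \<and> iv (set_iv Snd j u) Fst = i \<and> iv (set_iv Snd j u) Snd = j"
        using dp_inv_loop_var by (simp add: iv_set_iv)
      from third[OF this that(2) j refl] j
      show "(?I (sem N (For Thd relax) (set_iv Snd j u)) \<and>
        iv (sem N (For Thd relax) (set_iv Snd j u)) Fst = i) \<and>
        val_le u (sem N (For Thd relax) (set_iv Snd j u)) \<and>
        (j < N \<and> (\<forall>k<N. relaxed p q \<mu> r i j k (sem N (For Thd relax) (set_iv Snd j u))))"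
        by (simp add: val_le_loop_var)
    qed (use that(1) in blast, rule val_le_refl, erule (1) val_le_trans,
        use relaxed_mono that(2) in blast)
    then show ?thesis by blast
  qed
  have "?I (sem N relax_all s) \<and> val_le s (sem N relax_all s) \<and>
    (\<forall>i<N. i < N \<and> (\<forall>j<N. \<forall>k<N. relaxed p q \<mu> r i j k (sem N relax_all s)))"
    unfolding relax_all_def sem.simps(8)[of _ Fst]
  proof (rule loop_all[where I = ?I and M = val_le
      and Q = "\<lambda>i t. i < N \<and> (\<forall>j<N. \<forall>k<N. relaxed p q \<mu> r i j k t)"])
    fix i u assume i: "i < N" and u: "?I u"
    then have "?I (set_iv Fst i u) \<and> iv (set_iv Fst i u) Fst = i"
      using dp_inv_loop_var by (simp add: iv_set_iv)
    from second[OF this i refl] i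
    show "?I (sem N (For Snd (For Thd relax)) (set_iv Fst i u)) \<and>
      val_le u (sem N (For Snd (For Thd relax)) (set_iv Fst i u)) \<and>
      (i < N \<and> (\<forall>j<N. \<forall>k<N. relaxed p q \<mu> r i j k (sem N (For Snd (For Thd relax)) (set_iv Fst i u))))"
      by (simp add: val_le_loop_var)
  qed (rule s, rule val_le_refl, erule (1) val_le_trans, use relaxed_mono in blast)
  then have I: "?I (sem N relax_all s)"
    and rel: "\<And>i j k. i < N \<Longrightarrow> j < N \<Longrightarrow> k < N \<Longrightarrow> relaxed p q \<mu> r i j k (sem N relax_all s)" by blast+
  have "complete p q \<mu> (Suc r) (sem N relax_all s)"
    unfolding complete_def
  proof (intro allI impI)
    fix i j X assume ij: "i < N" "j < N" and X: "path p q \<mu> (Suc r) i j X"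
    from X show "sum W X \<le> val (sem N relax_all s) i j"
    proof (cases rule: path.cases)
      case top
      then have "path p q \<mu> r i j X" using path.top by simp
      then show ?thesis using I ij unfolding dp_inv_def complete_def by blast
    next
      case (step k Y)
      have kn: "k \<noteq> n" using step(3) not_prec_bot ij(2) by (auto simp: admissible_def)
      have "sum W X = sum W Y + W k"
        using sum_path_step[OF step(2) step(5) kn, of W] W_sentinel step(1) by simp
      then show ?thesis using rel[OF ij step(5)] step(2,3) by (simp add: relaxed_def)
    qed
  qed
  then show ?thesis using I by (simp add: dp_inv_def)
qed

definition fresh :: "env \<Rightarrow> nat \<Rightarrow> nat \<Rightarrow> bool" where
  "fresh s i j \<longleftrightarrow> val s i j = (if j = n + 1 then 0 else -1) \<and> sel s i j = 0"

lemma reset_correct: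
  assumes "ctx s0"
  shows "same s0 (sem N reset s0)" "\<And>i j. i < N \<Longrightarrow> j < N \<Longrightarrow> fresh (sem N reset s0) i j"
proof -
  define body where "body =
     Cond (INeq (IV Snd) (IPlus (IV Jobs) (IC 1)))
        (RPut Val (cell Fst Snd) (RC (-1))) (RPut Val (cell Fst Snd) (RC 0)) ;;
      IPut Sel (cell Fst Snd) (IC 0)"
  define M where "M s t \<longleftrightarrow> (\<forall>i<N. \<forall>j<N. fresh s i j \<longrightarrow> fresh t i j)" for s t
  have M: "\<And>s. M s s" "\<And>s t u. M s t \<Longrightarrow> M t u \<Longrightarrow> M s u" by (auto simp: M_def)
  have fresh_var: "fresh (set_iv x v s) = fresh s" for x v s
    by (simp add: fresh_def fun_eq_iff val_loop_var)
  have cellwise: "(same s0 t' \<and> iv t' Fst = i) \<and> M t t' \<and> fresh t' i j"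
    if "same s0 t" "iv t Fst = i" "iv t Snd = j" "i < N" "j < N" "t' = sem N body t" for i j t t'
  proof -
    have c: "ctx t" using same_ctx[OF that(1) assms] .
    then have r: "ia t Row i = i * N" "iv t Jobs = n" using that(4) by (auto simp: ctx_def)
    have t': "t' = t\<lparr>ia := (ia t)(Sel := (ia t Sel)(i * N + j := 0)),
      ra := (ra t)(Val := (ra t Val)(i * N + j := (if j = n + 1 then 0 else -1)))\<rparr>"
      unfolding that(6) body_def using that(2,3) r by auto
    have v: "val t' i' j' = (if i' = i \<and> j' = j then if j = n + 1 then 0 else -1 else val t i' j')"
      "sel t' i' j' = (if i' = i \<and> j' = j then 0 else sel t i' j')" if "j' < N" for i' j'
      using cell_inject[OF that \<open>j < N\<close>, of i' i] by (auto simp: val_def sel_def t')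
    have "same t t'" by (auto simp: same_def t')
    then have "same s0 t'" using same_trans that(1) by blast
    moreover have "iv t' Fst = i" using that(2) t' by simp
    moreover have "M t t'" unfolding M_def fresh_def using v by auto
    moreover have "fresh t' i j" unfolding fresh_def using v[OF that(5), of i] by auto
    ultimately show ?thesis by blast
  qed
  have row: "same s0 t' \<and> M t t' \<and> (\<forall>j<N. fresh t' i j)"
    if "same s0 t" "iv t Fst = i" "i < N" "t' = sem N (For Snd body) t" for i t t'
  proof -
    have "(same s0 t' \<and> iv t' Fst = i) \<and> M t t' \<and> (\<forall>j<N. j < N \<and> fresh t' i j)"
      unfolding that(4) sem.simps(8)
    proof (rule loop_all[where I = "\<lambda>t. same s0 t \<and> iv t Fst = i" and M = M and Q = "\<lambda>j t. j < N \<and>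
      fresh t i j"])
      fix j u assume j: "j < N" and u: "same s0 u \<and> iv u Fst = i"
      have "same s0 (set_iv Snd j u)" using u same_trans same_loop_var by blast
      from cellwise[OF this, of i j] u j that(3)
      show "(same s0 (sem N body (set_iv Snd j u)) \<and> iv (sem N body (set_iv Snd j u)) Fst = i) \<and>
        M u (sem N body (set_iv Snd j u)) \<and> j < N \<and> fresh (sem N body (set_iv Snd j u)) i j"
        by (simp add: iv_set_iv M_def fresh_var)
    qed (use that M in \<open>auto simp: M_def\<close>)
    then show ?thesis by blast
  qed
  have "same s0 (sem N reset s0) \<and> M s0 (sem N reset s0) \<and> (\<forall>i<N. i < N \<and>
    (\<forall>j<N. fresh (sem N reset s0) i j))"
    unfolding reset_def body_def[symmetric] sem.simps(8)[of _ Fst]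
  proof (rule loop_all[where I = "same s0" and M = M and Q = "\<lambda>i t. i < N \<and> (\<forall>j<N. fresh t i j)"])
    fix i u assume i: "i < N" and u: "same s0 u"
    have "same s0 (set_iv Fst i u)" using u same_trans same_loop_var by blast
    from row[OF this, of i] i
    show "same s0 (sem N (For Snd body) (set_iv Fst i u)) \<and>
        M u (sem N (For Snd body) (set_iv Fst i u)) \<and> i < N \<and>
          (\<forall>j<N. fresh (sem N (For Snd body) (set_iv Fst i u)) i j)"
      by (simp add: iv_set_iv M_def fresh_var)
  qed (use same_refl M in \<open>auto simp: M_def\<close>)
  then show "same s0 (sem N reset s0)" "\<And>i j. i < N \<Longrightarrow> j < N \<Longrightarrow> fresh (sem N reset s0) i j" by blast+
qed

lemma reset_dp_inv:
  assumes "ctx s"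
  shows "dp_inv s p q \<mu> 0 (sem N reset s)"
proof -
  let ?t = "sem N reset s"
  have fr: "val ?t i j = (if j = n + 1 then 0 else -1)" "sel ?t i j = 0" if "i < N" "j < N" for i j
    using reset_correct(2)[OF assms that] by (auto simp: fresh_def)
  have "traced p q \<mu> ?t"
    unfolding traced_def
  proof (intro allI impI)
    fix i j assume ij: "i < N" "j < N" "0 \<le> val ?t i j"
    then have "j = n + 1" using fr[OF ij(1,2)] by (auto split: if_splits)
    then show "\<exists>r X. path p q \<mu> r i j X \<and> val ?t i j = sum W X \<and> sel ?t i j = sum Pw X"
      using fr[OF ij(1,2)] path.top[of p q \<mu> 0 i] by (intro exI[of _ 0] exI[of _ "{}"]) simp
  qed
  moreover have "complete p q \<mu> 0 ?t"
    unfolding complete_def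
  proof (intro allI impI)
    fix i j X assume ij: "i < N" "j < N" and X: "path p q \<mu> 0 i j X"
    from X have "j = n + 1 \<and> X = {}" by cases auto
    then show "sum W X \<le> val ?t i j" using fr[OF ij] by simp
  qed
  ultimately show ?thesis using reset_correct(1)[OF assms] by (simp add: dp_inv_def)
qed

section \<open>Search over all guesses\<close>

definition best_inv :: "env \<Rightarrow> bool" where
  "best_inv s \<longleftrightarrow> ctx s \<and> (\<exists>X. feasible n A B X \<and> iv s BestSet = sum Pw X \<and>
     rv s BestVal \<le> robust_val n A B W X)"

definition explored :: "nat \<Rightarrow> nat \<Rightarrow> nat \<Rightarrow> nat \<Rightarrow> env \<Rightarrow> bool" where
  "explored p q x y s \<longleftrightarrow> p \<noteq> q \<longrightarrow> W x - W y \<le> W p \<longrightarrow> W x - W y \<le> W q \<longrightarrow>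
     (\<forall>X. path p q (W x - W y) N n n X \<longrightarrow> sum W X + (W x - W y) \<le> rv s BestVal)"

definition val_grows :: "env \<Rightarrow> env \<Rightarrow> bool" where
  "val_grows s t \<longleftrightarrow> rv s BestVal \<le> rv t BestVal"

lemma explored_mono: "explored p q x y s \<Longrightarrow> val_grows s t \<Longrightarrow> explored p q x y t"
  unfolding explored_def val_grows_def by (meson order_trans)

lemma improve_correct:
  assumes b: "best_inv s" and st: "iv s Cand1 = p" "iv s Cand2 = q" "rv s Slack = \<mu>"
    and pq: "p \<noteq> q" "p < N" "q < N" and \<mu>: "\<mu> \<le> W p" "\<mu> \<le> W q"
  defines "t \<equiv> sem N improve s"
  shows "best_inv t" "val_grows s t" "\<forall>x\<in>{Cand1, Cand2, Gain}. iv t x = iv s x"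
    "\<And>X. path p q \<mu> N n n X \<Longrightarrow> sum W X + \<mu> \<le> rv t BestVal"
proof -
  have c: "ctx s" using b by (simp add: best_inv_def)
  define u where "u = loop N Rnd (sem N relax_all) (sem N reset s)"
  have "dp_inv s p q \<mu> N u"
    unfolding u_def
  proof (rule loop_invariant[where P = "dp_inv s p q \<mu>"])
    show "dp_inv s p q \<mu> 0 (sem N reset s)" by (rule reset_dp_inv[OF c])
  next
    fix r v assume "dp_inv s p q \<mu> r v"
    then have "dp_inv s p q \<mu> r (set_iv Rnd r v)" by (rule dp_inv_loop_var[rotated]) simp
    from relax_all_correct[OF c st this]
    show "dp_inv s p q \<mu> (Suc r) (sem N relax_all (set_iv Rnd r v))" .
  qed
  then have u: "same s u" "traced p q \<mu> u" "complete p q \<mu> N u" by (auto simp: dp_inv_def)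
  have cu: "ctx u" by (rule same_ctx[OF u(1) c])
  then have row: "ia u Row n = n * N" "iv u Jobs = n" by (auto simp: ctx_def)
  have eq: "rv u = rv s" "\<And>x. x \<in> {Cand1, Cand2, Gain, BestSet} \<Longrightarrow> iv u x = iv s x"
    using u(1) by (auto simp: same_def)
  have t: "t = (if val u n n + \<mu> \<le> rv s BestVal then u else
      set_iv BestSet (sel u n n) (u\<lparr>rv := (rv u)(BestVal := val u n n + \<mu>)\<rparr>))"
    unfolding t_def improve_def using row eq(1) st(3)
    by (simp add: u_def[symmetric] val_def sel_def set_iv_def)
  have comp: "sum W X \<le> val u n n" if "path p q \<mu> N n n X" for X
    using u(3) that by (simp add: complete_def)
  \<comment> \<open>The empty chain, going straight from bottom to top, is a path for every guess.
    So the cell for \<open>n\<close>, \<open>n\<close> is known, and \<open>traced\<close> yields a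
    real chain behind it.\<close>
  have "prec n (n + 1)" using before_top[of n] by (simp add: prec_def)
  then have "path p q \<mu> 1 n n {}"
    using path.step[OF path.top[of p q \<mu> 0 n], of n] by (simp add: admissible_def)
  then have "0 \<le> val u n n" using comp[of "{}"] path_mono[of p q \<mu> 1 n n "{}" N] by simp
  then obtain r X where X: "path p q \<mu> r n n X" "val u n n = sum W X" "sel u n n = sum Pw X"
    using u(2)[unfolded traced_def, rule_format, of n n] by auto
  note R = path_robust[OF X(1) pq \<mu>]
  have bu: "best_inv u" using b cu eq by (simp add: best_inv_def)
  show "best_inv t"
  proof (cases "val u n n + \<mu> \<le> rv s BestVal")
    case False
    then have "ctx t" "iv t BestSet = sum Pw X" "rv t BestVal \<le> robust_val n A B W X"
      using t cu X R(2) by (auto simp: ctx_def set_iv_def)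
    then show ?thesis using R(1) unfolding best_inv_def by blast
  qed (use t bu in simp)
  have bv: "rv t BestVal = max (rv s BestVal) (val u n n + \<mu>)"
    using t eq(1) by (simp add: set_iv_def)
  then show "val_grows s t" by (simp add: val_grows_def)
  show "\<forall>x\<in>{Cand1, Cand2, Gain}. iv t x = iv s x" using t eq by (simp add: set_iv_def)
  show "\<And>X. path p q \<mu> N n n X \<Longrightarrow> sum W X + \<mu> \<le> rv t BestVal"
    using bv comp by fastforce
qed

lemma try_guess_correct:
  assumes b: "best_inv s" and st: "iv s Cand1 = p" "iv s Cand2 = q" "iv s Gain = x" "iv s Loss = y"
    and pq: "p < N" "q < N"
  defines "t \<equiv> sem N try_guess s"
  shows "best_inv t" "val_grows s t" "iv t Cand1 = p" "iv t Cand2 = q" "iv t Gain =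
    x" "explored p q x y t"
proof -
  define \<mu> where "\<mu> = W x - W y"
  define u where "u = s\<lparr>rv := (rv s)(Slack := \<mu>)\<rparr>"
  have ctx: "ctx s" using b by (simp add: best_inv_def)
  have bu: "best_inv u" using b by (simp add: best_inv_def u_def ctx_def)
  have stu: "iv u Cand1 = p" "iv u Cand2 = q" "rv u Slack = \<mu>" "iv u Gain =
    x" using st by (simp_all add: u_def)
  have grow: "val_grows s v \<longleftrightarrow> val_grows u v" for v by (simp add: val_grows_def u_def)
  have "ra s Wt = W" using ctx by (simp add: ctx_def)
  then have t: "t = (if p \<noteq> q \<and> \<mu> \<le> W p \<and> \<mu> \<le> W q then sem N improve u else u)"
    unfolding t_def try_guess_def using st by (auto simp: u_def \<mu>_def)
  have "best_inv t \<and> val_grows s t \<and> iv t Cand1 = p \<and> iv t Cand2 = q \<and> iv t Gain = x \<and>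
    explored p q x y t"
  proof (cases "p \<noteq> q \<and> \<mu> \<le> W p \<and> \<mu> \<le> W q")
    case True
    then have t': "t = sem N improve u" using t by simp
    note I = improve_correct[OF bu stu(1,2,3) _ pq, folded t']
    show ?thesis using I True stu grow by (auto simp: explored_def \<mu>_def[symmetric])
  next
    case False
    then show ?thesis using t bu stu grow by (auto simp: explored_def \<mu>_def val_grows_def)
  qed
  then show "best_inv t" "val_grows s t" "iv t Cand1 = p" "iv t Cand2 = q" "iv t Gain =
    x" "explored p q x y t"
    by blast+
qed

lemma best_inv_loop_var:
  "x \<noteq> Jobs \<Longrightarrow> x \<noteq> BestSet \<Longrightarrow> best_inv (set_iv x v s) = best_inv s"
  by (auto simp: best_inv_def ctx_loop_var) (auto simp: set_iv_def)

lemma val_grows_loop_var: "val_grows (set_iv x v s) t = val_grows s t"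
  by (simp add: val_grows_def set_iv_def)

lemma robust_val_empty_nonneg: "0 \<le> robust_val n A B W {}"
proof -
  obtain f where f: "robust_val n A B W {} = repair_val n A B W {} f" by (rule robust_val_attained)
  have "feasible n A B {}" by (simp add: feasible_def)
  from repair_val_ge[OF None_repairs[OF this, of f], of W]
  have "wt W (del {} f) \<le> repair_val n A B W {} f" by simp
  moreover have "del {} f = {}" by (cases f) auto
  ultimately show ?thesis using f by (simp add: wt_def)
qed

text \<open>A sandwich: throughout, \<open>BestVal\<close> is at most the robust value of the stored
  set; in the end, by \<open>robust_path\<close> and the exploration of all guesses, it is at least
  the robust value of every feasible set.\<close>

lemma search_correct:
  assumes c: "ctx s"
  shows "ctx (sem N search s)"
    and "\<exists>X. robust_optimal n A B W X \<and> iv (sem N search s) BestSet = sum Pw X"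
proof -
  have G: "\<And>s. val_grows s s" "\<And>s t u. val_grows s t \<Longrightarrow> val_grows t u \<Longrightarrow> val_grows s u"
    by (auto simp: val_grows_def)
  define c1 where "c1 = For Loss try_guess"
  define c2 where "c2 = For Gain c1"
  define c3 where "c3 = For Cand2 c2"
  have 1: "(best_inv t' \<and> iv t' Cand1 = p \<and> iv t' Cand2 = q \<and> iv t' Gain = x) \<and> val_grows t t' \<and>
      (\<forall>y<N. explored p q x y t')"
    if "best_inv t" "iv t Cand1 = p" "iv t Cand2 = q" "iv t Gain = x" "p < N" "q < N" "t' =
      sem N c1 t" for p q x t t'
    unfolding that(7) c1_def sem.simps
  proof (rule loop_all[where I = "\<lambda>t. best_inv t \<and> iv t Cand1 = p \<and> iv t Cand2 = q \<and> iv t Gain = x"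
        and M = val_grows and Q = "explored p q x"])
    fix y u assume "y < N" and u: "best_inv u \<and> iv u Cand1 = p \<and> iv u Cand2 = q \<and> iv u Gain = x"
    have b: "best_inv (set_iv Loss y u)" using u by (simp add: best_inv_loop_var)
    have st: "iv (set_iv Loss y u) Cand1 = p" "iv (set_iv Loss y u) Cand2 = q"
      "iv (set_iv Loss y u) Gain = x" "iv (set_iv Loss y u) Loss =
        y" using u by (simp_all add: iv_set_iv)
    show "(best_inv (sem N try_guess (set_iv Loss y u)) \<and>
      iv (sem N try_guess (set_iv Loss y u)) Cand1 = p \<and>
      iv (sem N try_guess (set_iv Loss y u)) Cand2 = q \<and>
        iv (sem N try_guess (set_iv Loss y u)) Gain = x) \<and>
      val_grows u (sem N try_guess (set_iv Loss y u)) \<and>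
        explored p q x y (sem N try_guess (set_iv Loss y u))"
      using try_guess_correct[OF b st that(5,6)] by (simp add: val_grows_loop_var)
  qed (use that in blast, rule G(1), erule (1) G(2), erule (1) explored_mono)
  have 2: "(best_inv t' \<and> iv t' Cand1 = p \<and> iv t' Cand2 = q) \<and> val_grows t t' \<and>
      (\<forall>x<N. \<forall>y<N. explored p q x y t')"
    if "best_inv t" "iv t Cand1 = p" "iv t Cand2 = q" "p < N" "q < N" "t' = sem N c2 t" for p q t t'
    unfolding that(6) c2_def sem.simps
  proof (rule loop_all[where I = "\<lambda>t. best_inv t \<and> iv t Cand1 = p \<and> iv t Cand2 = q"
        and M = val_grows and Q = "\<lambda>x t. \<forall>y<N. explored p q x y t"])
    fix x u assume "x < N" and u: "best_inv u \<and> iv u Cand1 = p \<and> iv u Cand2 = q"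
    have b: "best_inv (set_iv Gain x u)" using u by (simp add: best_inv_loop_var)
    have st: "iv (set_iv Gain x u) Cand1 = p" "iv (set_iv Gain x u) Cand2 = q"
      "iv (set_iv Gain x u) Gain = x" using u by (simp_all add: iv_set_iv)
    show "(best_inv (sem N c1 (set_iv Gain x u)) \<and> iv (sem N c1 (set_iv Gain x u)) Cand1 = p \<and>
      iv (sem N c1 (set_iv Gain x u)) Cand2 = q) \<and>
      val_grows u (sem N c1 (set_iv Gain x u)) \<and> (\<forall>y<N. explored p q x y (sem N c1 (set_iv Gain x u)))"
      using 1[OF b st that(4,5) refl] by (simp add: val_grows_loop_var)
  qed (use that in blast, rule G(1), erule (1) G(2), use explored_mono in blast)
  have 3: "(best_inv t' \<and> iv t' Cand1 = p) \<and> val_grows t t' \<and>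
      (\<forall>q<N. \<forall>x<N. \<forall>y<N. explored p q x y t')"
    if "best_inv t" "iv t Cand1 = p" "p < N" "t' = sem N c3 t" for p t t'
    unfolding that(4) c3_def sem.simps
  proof (rule loop_all[where I = "\<lambda>t. best_inv t \<and> iv t Cand1 = p"
        and M = val_grows and Q = "\<lambda>q t. \<forall>x<N. \<forall>y<N. explored p q x y t"])
    fix q u assume q: "q < N" and u: "best_inv u \<and> iv u Cand1 = p"
    have b: "best_inv (set_iv Cand2 q u)" using u by (simp add: best_inv_loop_var)
    have st: "iv (set_iv Cand2 q u) Cand1 = p" "iv (set_iv Cand2 q u) Cand2 = q"
      using u by (simp_all add: iv_set_iv)
    show "(best_inv (sem N c2 (set_iv Cand2 q u)) \<and> iv (sem N c2 (set_iv Cand2 q u)) Cand1 = p) \<and>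
      val_grows u (sem N c2 (set_iv Cand2 q u)) \<and>
      (\<forall>x<N. \<forall>y<N. explored p q x y (sem N c2 (set_iv Cand2 q u)))"
      using 2[OF b st that(3) q refl] by (simp add: val_grows_loop_var)
  qed (use that in blast, rule G(1), erule (1) G(2), use explored_mono in blast)
  define s1 where "s1 = set_iv BestSet 0 (s\<lparr>rv := (rv s)(BestVal := 0)\<rparr>)"
  have "feasible n A B {}" by (simp add: feasible_def)
  moreover have "ctx s1" using c by (simp add: ctx_def s1_def set_iv_def)
  ultimately have b1: "best_inv s1"
    unfolding best_inv_def using robust_val_empty_nonneg
    by (intro conjI exI[of _ "{}"]) (simp_all add: s1_def set_iv_def)
  define t where "t = sem N search s"
  have t: "t = loop N Cand1 (sem N c3) s1"
    unfolding t_def search_def c1_def c2_def c3_def s1_def by simp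
  have "best_inv t \<and> val_grows s1 t \<and> (\<forall>p<N. \<forall>q<N. \<forall>x<N. \<forall>y<N. explored p q x y t)"
    unfolding t
  proof (rule loop_all[where I = best_inv and M = val_grows
        and Q = "\<lambda>p t. \<forall>q<N. \<forall>x<N. \<forall>y<N. explored p q x y t"])
    fix p u assume p: "p < N" and u: "best_inv u"
    have b: "best_inv (set_iv Cand1 p u)" "iv (set_iv Cand1 p u) Cand1 = p"
      using u by (simp_all add: best_inv_loop_var iv_set_iv)
    show "best_inv (sem N c3 (set_iv Cand1 p u)) \<and> val_grows u (sem N c3 (set_iv Cand1 p u)) \<and>
      (\<forall>q<N. \<forall>x<N. \<forall>y<N. explored p q x y (sem N c3 (set_iv Cand1 p u)))"
      using 3[OF b p refl] by (simp add: val_grows_loop_var)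
  qed (rule b1, rule G(1), erule (1) G(2), use explored_mono in blast)
  then have best: "best_inv t" and ex: "\<And>p q x y. p < N \<Longrightarrow> q < N \<Longrightarrow> x < N \<Longrightarrow> y < N \<Longrightarrow> explored p q x y t"
    by blast+
  show "ctx (sem N search s)" using best by (simp add: best_inv_def t_def)
  from best obtain X where X: "feasible n A B X" "iv t BestSet = sum Pw X"
    "rv t BestVal \<le> robust_val n A B W X" by (auto simp: best_inv_def)
  have "robust_val n A B W T \<le> rv t BestVal" if T: "feasible n A B T" for T
  proof -
    obtain p q x y where "p < N" "q < N" "x < N" "y < N" "p \<noteq> q" "W x - W y \<le> W p" "W x - W y \<le> W q"
      "path p q (W x - W y) N n n T" "robust_val n A B W T = sum W T + (W x - W y)"
      using robust_path[OF T] by blast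
    then show ?thesis using ex[of p q x y] by (simp add: explored_def)
  qed
  then have "robust_optimal n A B W X" using X(1,3) unfolding robust_optimal_def by force
  then show "\<exists>X. robust_optimal n A B W X \<and> iv (sem N search s) BestSet = sum Pw X"
    using X(2) t_def by blast
qed

text \<open>If \<open>l\<close> is not in \<open>X\<close>, the members of \<open>X\<close> above
  \<open>l\<close> together weigh less than \<open>Pw l\<close>, so the greedy test fails; if
  \<open>l\<close> is in \<open>X\<close>, its own code makes the test succeed.\<close>

lemma decode_correct:
  assumes c: "ctx s" and X: "X \<subseteq> {..<n}" "iv s BestSet = sum Pw X"
    and super: "\<And>l. l < n \<Longrightarrow> sum Pw {l<..<n} < Pw l"
  shows "\<forall>l<n. ra (sem N decode s) Out l = (if l \<in> X then 1 else 0)" "iv (sem N decode s) Jobs = n"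
proof -
  define body where "body = Cond (Conj (ILt (IV Snd) (IV Jobs))
         (ILe (IPlus (IV Acc) (IA Pow (IV Snd))) (IV BestSet)))
       (ISet Acc (IPlus (IV Acc) (IA Pow (IV Snd))) ;; RPut Out (IV Snd) (RC 1))
       (RPut Out (IV Snd) (RC 0))"
  define P where "P l t \<longleftrightarrow> iv t Jobs = n \<and> iv t BestSet = sum Pw X \<and> ia t Pow = Pw \<and>
    iv t Acc = sum Pw (X \<inter> {..<l}) \<and> (\<forall>i<l. ra t Out i = (if i \<in> X then 1 else 0))" for l and t :: env
  have fin: "finite X" using X(1) finite_subset by blast
  have "P N (loop N Snd (sem N body) (set_iv Acc 0 s))"
  proof (rule loop_invariant[where P = P])
    show "P 0 (set_iv Acc 0 s)" using c X(2) by (simp add: P_def ctx_def set_iv_def)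
  next
    fix l t assume "P l t"
    then have t: "iv t Jobs = n" "iv t BestSet = sum Pw X" "ia t Pow = Pw"
      "iv t Acc = sum Pw (X \<inter> {..<l})" "\<forall>i<l. ra t Out i =
        (if i \<in> X then 1 else 0)" by (auto simp: P_def)
    let ?t = "sem N body (set_iv Snd l t)"
    have split: "sum Pw X = sum Pw (X \<inter> {..<l}) + sum Pw (X - {..<l})"
      using sum.Int_Diff[OF fin, of Pw "{..<l}"] .
    have test: "l < n \<and> sum Pw (X \<inter> {..<l}) + Pw l \<le> sum Pw X \<longleftrightarrow> l \<in> X"
    proof
      assume "l \<in> X"
      then have "Pw l \<le> sum Pw (X - {..<l})" using fin by (intro member_le_sum) auto
      then show "l < n \<and> sum Pw (X \<inter> {..<l}) + Pw l \<le> sum Pw X" using split \<open>l \<in> X\<close> X(1) by auto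
    next
      assume h: "l < n \<and> sum Pw (X \<inter> {..<l}) + Pw l \<le> sum Pw X"
      show "l \<in> X"
      proof (rule ccontr)
        assume "l \<notin> X"
        then have "X - {..<l} \<subseteq> {l<..<n}" using X(1) by (auto simp: le_less)
        then have "sum Pw (X - {..<l}) \<le> sum Pw {l<..<n}" by (intro sum_mono2) auto
        then show False using super[of l] h split by simp
      qed
    qed
    have "X \<inter> {..<Suc l} = (if l \<in> X then insert l (X \<inter> {..<l}) else X \<inter> {..<l})"
      by (auto simp: less_Suc_eq)
    then have next_sum: "sum Pw (X \<inter> {..<Suc l}) =
      (if l \<in> X then sum Pw (X \<inter> {..<l}) + Pw l else sum Pw (X \<inter> {..<l}))"
      using fin by simp
    have "?t = (if l \<in> X then
        (set_iv Acc (iv t Acc + Pw l) (set_iv Snd l t))\<lparr>ra := (ra t)(Out := (ra t Out)(l := 1))\<rparr>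
      else (set_iv Snd l t)\<lparr>ra := (ra t)(Out := (ra t Out)(l := 0))\<rparr>)"
      using test t by (auto simp: body_def set_iv_def)
    then show "P (Suc l) ?t" using t next_sum by (auto simp: P_def set_iv_def less_Suc_eq)
  qed
  then have "P N (sem N decode s)" by (simp add: decode_def body_def)
  then show "\<forall>l<n. ra (sem N decode s) Out l = (if l \<in> X then 1 else 0)" "iv (sem N decode s) Jobs = n"
    by (auto simp: P_def)
qed

end

section \<open>Normalising the instance\<close>

text \<open>The sum of all right ends lies beyond every interval and needs no comparisons; the
  initial 1 accounts for the later shift by one.\<close>

definition sum_ends :: com where
  "sum_ends = ISet Acc (IC 1) ;;
     For Snd (Cond (ILt (IV Snd) (IV Jobs)) (ISet Acc (IPlus (IV Acc) (IA End (IV Snd)))) Skip)"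

text \<open>Empty intervals conflict with nothing; they are replaced by unit intervals to the right of
  all others.  All coordinates move up by one to make room for the sentinel at 0.\<close>

definition move_jobs :: com where
  "move_jobs = For Snd (Cond (ILt (IV Snd) (IV Jobs))
     (Cond (ILe (IA End (IV Snd)) (IA Beg (IV Snd)))
       (IPut Beg (IV Snd) (IPlus (IV Acc) (IV Snd)) ;;
        IPut End (IV Snd) (IPlus (IPlus (IV Acc) (IV Snd)) (IC 1)))
       (IPut Beg (IV Snd) (IPlus (IA Beg (IV Snd)) (IC 1)) ;;
        IPut End (IV Snd) (IPlus (IA End (IV Snd)) (IC 1))))
     Skip)"

text \<open>The bottom sentinel takes the unit interval at 0 vacated by the shift. The top one must
  follow the substitutes of empty jobs, which start at \<open>Acc + j\<close> for
  \<open>j < n\<close>.\<close>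

definition add_sentinels :: com where
  "add_sentinels =
     IPut Beg (IV Jobs) (IC 0) ;; IPut End (IV Jobs) (IC 1) ;;
     IPut Beg (IPlus (IV Jobs) (IC 1)) (IPlus (IV Acc) (IV Jobs)) ;;
     IPut End (IPlus (IV Jobs) (IC 1)) (IPlus (IPlus (IV Acc) (IV Jobs)) (IC 1)) ;;
     RPut Wt (IV Jobs) (RC 0) ;; RPut Wt (IPlus (IV Jobs) (IC 1)) (RC 0)"

definition fill_rows :: com where
  "fill_rows = ISet Acc (IC 0) ;;
     For Snd (IPut Row (IV Snd) (IV Acc) ;; ISet Acc (IPlus (IV Acc) Bound))"

text \<open>Over a full run of \<open>Thd\<close> this doubles once for each index strictly between
  \<open>Snd\<close> and \<open>n\<close>, which is \<open>n - 1 - Snd\<close> times.\<close>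

definition double_up :: com where
  "double_up = Cond (Conj (ILt (IV Snd) (IV Thd)) (ILt (IV Thd) (IV Jobs)))
     (ISet Acc (IPlus (IV Acc) (IV Acc))) Skip"

definition fill_powers :: com where
  "fill_powers = For Snd (ISet Acc (IC 1) ;; For Thd double_up ;; IPut Pow (IV Snd) (IV Acc)) ;;
     IPut Pow (IPlus (IV Jobs) (IC 1)) (IC 0)"

definition prepare :: com where
  "prepare = sum_ends ;; move_jobs ;; add_sentinels ;; fill_rows ;; fill_powers"

section \<open>Correctness of the normalisation\<close>

lemma sum_ends_correct:
  assumes "iv s Jobs = n" "n \<le> N"
  shows "\<exists>v. sem N sum_ends s = s\<lparr>iv := (iv s)(Snd := v, Acc := 1 + (\<Sum>j<n. ia s End j))\<rparr>"
proof -
  define body where "body = Cond (ILt (IV Snd) (IV Jobs)) (ISet Acc (IPlus (IV Acc) (IA End (IV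
    Snd)))) Skip"
  let ?P = "\<lambda>l t. \<exists>v. t = s\<lparr>iv := (iv s)(Snd := v, Acc := 1 + (\<Sum>j<min l n. ia s End j))\<rparr>"
  have "?P N (loop N Snd (sem N body) (set_iv Acc 1 s))"
  proof (rule loop_invariant[where P = ?P])
    show "?P 0 (set_iv Acc 1 s)"
      by (rule exI[of _ "iv s Snd"]) (simp add: set_iv_def fun_upd_idem fun_upd_twist)
  next
    fix l t assume "?P l t"
    then obtain v where t: "t = s\<lparr>iv := (iv s)(Snd := v, Acc := 1 + (\<Sum>j<min l n. ia s End j))\<rparr>" ..
    have "sem N body (set_iv Snd l t) =
      s\<lparr>iv := (iv s)(Snd := l, Acc := 1 + (\<Sum>j<min (Suc l) n. ia s End j))\<rparr>"
      using assms(1) by (cases "l < n") (auto simp: body_def t set_iv_def min_def fun_eq_iff)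
    then show "?P (Suc l) (sem N body (set_iv Snd l t))" by blast
  qed
  then show ?thesis using assms(2) by (simp add: sum_ends_def body_def min_absorb2)
qed

lemma move_jobs_correct:
  assumes "iv s Jobs = n" "n \<le> N"
  defines "t \<equiv> sem N move_jobs s"
  shows "\<forall>x. x \<noteq> Snd \<longrightarrow> iv t x = iv s x" "ra t = ra s"
    "\<forall>j<n. ia t Beg j = (if ia s End j \<le> ia s Beg j then iv s Acc + j else ia s Beg j + 1)"
    "\<forall>j<n. ia t End j = (if ia s End j \<le> ia s Beg j then iv s Acc + j + 1 else ia s End j + 1)"
proof -
  define body where "body = Cond (ILt (IV Snd) (IV Jobs))
     (Cond (ILe (IA End (IV Snd)) (IA Beg (IV Snd)))
       (IPut Beg (IV Snd) (IPlus (IV Acc) (IV Snd)) ;;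
        IPut End (IV Snd) (IPlus (IPlus (IV Acc) (IV Snd)) (IC 1)))
       (IPut Beg (IV Snd) (IPlus (IA Beg (IV Snd)) (IC 1)) ;;
        IPut End (IV Snd) (IPlus (IA End (IV Snd)) (IC 1))))
     Skip"
  define newA newB where
    "newA j = (if ia s End j \<le> ia s Beg j then iv s Acc + j else ia s Beg j + 1)" and
    "newB j = (if ia s End j \<le> ia s Beg j then iv s Acc + j + 1 else ia s End j + 1)" for j
  let ?P = "\<lambda>l (t :: env). (\<forall>x. x \<noteq> Snd \<longrightarrow> iv t x = iv s x) \<and> ra t = ra s \<and>
    (\<forall>j<n. ia t Beg j = (if j < l then newA j else ia s Beg j) \<and>
      ia t End j = (if j < l then newB j else ia s End j))"
  have "?P N (loop N Snd (sem N body) s)"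
  proof (rule loop_invariant[where P = ?P])
    show "?P 0 s" by simp
  next
    fix l t assume t: "?P l t"
    let ?u = "set_iv Snd l t"
    have u: "iv ?u Snd = l" "iv ?u Jobs = n" "iv ?u Acc = iv s Acc" "ia ?u = ia t" "ra ?u = ra s"
      "\<forall>x. x \<noteq> Snd \<longrightarrow> iv ?u x = iv s x"
      using t assms(1) by (simp_all add: set_iv_def)
    show "?P (Suc l) (sem N body ?u)"
    proof (cases "l < n")
      case True
      then have l: "ia t Beg l = ia s Beg l" "ia t End l = ia s End l" using t by auto
      have "sem N body ?u = ?u\<lparr>ia := (ia t)(Beg := (ia t Beg)(l := newA l), End := (ia t End)(l :=
        newB l))\<rparr>"
        using True by (simp add: body_def u l newA_def newB_def fun_upd_twist)
      then show ?thesis using u t by (auto simp: less_Suc_eq)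
    next
      case False
      then have "sem N body ?u = ?u" by (simp add: body_def u)
      then show ?thesis using u t False by (auto simp: less_Suc_eq)
    qed
  qed
  then have "?P N t" by (simp add: t_def move_jobs_def body_def)
  then show "\<forall>x. x \<noteq> Snd \<longrightarrow> iv t x = iv s x" "ra t = ra s"
    "\<forall>j<n. ia t Beg j = (if ia s End j \<le> ia s Beg j then iv s Acc + j else ia s Beg j + 1)"
    "\<forall>j<n. ia t End j = (if ia s End j \<le> ia s Beg j then iv s Acc + j + 1 else ia s End j + 1)"
    using assms(2) by (auto simp: newA_def newB_def)
qed

lemma fill_rows_correct:
  fixes s :: env and N :: nat
  defines "t \<equiv> sem N fill_rows s"
  shows "iv t Jobs = iv s Jobs" "ra t = ra s" "\<forall>q. q \<noteq> Row \<longrightarrow> ia t q = ia s q"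
    "\<forall>i<N. ia t Row i = i * N"
proof -
  define body where "body = IPut Row (IV Snd) (IV Acc) ;; ISet Acc (IPlus (IV Acc) Bound)"
  let ?P = "\<lambda>l (t :: env). iv t Jobs = iv s Jobs \<and> ra t = ra s \<and> (\<forall>q. q \<noteq> Row \<longrightarrow> ia t q = ia s q) \<and>
    iv t Acc = l * N \<and> (\<forall>i<l. ia t Row i = i * N)"
  have "?P N (loop N Snd (sem N body) (set_iv Acc 0 s))"
    by (rule loop_invariant[where P = ?P]) (auto simp: body_def set_iv_def less_Suc_eq)
  then have "?P N t" by (simp add: t_def fill_rows_def body_def)
  then show "iv t Jobs = iv s Jobs" "ra t = ra s" "\<forall>q. q \<noteq> Row \<longrightarrow> ia t q = ia s q"
    "\<forall>i<N. ia t Row i = i * N" by auto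
qed

lemma fill_powers_correct:
  assumes "iv s Jobs = n" "n \<le> N"
  defines "t \<equiv> sem N fill_powers s"
  shows "iv t Jobs = n" "ra t = ra s" "\<forall>q. q \<noteq> Pow \<longrightarrow> ia t q = ia s q"
    "\<forall>l<n. ia t Pow l = 2 ^ (n - 1 - l)" "ia t Pow (n + 1) = 0"
proof -
  have dbl: "\<exists>v. sem N (For Thd double_up) u = u\<lparr>iv := (iv u)(Thd := v, Acc := 2 ^ (n - 1 - iv u Snd))\<rparr>"
    if "iv u Jobs = n" "iv u Acc = 1" for u
  proof -
    \<comment> \<open>Truncated subtraction makes the exponent 0 as long as \<open>Thd\<close> has
      not passed \<open>Snd\<close>, and \<open>min\<close> freezes it once \<open>Thd\<close>
      leaves the jobs.\<close>
    let ?P = "\<lambda>l t. \<exists>v. t = u\<lparr>iv := (iv u)(Thd := v, Acc := 2 ^ (min l n - 1 - iv u Snd))\<rparr>"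
    have "?P N (loop N Thd (sem N double_up) u)"
    proof (rule loop_invariant[where P = ?P])
      show "?P 0 u" using that(2) by (intro exI[of _ "iv u Thd"]) (simp add: fun_upd_idem)
    next
      fix l t assume "?P l t"
      then obtain v where t: "t = u\<lparr>iv := (iv u)(Thd := v, Acc := 2 ^ (min l n - 1 - iv u Snd))\<rparr>" ..
      have e: "(2::nat) ^ (min (Suc l) n - 1 - iv u Snd) =
        (if iv u Snd < l \<and> l < n then 2 ^ (min l n - 1 - iv u Snd) + 2 ^ (min l n - 1 - iv u Snd)
         else 2 ^ (min l n - 1 - iv u Snd))"
      proof (cases "iv u Snd < l \<and> l < n")
        case True
        then have "min (Suc l) n - 1 - iv u Snd = Suc (min l n - 1 - iv u Snd)" by auto
        then show ?thesis using True by simp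
      next
        case False
        then have "min (Suc l) n - 1 - iv u Snd = min l n - 1 - iv u Snd" by auto
        then show ?thesis using False by simp
      qed
      have "sem N double_up (set_iv Thd l t) =
        u\<lparr>iv := (iv u)(Thd := l, Acc := 2 ^ (min (Suc l) n - 1 - iv u Snd))\<rparr>"
        unfolding e using that(1) by (auto simp: double_up_def t set_iv_def fun_eq_iff)
      then show "?P (Suc l) (sem N double_up (set_iv Thd l t))" by blast
    qed
    then show ?thesis using assms(2) by (simp add: min_absorb2)
  qed
  define body where "body = ISet Acc (IC 1) ;; For Thd double_up ;; IPut Pow (IV Snd) (IV Acc)"
  let ?P = "\<lambda>l (t :: env). iv t Jobs = n \<and> ra t = ra s \<and> (\<forall>q. q \<noteq> Pow \<longrightarrow> ia t q = ia s q) \<and>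
    (\<forall>i<l. ia t Pow i = 2 ^ (n - 1 - i))"
  have P: "?P N (loop N Snd (sem N body) s)"
  proof (rule loop_invariant[where P = ?P])
    show "?P 0 s" using assms(1) by simp
  next
    fix l t assume t: "?P l t"
    let ?u = "set_iv Acc 1 (set_iv Snd l t)"
    have "iv ?u Jobs = n" "iv ?u Acc = 1" using t by (simp_all add: set_iv_def)
    from dbl[OF this] obtain v where
      "sem N (For Thd double_up) ?u = ?u\<lparr>iv := (iv ?u)(Thd := v, Acc := 2 ^ (n - 1 - iv ?u Snd))\<rparr>" ..
    then show "?P (Suc l) (sem N body (set_iv Snd l t))"
      using t by (auto simp: body_def set_iv_def less_Suc_eq)
  qed
  have t: "t = (let u = loop N Snd (sem N body) s in
      u\<lparr>ia := (ia u)(Pow := (ia u Pow)(iv u Jobs + 1 := 0))\<rparr>)"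
    by (simp add: t_def fill_powers_def body_def Let_def)
  show "iv t Jobs = n" "ra t = ra s" "\<forall>q. q \<noteq> Pow \<longrightarrow> ia t q = ia s q"
    "\<forall>l<n. ia t Pow l = 2 ^ (n - 1 - l)" "ia t Pow (n + 1) = 0"
    using P assms(2) by (auto simp: t Let_def)
qed

text \<open>The geometric sum, by induction on the number of indices above \<open>l\<close>, since
  the powers grow towards smaller indices.\<close>

lemma powers_superincreasing:
  fixes P :: "nat \<Rightarrow> nat"
  assumes "\<forall>l<n. P l = 2 ^ (n - 1 - l)" "l < n"
  shows "sum P {l<..<n} < P l"
proof -
  have "sum P {n - Suc k<..<n} < 2 ^ k" if "k < n" for k
    using that
  proof (induction k)
    case 0
    have "{n - 1<..<n} = {}" by auto
    then show ?case by simp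
  next
    case (Suc k)
    have "{n - Suc (Suc k)<..<n} = insert (n - Suc k) {n - Suc k<..<n}" using Suc.prems by auto
    moreover have "P (n - Suc k) = 2 ^ k" using assms(1) Suc.prems by simp
    ultimately show ?case using Suc by simp
  qed
  from this[of "n - 1 - l"] show ?thesis using assms by simp
qed

lemma prepare_correct:
  fixes n :: nat
  assumes s: "iv s Jobs = n" "\<forall>j<n. ia s Beg j = a j" "\<forall>j<n. ia s End j = b j" "\<forall>j<n. ra s Wt j = w j"
    and ab: "\<forall>j<n. a j \<le> b j" and w: "\<forall>j<n. 0 \<le> w j"
  defines "t \<equiv> sem (n + 2) prepare s"
  shows "guarded_jobs n (ia t Beg) (ia t End) (ra t Wt)"
    and "feasible n a b = feasible n (ia t Beg) (ia t End)"
    and "\<forall>j<n. ra t Wt j = w j" "iv t Jobs = n" "\<forall>i<n + 2. ia t Row i = i * (n + 2)"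
    and "ia t Pow (n + 1) = 0" "\<forall>l<n. ia t Pow l = 2 ^ (n - 1 - l)"
proof -
  let ?N = "n + 2"
  define M where "M = 1 + (\<Sum>j<n. b j)"
  obtain v where "sem ?N sum_ends s = s\<lparr>iv := (iv s)(Snd := v, Acc := 1 + (\<Sum>j<n. ia s End j))\<rparr>"
    using sum_ends_correct[OF s(1), of ?N] by auto
  then have s1: "sem ?N sum_ends s = s\<lparr>iv := (iv s)(Snd := v, Acc :=
    M)\<rparr>" using s(3) by (simp add: M_def)
  define s1 where "s1 = s\<lparr>iv := (iv s)(Snd := v, Acc := M)\<rparr>"
  have j1: "iv s1 Jobs = n" "iv s1 Acc = M" using s(1) by (simp_all add: s1_def)
  define s2 where "s2 = sem ?N move_jobs s1"
  note m = move_jobs_correct[OF j1(1), of ?N, folded s2_def, simplified]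
  have s2: "iv s2 Jobs = n" "iv s2 Acc = M" "ra s2 = ra s"
    "\<forall>j<n. ia s2 Beg j = (if b j \<le> a j then M + j else a j + 1)"
    "\<forall>j<n. ia s2 End j = (if b j \<le> a j then M + j + 1 else b j + 1)"
    using m j1 s by (auto simp: s1_def)
  define s3 where "s3 = sem ?N add_sentinels s2"
  have s3: "iv s3 Jobs = n" "ra s3 Wt = (ra s Wt)(n := 0, n + 1 := 0)"
    "ia s3 Beg = (ia s2 Beg)(n := 0, n + 1 := M + n)"
    "ia s3 End = (ia s2 End)(n := 1, n + 1 := M + n + 1)"
    using s2 by (simp_all add: s3_def add_sentinels_def)
  define s4 where "s4 = sem ?N fill_rows s3"
  note r = fill_rows_correct[of ?N s3, folded s4_def]
  have j4: "iv s4 Jobs = n" using r(1) s3(1) by simp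
  note p = fill_powers_correct[OF j4, of ?N]
  have t: "t = sem ?N fill_powers s4"
    by (simp only: t_def prepare_def sem.simps(6) s1 s1_def s2_def s3_def s4_def)
  note p = p[folded t, simplified]
  have A: "ia t Beg = (ia s2 Beg)(n := 0, n + 1 := M + n)" using p(3) r(3) s3(3) by simp
  have B: "ia t End = (ia s2 End)(n := 1, n + 1 := M + n + 1)" using p(3) r(3) s3(4) by simp
  have W: "ra t Wt = (ra s Wt)(n := 0, n + 1 := 0)" using p(2) r(2) s3(2) by simp
  have Aj: "ia t Beg j = (if b j \<le> a j then M + j else a j + 1)" if "j < n" for j
    using A s2(4) that by simp
  have Bj: "ia t End j = (if b j \<le> a j then M + j + 1 else b j + 1)" if "j < n" for j
    using B s2(5) that by simp
  have bM: "b j + 1 \<le> M" if "j < n" for j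
    using member_le_sum[of j "{..<n}" b] that by (simp add: M_def)
  show "iv t Jobs = n" "ia t Pow (n + 1) = 0" "\<forall>l<n. ia t Pow l = 2 ^ (n - 1 - l)" using p by auto
  show "\<forall>i<n + 2. ia t Row i = i * (n + 2)" using p(3) r(4) by simp
  show "\<forall>j<n. ra t Wt j = w j" using W s(4) by simp
  have cases: "j < n \<or> j = n \<or> j = n + 1" if "j < n + 2" for j using that by linarith
  show "guarded_jobs n (ia t Beg) (ia t End) (ra t Wt)"
  proof
    fix j assume "j < n + 2"
    then show "ia t Beg j < ia t End j" using cases[of j] Aj[of j] Bj[of j] A B by auto
  next
    fix j assume "j < n + 2" "j \<noteq> n"
    then show "ia t End n \<le> ia t Beg j" using cases[of j] Aj[of j] A B by (auto simp: M_def)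
  next
    fix j assume "j < n + 2" "j \<noteq> n + 1"
    then show "ia t End j \<le> ia t Beg (n + 1)" using cases[of j] Bj[of j] bM[of j] A B by (auto simp:
      M_def)
  next
    fix j assume "j < n"
    then show "0 \<le> ra t Wt j" using W s(4) w by simp
  next
    show "ra t Wt n = 0" "ra t Wt (n + 1) = 0" using W by auto
  qed
  \<comment> \<open>Two intervals that were nonempty are just shifted. An empty one was disjoint
    from everything, and so is its substitute: shifted right ends are at most \<open>M\<close>, and
    substitutes start at different points \<open>M + j\<close>.\<close>
  have "ival a b i \<inter> ival a b j = {} \<longleftrightarrow> ival (ia t Beg) (ia t End) i \<inter> ival (ia t Beg) (ia t End) j = {}"
    if ij: "i < n" "j < n" "i \<noteq> j" for i j
    using ij Aj[of i] Bj[of i] Aj[of j] Bj[of j] bM[of i] bM[of j] ab[rule_format,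
      of i] ab[rule_format, of j]
    by (auto simp: ival_def Int_atLeastLessThan max_def min_def)
  then show "feasible n a b = feasible n (ia t Beg) (ia t End)"
    unfolding feasible_def fun_eq_iff by (metis lessThan_iff subsetD)
qed

section \<open>Input and output\<close>

definition terminates :: "scom \<Rightarrow> mem \<Rightarrow> nat \<Rightarrow> (mem \<Rightarrow> bool) \<Rightarrow> bool" where
  "terminates c m T Q \<longleftrightarrow> (\<exists>t\<le>T. \<exists>m'. big_step c m t m' \<and> Q m')"

lemma terminates_Blk:
  "\<forall>i\<in>set is. \<not> is_jump i \<Longrightarrow> Q (fold mexec is m) \<Longrightarrow> length is \<le> T \<Longrightarrow> terminates (Blk is) m T Q"
  unfolding terminates_def using big_step.Blk by blast

lemma terminates_Sq:
  assumes "terminates c m T P" "\<And>m'. P m' \<Longrightarrow> terminates d m' U Q"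
  shows "terminates (Sq c d) m (T + U) Q"
proof -
  obtain t m' where 1: "t \<le> T" "big_step c m t m'" "P m'" using assms(1) by (auto simp: terminates_def)
  obtain u m'' where 2: "u \<le> U" "big_step d m' u m''" "Q m''" using assms(2)[OF 1(3)] by (auto simp:
    terminates_def)
  show ?thesis unfolding terminates_def using big_step.Sq[OF 1(2) 2(2)] 1(1) 2(1,3)
    by (intro exI[of _ "t + u"] conjI exI[of _ m'']) auto
qed

lemma terminates_Ite:
  assumes "holds b m \<Longrightarrow> terminates c m T Q" "\<not> holds b m \<Longrightarrow> terminates d m T Q"
  shows "terminates (Ite b c d) m (T + 2) Q"
proof (cases "holds b m")
  case True
  then obtain t m' where "t \<le> T" "big_step c m t m'" "Q m'" using assms(1) by (auto simp:
    terminates_def)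
  then show ?thesis unfolding terminates_def using IteT[OF True]
    by (intro exI[of _ "t + 2"] conjI exI[of _ m']) auto
next
  case False
  then obtain t m' where "t \<le> T" "big_step d m t m'" "Q m'" using assms(2) by (auto simp:
    terminates_def)
  then show ?thesis unfolding terminates_def using IteF[OF False]
    by (intro exI[of _ "t + 2"] conjI exI[of _ m']) auto
qed

lemma terminates_Until:
  assumes init: "P i m" "i \<le> k"
    and step: "\<And>j m. i \<le> j \<Longrightarrow> j < k \<Longrightarrow> P j m \<Longrightarrow> \<not> holds b m \<and> terminates c m T (P (Suc j))"
    and exit: "\<And>m. P k m \<Longrightarrow> holds b m"
  shows "terminates (Until b c) m ((k - i) * (T + 2) + 1) (P k)"
  using init step
proof (induction "k - i" arbitrary: i m)
  case 0
  then have "i = k" by simp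
  then have "big_step (Until b c) m 1 m" using UntilT exit 0 by blast
  then show ?case unfolding terminates_def using 0 \<open>i =
    k\<close> by (intro exI[of _ 1] conjI exI[of _ m]) simp_all
next
  case (Suc d)
  then have ik: "i < k" by simp
  obtain t m' where 1: "\<not> holds b m" "t \<le> T" "big_step c m t m'" "P (Suc i) m'"
    using Suc.prems(3)[OF _ ik Suc.prems(1)] by (auto simp: terminates_def)
  have "terminates (Until b c) m' ((k - Suc i) * (T + 2) + 1) (P k)"
  proof (rule Suc.hyps(1))
    show "d = k - Suc i" "Suc i \<le> k" using Suc.hyps(2) ik by simp_all
    show "P (Suc i) m'" by (rule 1(4))
    show "\<not> holds b m \<and> terminates c m T (P (Suc j))" if "Suc i \<le> j" "j < k" "P j m" for j m
      using Suc.prems(3)[of j m] that by simp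
  qed
  then obtain u m'' where 2: "u \<le> (k - Suc i) * (T + 2) + 1" "big_step (Until b c) m' u m''" "P k m''"
    by (auto simp: terminates_def)
  have "k - i = Suc (k - Suc i)" using ik by simp
  then have "t + u + 2 \<le> (k - i) * (T + 2) + 1" using 1(2) 2(1) by simp
  then show ?case unfolding terminates_def using UntilF[OF 1(1,3) 2(2)] 2(3) by blast
qed

lemma terminates_mono:
  "terminates c m T Q \<Longrightarrow> T \<le> U \<Longrightarrow> (\<And>m. Q m \<Longrightarrow> R m) \<Longrightarrow> terminates c m U R"
  unfolding terminates_def using order_trans[of _ T U] by blast

text \<open>The input occupies all registers up to \<open>2 n\<close>, so it is first moved out of the way, to the
  addresses from \<open>64 n\<close> on.  Doubling register 0 is the only way to obtain such an address
  without overwriting input.\<close>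

definition save_low :: "instr list" where
  "save_low = [IAdd 0 0 0, IAdd 0 0 0, IAdd 0 0 0, IAdd 0 0 0, IAdd 0 0 0, IAdd 0 0 0,
     IStore 0 1, IConst 1 1, IAdd 0 0 1, IStore 0 2, IAdd 0 0 1, IStore 0 3, IAdd 0 0 1, IStore 0 4,
     IConst 2 3, ISub 4 0 2, IAdd 0 0 1, IConst 2 5]"

text \<open>Register 0 is the target pointer, 2 the source pointer, 1 the constant 1, 3 the value in
  transit and 4 the base \<open>64 n\<close>. Copying runs until the source pointer reaches that
  base, a bound already at hand that covers the \<open>2 n\<close> input registers.\<close>

definition copy_ints :: scom where
  "copy_ints = Until (TI 4 2) (Blk [ILoad 3 2, IStore 0 3, IAdd 2 2 1, IAdd 0 0 1])"

text \<open>Real register 0 is the transit register, so the weight stored in it is saved before the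
  loop starts.\<close>

definition copy_reals :: scom where
  "copy_reals = Sq (Blk [RStore 4 0, IAdd 0 4 1, IConst 2 1])
     (Until (TI 4 2) (Blk [RLoad 0 2, RStore 0 0, IAdd 2 2 1, IAdd 0 0 1]))"

text \<open>Registers 1 to 4 are freed one after another: saving \<open>I[1]\<close> makes room for
  the constant 1, which then advances the pointer. \<open>n \<ge> 1\<close> keeps the target
  \<open>64 n\<close> apart from the input and from these registers.\<close>

lemma save_low_correct:
  fixes I :: "nat \<Rightarrow> int" and R :: "nat \<Rightarrow> real"
  assumes "1 \<le> n" "I 0 = int n"
  shows "fold mexec save_low (I, R) =
    (\<lambda>k. if k = 0 then int (64 * n + 4) else if k = 1 then 1 else if k = 2 then 5
      else if k = 4 then int (64 * n)
      else if 64 * n \<le> k \<and> k < 64 * n + 4 then I (Suc k - 64 * n) else I k, R)"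
proof -
  have a: "nat (int n * 64) = 64 * n" "nat (1 + int n * 64) = 64 * n + 1"
    "nat (2 + int n * 64) = 64 * n + 2" "nat (3 + int n * 64) = 64 * n + 3"
    by (simp_all add: nat_add_distrib nat_mult_distrib)
  show ?thesis
    using assms by (auto simp: save_low_def a fun_eq_iff algebra_simps)
qed

text \<open>Nonnegativity of all registers is carried along because environments hold naturals, so
  that any memory reached in this way can be read as an environment.\<close>

lemma copy_ints_correct:
  assumes B: "5 \<le> B" and m: "fst m 0 = int (B + 4)" "fst m 1 = 1" "fst m 2 = 5" "fst m 4 = int B"
    "\<And>i. i < 4 \<Longrightarrow> fst m (B + i) = I (Suc i)" "\<And>i. 5 \<le> i \<Longrightarrow> i < B \<Longrightarrow> fst m i = I i"
    "\<And>i. 0 \<le> fst m i" "snd m = R"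
  shows "terminates copy_ints m ((B - 1 - 4) * 6 + 1) (\<lambda>m'. fst m' 1 = 1 \<and> fst m' 4 = int B \<and>
    snd m' = R \<and>
    (\<forall>i<B - 1. fst m' (B + i) = I (Suc i)) \<and> (\<forall>i. 0 \<le> fst m' i))"
proof -
  define P where "P k m' \<longleftrightarrow> fst m' 0 = int (B + k) \<and> fst m' 1 = 1 \<and> fst m' 2 = int (Suc k) \<and>
    fst m' 4 = int B \<and> snd m' = R \<and> (\<forall>i<k. fst m' (B + i) = I (Suc i)) \<and>
    (\<forall>i. k < i \<longrightarrow> i < B \<longrightarrow> fst m' i = I i) \<and> (\<forall>i. 0 \<le> fst m' i)" for k and m' :: mem
  have "terminates copy_ints m ((B - 1 - 4) * (4 + 2) + 1) (P (B - 1))"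
    unfolding copy_ints_def
  proof (rule terminates_Until)
    show "P 4 m" using m by (simp add: P_def)
    show "4 \<le> B - 1" using B by simp
    show "holds (TI 4 2) m'" if "P (B - 1) m'" for m' using that B by (simp add: P_def)
  next
    fix k m' assume k: "4 \<le> k" "k < B - 1" and P: "P k m'"
    let ?is = "[ILoad 3 2, IStore 0 3, IAdd 2 2 1, IAdd 0 0 1]"
    \<comment> \<open>Naming the address makes it an atom, so that its comparison with fixed
      registers does not unfold the sum.\<close>
    obtain D where D: "D = B + k" by blast
    have D9: "9 \<le> D" using D B k by simp
    have st: "fst m' 0 = int D" "fst m' 1 = 1" "fst m' 2 = int (Suc k)" "fst m' 4 = int B" "snd m' = R"
      "\<forall>i<k. fst m' (B + i) = I (Suc i)" "\<forall>i. k < i \<longrightarrow> i < B \<longrightarrow> fst m' i = I i" "\<forall>i. 0 \<le> fst m' i"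
      using P unfolding P_def D by blast+
    have Ik: "fst m' (Suc k) = I (Suc k)" using st(7) k by simp
    obtain g where g: "g = (fst m')(3 := I (Suc k), D := I (Suc k), 2 := int (Suc k) + 1, 0 :=
      int D + 1)" by blast
    have f: "fold mexec ?is m' = (g, R)"
      using st(1-5) Ik D9 unfolding g by (simp del: of_nat_Suc)
    have "g (B + i) = I (Suc i)" if "i < Suc k" for i
      using that st(6) D B k by (cases "i = k") (simp_all add: g)
    moreover have "g i = I i" if "Suc k < i" "i < B" for i
      using that st(7) D B k by (simp add: g)
    moreover have "0 \<le> I (Suc k)" using st(8) Ik by metis
    then have "0 \<le> g i" for i using st(8) by (simp add: g)
    moreover have "g 0 = int (B + Suc k)" "g 1 = 1" "g 2 = int (Suc (Suc k))" "g 4 = int B"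
      using D D9 st(2,4) by (simp_all add: g)
    ultimately have "P (Suc k) (g, R)" unfolding P_def fst_conv snd_conv by blast
    then have "P (Suc k) (fold mexec ?is m')" unfolding f .
    then have "terminates (Blk ?is) m' 4 (P (Suc k))"
      by (intro terminates_Blk) simp_all
    moreover have "\<not> holds (TI 4 2) m'" using st(3,4) k by simp
    ultimately show "\<not> holds (TI 4 2) m' \<and> terminates (Blk ?is) m' 4 (P (Suc k))" by blast
  qed
  then show ?thesis by (rule terminates_mono) (simp_all add: P_def)
qed

lemma copy_reals_correct:
  assumes B: "5 \<le> B" and m: "fst m 1 = 1" "fst m 4 = int B" "snd m = R" "\<And>i. 0 \<le> fst m i"
    and up: "\<And>i. i < K \<Longrightarrow> fst m (B + i) = J i"
  shows "terminates copy_reals m (3 + ((B - 1) * 6 + 1)) (\<lambda>m'. fst m' 4 = int B \<and>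
    (\<forall>i<K. fst m' (B + i) = J i) \<and> (\<forall>i<B. snd m' (B + i) = R i) \<and> (\<forall>i. 0 \<le> fst m' i))"
proof -
  define P where "P k m' \<longleftrightarrow> fst m' 0 = int (B + k) \<and> fst m' 1 = 1 \<and> fst m' 2 = int k \<and>
    fst m' 4 = int B \<and> (\<forall>i<K. fst m' (B + i) = J i) \<and> (\<forall>i<k. snd m' (B + i) = R i) \<and>
    (\<forall>i. k \<le> i \<longrightarrow> i < B \<longrightarrow> snd m' i = R i) \<and> (\<forall>i. 0 \<le> fst m' i)" for k and m' :: mem
  have "terminates copy_reals m (3 + ((B - 1) * (4 + 2) + 1)) (P B)"
    unfolding copy_reals_def
  proof (rule terminates_Sq)
    have "P 1 (fold mexec [RStore 4 0, IAdd 0 4 1, IConst 2 1] m)"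
      using m B up by (simp add: P_def)
    then show "terminates (Blk [RStore 4 0, IAdd 0 4 1, IConst 2 1]) m 3 (P 1)"
      by (intro terminates_Blk) simp_all
  next
    fix m1 assume "P 1 m1"
    then show "terminates (Until (TI 4 2) (Blk [RLoad 0 2, RStore 0 0, IAdd 2 2 1, IAdd 0 0 1])) m1
      ((B - 1) * (4 + 2) + 1) (P B)"
    proof (rule terminates_Until)
      show "1 \<le> B" using B by simp
      show "holds (TI 4 2) m'" if "P B m'" for m' using that by (simp add: P_def)
    next
      fix k m' assume k: "1 \<le> k" "k < B" and P: "P k m'"
      let ?is = "[RLoad 0 2, RStore 0 0, IAdd 2 2 1, IAdd 0 0 1]"
      obtain D where D: "D = B + k" by blast
      have st: "fst m' 0 = int D" "fst m' 1 = 1" "fst m' 2 = int k" "fst m' 4 = int B"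
        "\<forall>i<K. fst m' (B + i) = J i" "\<forall>i<k. snd m' (B + i) = R i"
        "\<forall>i. k \<le> i \<longrightarrow> i < B \<longrightarrow> snd m' i = R i" "\<forall>i. 0 \<le> fst m' i"
        using P unfolding P_def D by blast+
      have Rk: "snd m' k = R k" using st(7) k by simp
      obtain g h where gh: "g = (fst m')(2 := int k + 1, 0 := int D + 1)" "h = (snd m')(0 := R k,
        D := R k)" by blast
      have f: "fold mexec ?is m' = (g, h)"
        using st(1-4) Rk unfolding gh by simp
      have "g (B + i) = J i" if "i < K" for i using that st(5) B by (simp add: gh)
      moreover have "h (B + i) = R i" if "i < Suc k" for i
        using that st(6) D B by (cases "i = k") (simp_all add: gh)
      moreover have "h i = R i" if "Suc k \<le> i" "i < B" for i using that st(7) D by (simp add: gh)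
      moreover have "0 \<le> g i" for i using st(8) by (simp add: gh)
      moreover have "g 0 = int (B + Suc k)" "g 1 = 1" "g 2 = int (Suc k)" "g 4 = int B"
        using D st(2,4) by (simp_all add: gh)
      ultimately have "P (Suc k) (g, h)" unfolding P_def fst_conv snd_conv by blast
      then have "P (Suc k) (fold mexec ?is m')" unfolding f .
      then have "terminates (Blk ?is) m' 4 (P (Suc k))"
        by (intro terminates_Blk) simp_all
      moreover have "\<not> holds (TI 4 2) m'" using st(3,4) k by simp
      ultimately show "\<not> holds (TI 4 2) m' \<and> terminates (Blk ?is) m' 4 (P (Suc k))" by blast
    qed
  qed
  then show ?thesis by (rule terminates_mono) (simp_all add: P_def)
qed

text \<open>All registers used are congruent to 0 or 1 modulo 8, hence disjoint from the array cells
  being filled. They lie below 64, which is why the copy was placed at \<open>64 n\<close> and not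
  closer. Register 24 advances by 64 towards the limit \<open>64 n\<close>, since \<open>n\<close>
  itself is no longer stored; register 8, the address of \<open>Jobs\<close>, counts the rounds and
  ends up holding \<open>n\<close>.\<close>

definition spread_init :: "instr list" where
  "spread_init = [IConst 0 0, IAdd 16 4 0, IConst 1 1, IConst 9 8, IConst 17 64, IConst 24 0,
     IConst 32 2, IAdd 40 16 0, IAdd 48 16 0, IConst 8 0]"

definition spread_step :: "instr list" where
  "spread_step = [ILoad 0 40, IStore 32 0, IAdd 40 40 1, IAdd 32 32 1, ILoad 0 40, IStore 32 0,
     IAdd 40 40 1, RLoad 0 48, ISub 32 32 1, RStore 32 0, IAdd 32 32 9, IAdd 48 48 1,
     IAdd 24 24 17, IAdd 8 8 1]"

definition spread :: scom where
  "spread = Sq (Blk spread_init) (Sq (Until (TI 16 24) (Blk spread_step)) (Blk [IAdd 0 8 1,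
    IAdd 0 0 1]))"

text \<open>The cells \<open>D\<close> and \<open>Suc D\<close> avoid all bookkeeping registers and
  lie below the integer source \<open>S\<close>, so no integer still to be read is lost.\<close>

lemma spread_step_correct:
  fixes I :: "nat \<Rightarrow> int" and R :: "nat \<Rightarrow> real"
  assumes D: "\<forall>x\<in>{0, 1, 8, 9, 16, 17, 24, 32, 40, 48}. D \<noteq> x \<and> Suc D \<noteq> x" "Suc D < S" and S: "64 \<le> S"
    and I: "I 32 = int D" "I 40 = int S" "I 48 = int T" "I 1 = 1" "I 9 = 8" "I 17 = 64"
  shows "fold mexec spread_step (I, R) =
    (I(0 := I S, D := I S, 40 := int S + 1, 32 := int D + 1, 0 := I (Suc S), Suc D := I (Suc S),
      40 := int S + 2, 32 := int D + 8, 48 := int T + 1, 24 := I 24 + 64, 8 := I 8 + 1),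
     R(0 := R T, D := R T))"
proof -
  obtain D' S' where D': "D' = Suc D" "S' = Suc S" by blast
  have sD: "int S' = int S + 1" "int D' = int D + 1" using D' by simp_all
  have ne: "S' \<noteq> 32" "S' \<noteq> 40" "S' \<noteq> D" "S' \<noteq> 0" using D(2) S D' by simp_all
  have Dn: "D \<noteq> 0" "D \<noteq> Suc 0" "D \<noteq> 8" "D \<noteq> 9" "D \<noteq> 17" "D \<noteq> 24" "D \<noteq> 32" "D \<noteq> 40" "D \<noteq> 48"
    "D' \<noteq> 0" "D' \<noteq> Suc 0" "D' \<noteq> 8" "D' \<noteq> 9" "D' \<noteq> 17" "D' \<noteq> 24" "D' \<noteq> 32" "D' \<noteq> 40" "D' \<noteq> 48"
    using D(1) unfolding D'(1) by auto
  have I1: "I (Suc 0) = 1" using I(4) by simp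
  define I1 where "I1 = I(0 := I S, D := I S, 40 := int S', 32 := int D')"
  have 1: "fold mexec [ILoad 0 40, IStore 32 0, IAdd 40 40 1, IAdd 32 32 1] (I, R) = (I1, R)"
    by (simp add: I I1 Dn Dn[symmetric] I1_def sD add.commute)
  have v1: "I1 40 = int S'" "I1 32 = int D'" "I1 (Suc 0) = 1" "I1 S' = I S'" "I1 48 = int T" "I1 9 = 8"
    "I1 17 = 64" "I1 24 = I 24" "I1 8 = I 8"
    using ne Dn by (simp_all add: I1_def I I1)
  define I2 where "I2 = I1(0 := I S', D' := I S', 40 := int S' + 1)"
  have 2: "fold mexec [ILoad 0 40, IStore 32 0, IAdd 40 40 1] (I1, R) = (I2, R)"
    by (simp add: v1 Dn Dn[symmetric] I2_def)
  have v2: "I2 32 = int D'" "I2 (Suc 0) = 1" "I2 48 = int T" "I2 9 = 8" "I2 17 = 64" "I2 24 =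
    I 24" "I2 8 = I 8"
    using Dn by (simp_all add: I2_def v1)
  have 3: "fold mexec [RLoad 0 48, ISub 32 32 1, RStore 32 0, IAdd 32 32 9, IAdd 48 48 1,
    IAdd 24 24 17, IAdd 8 8 1]
    (I2, R) = (I2(32 := int D + 8, 48 := int T + 1, 24 := I 24 + 64, 8 := I 8 + 1), R(0 := R T, D :=
      R T))"
    by (simp add: v2) (simp add: D' algebra_simps)
  have eq: "spread_step = [ILoad 0 40, IStore 32 0, IAdd 40 40 1, IAdd 32 32 1] @ [ILoad 0 40,
    IStore 32 0, IAdd 40 40 1] @
    [RLoad 0 48, ISub 32 32 1, RStore 32 0, IAdd 32 32 9, IAdd 48 48 1, IAdd 24 24 17, IAdd 8 8 1]"
    by (simp add: spread_step_def)
  have "fold mexec spread_step (I, R) =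
    (I2(32 := int D + 8, 48 := int T + 1, 24 := I 24 + 64, 8 := I 8 + 1), R(0 := R T, D := R T))"
    unfolding eq fold_append comp_apply 1 2 3 ..
  then show ?thesis by (simp add: I2_def I1_def D' add.commute)
qed

lemma spread_correct:
  assumes n: "1 \<le> n" and m: "fst m 4 = int (64 * n)" "\<And>i. 0 \<le> fst m i"
    and ints: "\<And>i. i < 2 * n \<Longrightarrow> fst m (64 * n + i) = J i" and reals: "\<And>i. i < n \<Longrightarrow>
      snd m (64 * n + i) = R i"
  shows "terminates spread m (10 + ((n * 16 + 1) + 2)) (\<lambda>m'. fst m' 0 = int (n + 2) \<and> fst m' 8 = int n \<and>
    (\<forall>i<n. fst m' (8 * i + 2) = J (2 * i) \<and> fst m' (8 * i + 3) = J (2 * i + 1) \<and>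
      snd m' (8 * i + 2) = R i) \<and>
    (\<forall>i. 0 \<le> fst m' i))"
proof -
  define P where "P k m' \<longleftrightarrow> fst m' 8 = int k \<and> fst m' 1 = 1 \<and> fst m' 9 = 8 \<and> fst m' 17 = 64 \<and>
    fst m' 16 = int (64 * n) \<and> fst m' 24 = int (64 * k) \<and> fst m' 32 = int (8 * k + 2) \<and>
    fst m' 40 = int (64 * n + 2 * k) \<and> fst m' 48 = int (64 * n + k) \<and>
    (\<forall>i<k. fst m' (8 * i + 2) = J (2 * i) \<and> fst m' (8 * i + 3) = J (2 * i + 1) \<and>
      snd m' (8 * i + 2) = R i) \<and>
    (\<forall>i<2 * n. fst m' (64 * n + i) = J i) \<and> (\<forall>i<n. snd m' (64 * n + i) = R i) \<and>
    (\<forall>i. 0 \<le> fst m' i)" for k and m' :: mem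
  show ?thesis
    unfolding spread_def
  proof (rule terminates_Sq)
    have "P 0 (fold mexec spread_init m)"
      using m n ints reals by (auto simp: P_def spread_init_def)
    then show "terminates (Blk spread_init) m 10 (P 0)"
      by (intro terminates_Blk) (simp_all add: spread_init_def)
  next
    fix m0 assume m0: "P 0 m0"
    show "terminates (Sq (Until (TI 16 24) (Blk spread_step)) (Blk [IAdd 0 8 1, IAdd 0 0 1])) m0
      ((n * 16 + 1) + 2) (\<lambda>m'. fst m' 0 = int (n + 2) \<and> fst m' 8 = int n \<and>
    (\<forall>i<n. fst m' (8 * i + 2) = J (2 * i) \<and> fst m' (8 * i + 3) = J (2 * i + 1) \<and>
      snd m' (8 * i + 2) = R i) \<and>
    (\<forall>i. 0 \<le> fst m' i))"
    proof (rule terminates_Sq)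
      have "terminates (Until (TI 16 24) (Blk spread_step)) m0 ((n - 0) * (14 + 2) + 1) (P n)"
        using m0
      proof (rule terminates_Until)
        show "holds (TI 16 24) m'" if "P n m'" for m' using that by (simp add: P_def)
      next
        fix k m' assume k: "k < n" and P: "P k m'"
        have all: "\<forall>i<2 * n. fst m' (64 * n + i) = J i" "\<forall>i<n. snd m' (64 * n + i) = R i"
          "\<forall>i<k. fst m' (8 * i + 2) = J (2 * i) \<and> fst m' (8 * i + 3) = J (2 * i + 1) \<and>
            snd m' (8 * i + 2) = R i"
          "\<forall>i. 0 \<le> fst m' i"
          using P unfolding P_def by blast+
        have J: "fst m' (64 * n + 2 * k) = J (2 * k)" "fst m' (Suc (64 * n + 2 * k)) = J (2 * k + 1)"
          "snd m' (64 * n + k) = R k"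
          using all(1)[rule_format, of "2 * k"] all(1)[rule_format, of "2 * k + 1"] all(2) k by simp_all
        define D S T where "D = 8 * k + 2" and "S = 64 * n + 2 * k" and "T = 64 * n + k"
        have D: "D \<noteq> 0 \<and> D \<noteq> 1 \<and> D \<noteq> 8 \<and> D \<noteq> 9 \<and> D \<noteq> 16 \<and> D \<noteq> 17 \<and> D \<noteq> 24 \<and> D \<noteq> 32 \<and> D \<noteq> 40 \<and> D \<noteq> 48"
          "Suc D \<noteq> 0 \<and> Suc D \<noteq> 1 \<and> Suc D \<noteq> 8 \<and> Suc D \<noteq> 9 \<and> Suc D \<noteq> 16 \<and> Suc D \<noteq> 17 \<and>
           Suc D \<noteq> 24 \<and> Suc D \<noteq> 32 \<and> Suc D \<noteq> 40 \<and> Suc D \<noteq> 48"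
          unfolding D_def by presburger+
        have S: "64 \<le> S" "Suc D < S" using n k unfolding D_def S_def by linarith+
        have st: "fst m' 32 = int D" "fst m' 40 = int S" "fst m' 48 = int T" "fst m' 1 =
          1" "fst m' 9 = 8"
          "fst m' 17 = 64" "fst m' 24 = int (64 * k)" "fst m' 8 = int k"
          "fst m' S = J (2 * k)" "fst m' (Suc S) = J (2 * k + 1)" "snd m' T = R k"
          using P J unfolding P_def D_def S_def T_def by simp_all
        have f: "fold mexec spread_step m' = ((fst m')(0 := J (2 * k), D := J (2 * k), 40 :=
          int S + 1, 32 := int D + 1,
            0 := J (2 * k + 1), Suc D := J (2 * k + 1), 40 := int S + 2, 32 := int D + 8,
            48 := int T + 1, 24 := int (64 * k) + 64, 8 := int k + 1), (snd m')(0 := R k, D := R k))"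
          using spread_step_correct[of D S "fst m'" T "snd m'"] D S(1,2) st by simp
        have nn: "0 \<le> J (2 * k)" "0 \<le> J (2 * k + 1)" using all(4) J by metis+
        have low: "8 * i + 2 \<noteq> 0 \<and> 8 * i + 2 \<noteq> 40 \<and> 8 * i + 2 \<noteq> 32 \<and> 8 * i + 2 \<noteq> 48 \<and>
          8 * i + 2 \<noteq> 24 \<and> 8 * i + 2 \<noteq> 8"
          "8 * i + 3 \<noteq> 0 \<and> 8 * i + 3 \<noteq> 40 \<and> 8 * i + 3 \<noteq> 32 \<and> 8 * i + 3 \<noteq> 48 \<and> 8 * i + 3 \<noteq> 24 \<and>
            8 * i + 3 \<noteq> 8" for i :: nat
          by presburger+
        obtain g h where gh: "g = (fst m')(0 := J (2 * k), D := J (2 * k), 40 := int S + 1, 32 :=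
          int D + 1,
            0 := J (2 * k + 1), Suc D := J (2 * k + 1), 40 := int S + 2, 32 := int D + 8,
            48 := int T + 1, 24 := int (64 * k) + 64, 8 := int k + 1)"
          "h = (snd m')(0 := R k, D := R k)" by blast
        have "g (8 * i + 2) = J (2 * i) \<and> g (8 * i + 3) = J (2 * i + 1) \<and> h (8 * i + 2) =
          R i" if "i < Suc k" for i
        proof (cases "i = k")
          case True
          have eq: "8 * k + 2 = D" "8 * k + 3 = Suc D" by (simp_all add: D_def)
          show ?thesis unfolding True eq using D by (simp add: gh)
        next
          case False
          then have ik: "i < k" using that by simp
          obtain E F where EF: "E = 8 * i + 2" "F = 8 * i + 3" by blast
          have "fst m' E = J (2 * i)" "fst m' F = J (2 * i + 1)" "snd m' E = R i"
            using all(3) ik unfolding EF by blast+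
          moreover have "E \<noteq> D" "E \<noteq> Suc D" "F \<noteq> D" "F \<noteq> Suc D" using ik by (simp_all add: EF D_def)
          ultimately show ?thesis
            using low[of i, folded EF] unfolding EF[symmetric] by (simp add: gh)
        qed
        moreover have "g (64 * n + i) = fst m' (64 * n + i) \<and> h (64 * n + i) =
          snd m' (64 * n + i)" for i
        proof -
          obtain E where E: "E = 64 * n + i" by blast
          have "E \<noteq> 0" "E \<noteq> 8" "E \<noteq> 24" "E \<noteq> 32" "E \<noteq> 40" "E \<noteq> 48" "E \<noteq> D" "E \<noteq> Suc D"
            using n k unfolding E D_def by linarith+
          then show ?thesis unfolding E[symmetric] by (simp add: gh)
        qed
        then have "\<forall>i<2 * n. g (64 * n + i) = J i" "\<forall>i<n. h (64 * n + i) =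
          R i" using all(1,2) by simp_all
        moreover have "0 \<le> g i" for i using all(4) nn by (simp add: gh)
        moreover have "g 8 = int (Suc k) \<and> g 1 = 1 \<and> g 9 = 8 \<and> g 17 = 64 \<and> g 16 = int (64 * n) \<and>
          g 24 = int (64 * Suc k) \<and> g 32 = int (8 * Suc k + 2) \<and> g 40 = int (64 * n + 2 * Suc k) \<and>
          g 48 = int (64 * n + Suc k)"
          using D P by (simp add: gh P_def D_def S_def T_def)
        ultimately have "P (Suc k) (g, h)" unfolding P_def fst_conv snd_conv by blast
        then have "P (Suc k) (fold mexec spread_step m')" unfolding f gh .
        moreover have "\<forall>i\<in>set spread_step. \<not> is_jump i" "length spread_step \<le> 14"
          by (simp_all add: spread_step_def)
        ultimately have "terminates (Blk spread_step) m' 14 (P (Suc k))"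
          using terminates_Blk by blast
        then show "\<not> holds (TI 16 24) m' \<and> terminates (Blk spread_step) m' 14 (P (Suc k))"
          using P k by (simp add: P_def)
      qed simp
      then show "terminates (Until (TI 16 24) (Blk spread_step)) m0 (n * 16 + 1) (P n)" by simp
    next
      fix m1 assume "P n m1"
      then show "terminates (Blk [IAdd 0 8 1, IAdd 0 0 1]) m1 2 (\<lambda>m'. fst m' 0 = int (n + 2) \<and>
        fst m' 8 = int n \<and>
    (\<forall>i<n. fst m' (8 * i + 2) = J (2 * i) \<and> fst m' (8 * i + 3) = J (2 * i + 1) \<and>
      snd m' (8 * i + 2) = R i) \<and>
    (\<forall>i. 0 \<le> fst m' i))"
        by (intro terminates_Blk) (simp_all add: P_def)
    qed
  qed
qed

definition prologue :: scom where
  "prologue = Sq (Blk save_low) (Sq copy_ints (Sq copy_reals spread))"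

lemma prologue_correct:
  assumes n: "1 \<le> n"
  shows "terminates prologue (mem_of (init n a b w)) (1000 * n) (\<lambda>m. \<exists>s. represents (n + 2) s m \<and>
    iv s Jobs = n \<and> (\<forall>j<n. ia s Beg j = a j) \<and> (\<forall>j<n. ia s End j = b j) \<and> (\<forall>j<n. ra s Wt j = w j))"
proof -
  let ?B = "64 * n"
  obtain I R where IR: "mem_of (init n a b w) = (I, R)" by (cases "mem_of (init n a b w)")
  have I0: "I 0 = int n" and Ia: "\<And>j. j < n \<Longrightarrow> I (Suc (2 * j)) = int (a j)"
    and Ib: "\<And>j. j < n \<Longrightarrow> I (Suc (2 * j + 1)) = int (b j)" and Inn: "\<And>i. 0 \<le> I i"
    and Rw: "\<And>j. j < n \<Longrightarrow> R j = w j"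
    using IR by (auto simp: mem_of_def init_def)
  let ?Q1 = "\<lambda>m :: mem. fst m 0 = int (?B + 4) \<and> fst m 1 = 1 \<and> fst m 2 = 5 \<and> fst m 4 = int ?B \<and>
    (\<forall>i<4. fst m (?B + i) = I (Suc i)) \<and> (\<forall>i. 5 \<le> i \<longrightarrow> i < ?B \<longrightarrow> fst m i = I i) \<and>
    (\<forall>i. 0 \<le> fst m i) \<and> snd m = R"
  let ?Q2 = "\<lambda>m :: mem. fst m 1 = 1 \<and> fst m 4 = int ?B \<and> snd m = R \<and>
    (\<forall>i<?B - 1. fst m (?B + i) = I (Suc i)) \<and> (\<forall>i. 0 \<le> fst m i)"
  let ?Q3 = "\<lambda>m :: mem. fst m 4 = int ?B \<and> (\<forall>i<?B - 1. fst m (?B + i) = I (Suc i)) \<and>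
    (\<forall>i<?B. snd m (?B + i) = R i) \<and> (\<forall>i. 0 \<le> fst m i)"
  let ?Q4 = "\<lambda>m :: mem. fst m 0 = int (n + 2) \<and> fst m 8 = int n \<and>
    (\<forall>i<n. fst m (8 * i + 2) = I (Suc (2 * i)) \<and> fst m (8 * i + 3) = I (Suc (2 * i + 1)) \<and>
      snd m (8 * i + 2) = R i) \<and> (\<forall>i. 0 \<le> fst m i)"
  have "?Q1 (fold mexec save_low (I, R))"
    unfolding save_low_correct[of n I, OF n I0] using n Inn by auto
  moreover have "\<forall>i\<in>set save_low. \<not> is_jump i" "length save_low \<le> 18"
    by (simp_all add: save_low_def)
  ultimately have 1: "terminates (Blk save_low) (I, R) 18 ?Q1"
    by (intro terminates_Blk)
  have 2: "terminates copy_ints m ((?B - 1 - 4) * 6 + 1) ?Q2" if "?Q1 m" for m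
    using that n by (intro copy_ints_correct) auto
  have 3: "terminates copy_reals m (3 + ((?B - 1) * 6 + 1)) ?Q3" if "?Q2 m" for m
    using that n by (intro copy_reals_correct) auto
  have 4: "terminates spread m (10 + ((n * 16 + 1) + 2)) ?Q4" if "?Q3 m" for m
    using that n by (intro spread_correct) auto
  have "terminates prologue (I, R)
    (18 + (((?B - 1 - 4) * 6 + 1) + ((3 + ((?B - 1) * 6 + 1)) + (10 + ((n * 16 + 1) + 2))))) ?Q4"
    unfolding prologue_def by (rule terminates_Sq[OF 1 terminates_Sq[OF 2 terminates_Sq[OF 3 4]]])
  then show ?thesis
    unfolding IR
  proof (rule terminates_mono)
    show "18 + (((?B - 1 - 4) * 6 + 1) + ((3 + ((?B - 1) * 6 + 1)) + (10 + ((n * 16 + 1) + 2)))) \<le>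
      1000 * n"
      using n by simp
  next
    fix m assume m: "?Q4 m"
    \<comment> \<open>Distinct variables and cells have distinct registers, so a memory with
      nonnegative integers and the bound in register 0 represents the environment read off from it,
      whatever the remaining cells contain.\<close>
    define s where "s = \<lparr>iv = \<lambda>x. nat (fst m (iaddr x)), rv = \<lambda>x. snd m (raddr x),
      ia = \<lambda>q i. nat (fst m (8 * i + ibase q)), ra = \<lambda>q i. snd m (8 * i + rbase q)\<rparr>"
    have "represents (n + 2) s m" using m by (simp add: represents_def s_def)
    moreover have "iv s Jobs = n" using m by (simp add: s_def)
    moreover have "ia s Beg j = a j \<and> ia s End j = b j \<and> ra s Wt j = w j" if "j < n" for j
    proof -
      have "fst m (8 * j + 2) = int (a j)" "fst m (8 * j + 3) = int (b j)" "snd m (8 * j + 2) = w j"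
        using m that Ia Ib Rw by auto
      then show ?thesis unfolding s_def by (simp del: add_2_eq_Suc')
    qed
    ultimately show "\<exists>s. represents (n + 2) s m \<and> iv s Jobs = n \<and> (\<forall>j<n. ia s Beg j = a j) \<and>
      (\<forall>j<n. ia s End j = b j) \<and> (\<forall>j<n. ra s Wt j = w j)" by blast
  qed
qed

text \<open>The answer is kept in real registers, which leaves all integer registers free for the output.\<close>

definition emit_step :: scom where
  "emit_step = Sq (Blk [IAdd 3 2 2, IAdd 3 3 3, IAdd 3 3 3, IConst 4 4, IAdd 3 3 4, RLoad 0 3])
     (Sq (Ite (TR 0 1) (Blk [IConst 4 0]) (Blk [IConst 4 1])) (Blk [IStore 2 4, IAdd 2 2 1]))"

text \<open>Registers 0 to 4 serve the output loop as scratch, so their own answers are written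
  last, with direct addresses and tests on real registers only. Writing beyond \<open>n\<close> is
  harmless, as only registers below \<open>n\<close> are read.\<close>

definition emit_low :: "nat \<Rightarrow> scom" where
  "emit_low i = Ite (TR (8 * i + 4) 1) (Blk [IConst i 0]) (Blk [IConst i 1])"

text \<open>\<open>n\<close> leaves register 8 first, because that register may itself receive
  output.\<close>

definition epilogue :: scom where
  "epilogue = Sq (Blk [IConst 1 0, IAdd 0 8 1, IConst 1 1, IConst 2 5, RConst 1 0])
     (Sq (Until (TI 0 2) emit_step)
       (Sq (emit_low 4) (Sq (emit_low 3) (Sq (emit_low 2) (Sq (emit_low 1) (emit_low 0))))))"

lemma emit_low_correct:
  assumes "Q ((fst m)(i := (if snd m (8 * i + 4) \<le> snd m 1 then 0 else 1)), snd m)"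
  shows "terminates (emit_low i) m 3 Q"
proof -
  have "terminates (Ite (TR (8 * i + 4) 1) (Blk [IConst i 0]) (Blk [IConst i 1])) m (1 + 2) Q"
    by (rule terminates_Ite; rule terminates_Blk) (use assms in simp_all)
  then show ?thesis unfolding emit_low_def by (rule terminates_mono) simp_all
qed

lemma emit_step_correct:
  assumes m: "fst m 2 = int k" "fst m 1 = 1" "snd m 1 = 0" and k: "5 \<le> k"
    and Q: "\<And>x y g h. g = (fst m)(3 := x, 4 := y, k := (if snd m (8 * k + 4) \<le> 0 then 0 else 1),
      2 := int k + 1) \<Longrightarrow>
      h = (snd m)(0 := snd m (8 * k + 4)) \<Longrightarrow> Q (g, h)"
  shows "terminates emit_step m 11 Q"
proof -
  obtain E where E: "E = 8 * k + 4" by blast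
  let ?c1 = "[IAdd 3 2 2, IAdd 3 3 3, IAdd 3 3 3, IConst 4 4, IAdd 3 3 4, RLoad 0 3]"
  let ?m1 = "((fst m)(3 := int E, 4 := 4), (snd m)(0 := snd m E))"
  let ?m2 = "((fst m)(3 := int E, 4 := (if snd m E \<le> 0 then 0 else 1)), (snd m)(0 := snd m E))"
  let ?m3 = "((fst m)(3 := int E, 4 := (if snd m E \<le> 0 then 0 else 1), k :=
    (if snd m E \<le> 0 then 0 else 1), 2 := int k + 1), (snd m)(0 := snd m E))"
  have "int k + int k + (int k + int k) + (int k + int k + (int k + int k)) + 4 =
    int E" by (simp add: E)
  then have "fold mexec ?c1 m = ?m1"
    using m(1) by (simp add: fun_upd_twist)
  then have 1: "terminates (Blk ?c1) m 6 (\<lambda>m'. m' = ?m1)"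
    by (intro terminates_Blk) (simp_all del: fold.simps fold_simps)
  have 2: "terminates (Ite (TR 0 1) (Blk [IConst 4 0]) (Blk [IConst 4 1])) m' (1 + 2) (\<lambda>m'. m' = ?m2)"
    if "m' = ?m1" for m'
    by (rule terminates_Ite; rule terminates_Blk) (use that m(3) in simp_all)
  have "Q ?m3" by (rule Q) (simp_all add: E)
  moreover have "fold mexec [IStore 2 4, IAdd 2 2 1] ?m2 = ?m3"
    using m k by simp
  ultimately have 3: "terminates (Blk [IStore 2 4, IAdd 2 2 1]) m' 2 Q" if "m' = ?m2" for m'
    unfolding that by (intro terminates_Blk) (simp_all del: fold_simps)
  have "terminates emit_step m (6 + ((1 + 2) + 2)) Q"
    unfolding emit_step_def by (rule terminates_Sq[OF 1 terminates_Sq[OF 2 3]])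
  then show ?thesis by simp
qed

lemma epilogue_correct:
  assumes m: "fst m 8 = int n" "\<And>i. i < n \<Longrightarrow> snd m (8 * i + 4) = out i"
  shows "terminates epilogue m (13 * n + 100) (\<lambda>m'. \<forall>j<n. fst m' j \<noteq> 0 \<longleftrightarrow> 0 < out j)"
proof -
  define P where "P k m' \<longleftrightarrow> fst m' 0 = int n \<and> fst m' 1 = 1 \<and> fst m' 2 = int k \<and> snd m' 1 = 0 \<and>
    (\<forall>i<n. snd m' (8 * i + 4) = out i) \<and> (\<forall>i. 5 \<le> i \<longrightarrow> i < k \<longrightarrow> i < n \<longrightarrow> (fst m' i \<noteq> 0 \<longleftrightarrow>
      0 < out i))" for k and m' :: mem
  \<comment> \<open>The loop starts at 5 and exits at once if there are at most 5 jobs.\<close>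
  let ?k = "max 5 n"
  have "P 5 (fold mexec [IConst 1 0, IAdd 0 8 1, IConst 1 1, IConst 2 5, RConst 1 0] m)"
    using m by (auto simp: P_def)
  then have 1: "terminates (Blk [IConst 1 0, IAdd 0 8 1, IConst 1 1, IConst 2 5, RConst 1 0]) m 5 (P 5)"
    by (intro terminates_Blk) simp_all
  have 2: "terminates (Until (TI 0 2) emit_step) m' ((?k - 5) * (11 + 2) + 1) (P ?k)" if "P 5 m'" for m'
    using that
  proof (rule terminates_Until)
    show "5 \<le> ?k" by simp
    show "holds (TI 0 2) m'" if "P ?k m'" for m' using that by (simp add: P_def)
  next
    fix k m' assume k: "5 \<le> k" "k < ?k" and P: "P k m'"
    have kn: "k < n" using k by simp
    have st: "fst m' 0 = int n" "fst m' 1 = 1" "fst m' 2 = int k" "snd m' 1 = 0"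
      "\<forall>i<n. snd m' (8 * i + 4) = out i" "\<forall>i. 5 \<le> i \<longrightarrow> i < k \<longrightarrow> i < n \<longrightarrow> (fst m' i \<noteq> 0 \<longleftrightarrow> 0 < out i)"
      using P unfolding P_def by blast+
    have "terminates emit_step m' 11 (P (Suc k))"
    proof (rule emit_step_correct[OF st(3,2,4) k(1)])
      fix x y g h
      assume g: "g = (fst m')(3 := x, 4 := y, k := (if snd m' (8 * k + 4) \<le> 0 then 0 else 1), 2 :=
        int k + 1)"
        and h: "h = (snd m')(0 := snd m' (8 * k + 4))"
      have "g i \<noteq> 0 \<longleftrightarrow> 0 < out i" if "5 \<le> i" "i < Suc k" "i < n" for i
        using that st(5,6) by (cases "i = k") (auto simp: g)
      moreover have "h (8 * i + 4) = out i" if "i < n" for i using that st(5) by (simp add: h)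
      moreover have "g 0 = int n" "g 1 = 1" "g 2 = int (Suc k)" "h 1 =
        0" using st(1-4) k(1) by (simp_all add: g h)
      ultimately show "P (Suc k) (g, h)" unfolding P_def fst_conv snd_conv by blast
    qed
    then show "\<not> holds (TI 0 2) m' \<and> terminates emit_step m' 11 (P (Suc k))" using st(1,3) kn by simp
  qed
  let ?Q = "\<lambda>m' :: mem. \<forall>j<n. fst m' j \<noteq> 0 \<longleftrightarrow> 0 < out j"
  have 3: "terminates (Sq (emit_low 4) (Sq (emit_low 3) (Sq (emit_low 2) (Sq (emit_low 1) (emit_low
    0)))))
      m' (3 + (3 + (3 + (3 + 3)))) ?Q" if P: "P ?k m'" for m'
  proof -
    obtain g h where gh: "m' = (g, h)" by (cases m')
    define e where "e i = (if h (8 * i + 4) \<le> h 1 then 0 else 1 :: int)" for i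
    have e: "e i \<noteq> 0 \<longleftrightarrow> 0 < out i" if "i < n" for i using P that by (auto simp: P_def e_def gh)
    have fin: "?Q (g(4 := e 4, 3 := e 3, 2 := e 2, 1 := e 1, 0 := e 0), h)"
    proof (intro allI impI)
      fix j assume j: "j < n"
      have "j = 0 \<or> j = 1 \<or> j = 2 \<or> j = 3 \<or> j = 4 \<or> 5 \<le> j" by linarith
      then show "fst (g(4 := e 4, 3 := e 3, 2 := e 2, 1 := e 1, 0 := e 0), h) j \<noteq> 0 \<longleftrightarrow> 0 < out j"
        using e[OF j] P j by (elim disjE) (simp_all add: P_def gh)
    qed
    have st: "terminates (emit_low i) (f, h) 3 (\<lambda>m. m = (f(i := e i), h))" for f i
      by (rule emit_low_correct) (simp add: e_def)
    show ?thesis unfolding gh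
    proof (rule terminates_Sq[OF st], hypsubst, rule terminates_Sq[OF st], hypsubst,
        rule terminates_Sq[OF st], hypsubst, rule terminates_Sq[OF st], hypsubst)
      show "terminates (emit_low 0) (g(4 := e 4, 3 := e 3, 2 := e 2, 1 := e 1), h) 3 ?Q"
        by (rule terminates_mono[OF st]) (use fin in simp_all)
    qed
  qed
  have "terminates epilogue m (5 + (((?k - 5) * (11 + 2) + 1) + (3 + (3 + (3 + (3 + 3)))))) ?Q"
    unfolding epilogue_def by (rule terminates_Sq[OF 1 terminates_Sq[OF 2 3]])
  then show ?thesis by (rule terminates_mono) auto
qed

section \<open>The complete solver\<close>

definition algorithm :: com where
  "algorithm = prepare ;; search ;; decode"

lemma algorithm_correct:
  assumes s: "iv s Jobs = n" "\<forall>j<n. ia s Beg j = a j" "\<forall>j<n. ia s End j = b j" "\<forall>j<n. ra s Wt j = w j"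
    and ab: "\<forall>j<n. a j \<le> b j" and w: "\<forall>j<n. 0 \<le> w j"
  defines "t \<equiv> sem (n + 2) algorithm s"
  shows "iv t Jobs = n" "\<exists>X. robust_optimal n a b w X \<and> (\<forall>l<n. ra t Out l = (if l \<in> X then 1 else 0))"
proof -
  define u where "u = sem (n + 2) prepare s"
  note p = prepare_correct[OF assms(1-6), folded u_def]
  interpret tables n "ia u Beg" "ia u End" "ra u Wt" "ia u Pow"
    by (rule tables.intro[OF p(1)]) (simp add: tables_axioms_def p(6)[simplified])
  have c: "ctx u" using p(4,5) by (simp add: ctx_def)
  define v where "v = sem (n + 2) search u"
  obtain X where X: "robust_optimal n (ia u Beg) (ia u End) (ra u Wt) X" "iv v BestSet =
    sum (ia u Pow) X"
    using search_correct(2)[OF c] v_def by blast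
  have cv: "ctx v" using search_correct(1)[OF c] v_def by simp
  have Xn: "X \<subseteq> {..<n}" using X(1) by (simp add: robust_optimal_def feasible_def)
  note d = decode_correct[OF cv Xn X(2) powers_superincreasing[OF p(7)]]
  have t: "t = sem (n + 2) decode v" by (simp only: t_def algorithm_def sem.simps(6) u_def v_def)
  show "iv t Jobs = n" using d(2) t by simp
  have "robust_optimal n a b w X"
    \<comment> \<open>Back to the original instance: the normalised one has the same feasible sets
      and job weights.\<close>
    using X(1) robust_optimal_cong[OF p(2), of w "ra u Wt" X] p(3) by simp
  then show "\<exists>X. robust_optimal n a b w X \<and> (\<forall>l<n. ra t Out l = (if l \<in> X then 1 else 0))"
    using d(1) t by blast
qed

text \<open>The test for \<open>n = 0\<close> compares \<open>n + I[1]\<close> with \<open>I[1]\<close>, as no register is free to hold a 0.\<close>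

definition solver :: scom where
  "solver = Sq (Blk [IAdd 0 0 1]) (Ite (TI 0 1) (Blk [])
     (Sq (Blk [ISub 0 0 1]) (Sq prologue (Sq (compile 0 algorithm) epilogue))))"

lemma solver_correct:
  assumes ab: "\<forall>j<n. a j \<le> b j" and w: "\<forall>j<n. 0 \<le> w j"
  shows "terminates solver (mem_of (init n a b w)) (2000 * (n + 1) + time (n + 2) algorithm)
    (\<lambda>m. robust_optimal n a b w {j. j < n \<and> fst m j \<noteq> 0})"
proof -
  let ?Q = "\<lambda>m :: mem. robust_optimal n a b w {j. j < n \<and> fst m j \<noteq> 0}"
  obtain I R where IR: "mem_of (init n a b w) = (I, R)" by (cases "mem_of (init n a b w)")
  have I0: "I 0 = int n" using IR by (auto simp: mem_of_def init_def)
  let ?m1 = "(I(0 := int n + I 1), R)"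
  have 1: "terminates (Blk [IAdd 0 0 1]) (I, R) 1 (\<lambda>m. m = ?m1)"
    by (intro terminates_Blk) (simp_all add: I0)
  have main: "terminates (Sq prologue (Sq (compile 0 algorithm) epilogue)) (I, R)
    (1000 * n + (time (n + 2) algorithm + (13 * n + 100))) ?Q" if n: "1 \<le> n"
  proof (rule terminates_Sq[OF prologue_correct[OF n, of a b w, unfolded IR]])
    fix m assume "\<exists>s. represents (n + 2) s m \<and> iv s Jobs = n \<and> (\<forall>j<n. ia s Beg j = a j) \<and>
      (\<forall>j<n. ia s End j = b j) \<and> (\<forall>j<n. ra s Wt j = w j)"
    then obtain s where s: "represents (n + 2) s m" "iv s Jobs = n" "\<forall>j<n. ia s Beg j = a j"
      "\<forall>j<n. ia s End j = b j" "\<forall>j<n. ra s Wt j = w j" by blast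
    let ?t = "sem (n + 2) algorithm s"
    note alg = algorithm_correct[OF s(2-5) ab w]
    obtain X where X: "robust_optimal n a b w X" "\<forall>l<n. ra ?t Out l = (if l \<in> X then 1 else 0)"
      using alg(2) by blast
    have c: "terminates (compile 0 algorithm) m (time (n + 2) algorithm) (represents (n + 2) ?t)"
      using compile_correct[OF s(1), of algorithm 0] unfolding terminates_def by blast
    show "terminates (Sq (compile 0 algorithm) epilogue) m (time (n + 2) algorithm + (13 * n + 100)) ?Q"
    proof (rule terminates_Sq[OF c])
      fix m' assume m': "represents (n + 2) ?t m'"
      have jobs: "fst m' 8 = int n"
      proof -
        have "fst m' (iaddr Jobs) = int (iv ?t Jobs)" using m' unfolding represents_def by blast
        then show ?thesis using alg(1) by simp
      qed
      have out: "snd m' (8 * i + 4) = ra ?t Out i" for i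
      proof -
        have "snd m' (8 * i + rbase Out) = ra ?t Out i" using m' unfolding represents_def by blast
        then show ?thesis by simp
      qed
      have "X \<subseteq> {..<n}" using X(1) by (simp add: robust_optimal_def feasible_def)
      then have "?Q m''" if "\<forall>j<n. fst m'' j \<noteq> 0 \<longleftrightarrow> 0 < ra ?t Out j" for m'' :: mem
      proof -
        have "{j. j < n \<and> fst m'' j \<noteq> 0} = X" using that X(2) \<open>X \<subseteq> {..<n}\<close> by (auto split: if_splits)
        then show ?thesis using X(1) by simp
      qed
      then show "terminates epilogue m' (13 * n + 100) ?Q"
        using terminates_mono[OF epilogue_correct[OF jobs out], of "13 * n + 100" ?Q] by simp
    qed
  qed
  have 2: "terminates (Ite (TI 0 1) (Blk []) (Sq (Blk [ISub 0 0 1]) (Sq prologue (Sq (compile 0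
    algorithm) epilogue))))
      m (1 + (1000 * n + (time (n + 2) algorithm + (13 * n + 100))) + 2) ?Q" if "m = ?m1" for m
  proof (rule terminates_Ite)
    assume "holds (TI 0 1) m"
    then have "n = 0" using that by simp
    \<comment> \<open>Without jobs the output set is empty whatever the registers contain, and the
      empty set is the only feasible one.\<close>
    then have "?Q m" by (simp add: robust_optimal_def feasible_def)
    then show "terminates (Blk []) m (1 + (1000 * n + (time (n + 2) algorithm + (13 * n + 100)))) ?Q"
      by (intro terminates_Blk) simp_all
  next
    assume "\<not> holds (TI 0 1) m"
    then have n: "1 \<le> n" using that by simp
    have "terminates (Blk [ISub 0 0 1]) m 1 (\<lambda>m. m = (I, R))"
      by (intro terminates_Blk) (use that I0 in \<open>auto simp: fun_eq_iff\<close>)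
    then show "terminates (Sq (Blk [ISub 0 0 1]) (Sq prologue (Sq (compile 0 algorithm) epilogue))) m
      (1 + (1000 * n + (time (n + 2) algorithm + (13 * n + 100)))) ?Q"
      by (rule terminates_Sq) (use main[OF n] in simp)
  qed
  have "terminates solver (I, R) (1 + (1 + (1000 * n + (time (n + 2) algorithm + (13 * n + 100))) +
    2)) ?Q"
    unfolding solver_def by (rule terminates_Sq[OF 1 2])
  then show ?thesis unfolding IR by (rule terminates_mono) auto
qed

theorem theorem6:
  "\<exists>prog :: instr list. \<exists>c d :: nat.
     \<forall>n a b w. (\<forall>j<n. a j \<le> b j) \<and> (\<forall>j<n. 0 \<le> w j) \<longrightarrow>
       (let s = run prog (c * (input_size n a b + 1) ^ d) (init n a b w)
        in halted prog s \<and> robust_optimal n a b w (ram_output n s))"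
proof -
  obtain C k where C: "\<And>N. time N algorithm \<le> C * (N + 1) ^ k" using time_polynomial by blast
  \<comment> \<open>The bound of the algorithm at \<open>n + 2\<close> has base
    \<open>n + 3\<close>, which is at most 3 times the input size plus 1; this gives the factor
    \<open>3 ^ k\<close>. The exponent \<open>Suc k\<close> is at least 1 and thus also absorbs the
    linear cost of input and output.\<close>
  let ?c = "2000 + C * 3 ^ k" and ?d = "Suc k"
  have bound: "2000 * (n + 1) + time (n + 2) algorithm \<le> ?c * (input_size n a b + 1) ^ ?d" for n a b
  proof -
    let ?x = "input_size n a b + 1"
    have x: "n + 1 \<le> ?x" "1 \<le> ?x" by (simp_all add: input_size_def)
    have "time (n + 2) algorithm \<le> C * (3 * ?x) ^ k"
      using C[of "n + 2"] x(1) by (elim order_trans) (intro mult_left_mono power_mono; simp)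
    also have "\<dots> = C * 3 ^ k * ?x ^ k" by (simp only: power_mult_distrib mult.assoc)
    also have "\<dots> \<le> C * 3 ^ k * ?x ^ ?d" using x(2) by (intro mult_left_mono power_increasing) simp_all
    finally have t: "time (n + 2) algorithm \<le> C * 3 ^ k * ?x ^ ?d" .
    have "n + 1 \<le> ?x ^ 1" using x(1) by simp
    also have "\<dots> \<le> ?x ^ ?d" using x(2) by (intro power_increasing) simp_all
    finally have "2000 * (n + 1) \<le> 2000 * ?x ^ ?d" by simp
    then have "2000 * (n + 1) + time (n + 2) algorithm \<le> 2000 * ?x ^ ?d + C * 3 ^ k * ?x ^ ?d"
      using t by (rule add_mono)
    also have "\<dots> = ?c * ?x ^ ?d" by (rule distrib_right[symmetric])
    finally show ?thesis .
  qed
  have "halted (assemble 0 solver) s \<and> robust_optimal n a b w (ram_output n s)"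
    if ab: "\<forall>j<n. a j \<le> b j" and w: "\<forall>j<n. 0 \<le> w j"
      and s: "s = run (assemble 0 solver) (?c * (input_size n a b + 1) ^ ?d) (init n a b w)" for n a
        b w s
  proof -
    obtain t m where t: "t \<le> 2000 * (n + 1) + time (n + 2) algorithm"
      "big_step solver (mem_of (init n a b w)) t m" "robust_optimal n a b w {j. j < n \<and> fst m j \<noteq> 0}"
      using solver_correct[OF ab w] unfolding terminates_def by blast
    have "pc (init n a b w) = 0" by (simp add: init_def)
    note r = big_step_run[OF t(2) this order_trans[OF t(1) bound[of n a b]], folded s]
    have "ram_output n s = {j. j < n \<and> fst m j \<noteq> 0}"
      using r(2) by (auto simp: ram_output_def mem_of_def)
    then show ?thesis using r(1) t(3) by simp
  qed
  then show ?thesis unfolding Let_def by blast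
qed

end
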